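(* Let $f_0\in\mathcal{C}^2([0,+\infty))$, $f_1\in\mathcal{C}^1([0,+\infty))$ be compactly supported functions with supports contained in $[0,R]$ for some $R>0$, with $f_0'(0)=0$. Let $\mu:[0,+\infty)\to[0,+\infty)$ be a modulus of continuity such that: (i) $\mu$ does not satisfy the Dini condition, i.e. $\int_0^{\tau_0}\frac{\mu(\tau)}{\tau}\,\mathrm{d}\tau=+\infty$ for some (and, then, for any) $\tau_0>0$; (ii) $\mu\in\mathcal{C}^2((0,+\infty))$ and there exists $\tau_1>0$ such that $|\mu^{(k)}(\tau)|\lesssim\tau^{-k}\mu(\tau)$ for any $\tau\in(0,\tau_1)$ and $k=1,2$. Let $\mathcal{H}:(0,\tau_0]\to[0,+\infty)$ be the decreasing function $\mathcal{H}(\tau)=\int_\tau^{\tau_0}\frac{\mu(\sigma)}{\sigma}\,\mathrm{d}\sigma$. Then there exist $\varepsilon_0=\varepsilon_0(f_0,f_1,R,\mu)>0$ and three constants $K,k_1,k_2>0$ depending on $f_0,f_1,R$ such that for any $\varepsilon\in(0,\varepsilon_0]$ and any $T>0$ with $$T\leqslant K\varepsilon\left[\mathcal{H}^{-1}\left(k_1\varepsilon^{-1}+\mathcal{H}(k_2\varepsilon)\right)\right]^{-1},$$ the semilinear Cauchy problem (radially symmetric wave equation in space dimension $3$) $$\begin{cases}u_{tt}-u_{rr}-\frac{2}{r}u_r=|u_t|^2\mu(|u_t|),& r\geqslant 0,\ t>0,\\ u(0,r)=\varepsilon f_0(r),\quad u_t(0,r)=\varepsilon f_1(r),& r\geqslant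 0,\end{cases}$$ has a uniquely determined local (in time) classical solution $u=u(t,r)$ such that $u\in\mathcal{C}^1([0,T]\times[0,+\infty))$ and $ru(t,r)\in\mathcal{C}^2([0,T]\times[0,+\infty))$, subject to the support condition $\mathrm{supp}\,u\subset\{(t,r)\in[0,T]\times[0,+\infty):\ r\leqslant t+R\}$, and satisfying, for any $t\in[0,T]$ and $r\geqslant 0$ with $r\leqslant t+R$, the estimates $$|\partial^\alpha u(t,r)|\lesssim\varepsilon\,\|(f_0,f_0',f_0'',f_1,f_1')\|_{L^\infty([0,+\infty))}\,(t-r+2R)^{-1}\qquad\forall\alpha\in\mathbb{N}^2:\ |\alpha|=0,1,$$ $$|\partial^\alpha(ru(t,r))|\lesssim\varepsilon\,\|(f_0,f_0',f_0'',f_1,f_1')\|_{L^\infty([0,+\infty))}\,(t-r+2R)^{-1}\qquad\forall\alpha\in\mathbb{N}^2:\ |\alpha|=1,2,$$ where $\partial=(\partial_t,\partial_r)$. In other words, the lifespan $T_\varepsilon$ of the local (in time) classical solution $u$ satisfies the lower bound estimate $$T_\varepsilon\geqslant K\varepsilon\left[\mathcal{H}^{-1}\left(k_1\varepsilon^{-1}+\mathcal{H}(k_2\varepsilon)\right)\right]^{-1}.$$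
   Context: A modulus of continuity is a continuous, concave and increasing function $\mu:[0,+\infty)\to[0,+\infty)$ with $\mu(0)=0$. It satisfies the Dini condition if $\int_0^{\tau_0}\frac{\mu(\tau)}{\tau}\,\mathrm{d}\tau<+\infty$ for some (equivalently, for any) $\tau_0>0$. When the Dini condition fails, $\mathcal{H}:(0,\tau_0]\to[0,+\infty)$ is invertible, and $\mathcal{H}^{-1}:[0,+\infty)\to(0,\tau_0]$ denotes its inverse. The notation $f\lesssim g$ means that there is a positive constant $C$ with $f\leqslant Cg$; in hypothesis (ii) $C$ is independent of $\tau$, and in the estimates for the solution $C$ is independent of $t$, $r$, $T$ and $\varepsilon$. The lifespan $T_\varepsilon$ of a local solution is its maximal existence time. Since $u$ is only required to be $\mathcal{C}^1$ with $ru\in\mathcal{C}^2$, the equation is understood in its equivalent form (multiplied by $r$) $(ru)_{tt}-(ru)_{rr}=r|u_t|^2\mu(|u_t|)$. *)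

theory Defs
  imports "HOL-Analysis.Analysis"
begin

text \<open>
  Functions on \<open>[0,\<infinity>)\<close> and on \<open>[0,T] \<times> [0,\<infinity>)\<close> are represented by total functions on \<open>real\<close>
  and \<open>real \<times> real\<close> (curried); only their values on the stated domain are ever used.
  Derivatives are taken within the domain, so they are one-sided at boundary points.
\<close>

subsection \<open>Derivatives and \<open>C\<^sup>k\<close> classes on domains with boundary\<close>

definition deriv_within :: "real set \<Rightarrow> (real \<Rightarrow> real) \<Rightarrow> real \<Rightarrow> real" where
  "deriv_within S f = (\<lambda>x. vector_derivative f (at x within S))"

primrec Ck_on :: "nat \<Rightarrow> real set \<Rightarrow> (real \<Rightarrow> real) \<Rightarrow> bool" where
  "Ck_on 0 S f \<longleftrightarrow> continuous_on S f"
| "Ck_on (Suc k) S f \<longleftrightarrow> f differentiable_on S \<and> Ck_on k S (deriv_within S f)"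

definition pd_t :: "real \<Rightarrow> (real \<Rightarrow> real \<Rightarrow> real) \<Rightarrow> real \<Rightarrow> real \<Rightarrow> real" where
  "pd_t T u = (\<lambda>t r. deriv_within {0..T} (\<lambda>s. u s r) t)"

definition pd_r :: "(real \<Rightarrow> real \<Rightarrow> real) \<Rightarrow> real \<Rightarrow> real \<Rightarrow> real" where
  "pd_r u = (\<lambda>t r. deriv_within {0..} (u t) r)"

definition pd :: "real \<Rightarrow> nat \<Rightarrow> nat \<Rightarrow> (real \<Rightarrow> real \<Rightarrow> real) \<Rightarrow> real \<Rightarrow> real \<Rightarrow> real" where
  "pd T a b u = (pd_t T ^^ a) ((pd_r ^^ b) u)"

text \<open>
  Class \<open>C\<^sup>k\<close> on \<open>[0,T] \<times> [0,\<infinity>)\<close> (for \<open>T > 0\<close>): all partial derivatives up to order \<open>k\<close>, in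
  whatever order of differentiation, exist and are continuous up to the boundary.
\<close>

primrec Ck2_on :: "nat \<Rightarrow> real \<Rightarrow> (real \<Rightarrow> real \<Rightarrow> real) \<Rightarrow> bool" where
  "Ck2_on 0 T u \<longleftrightarrow> continuous_on ({0..T} \<times> {0..}) (\<lambda>(t, r). u t r)"
| "Ck2_on (Suc k) T u \<longleftrightarrow>
     continuous_on ({0..T} \<times> {0..}) (\<lambda>(t, r). u t r) \<and>
     (\<forall>r\<ge>0. (\<lambda>s. u s r) differentiable_on {0..T}) \<and>
     (\<forall>t\<in>{0..T}. u t differentiable_on {0..}) \<and>
     Ck2_on k T (pd_t T u) \<and> Ck2_on k T (pd_r u)"

text \<open>
  The supremum norm over \<open>[0,\<infinity>)\<close> of the vector \<open>(f\<^sub>0, f\<^sub>0', f\<^sub>0'', f\<^sub>1, f\<^sub>1')\<close>. Each component is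
  continuous when \<open>f\<^sub>0\<close> is \<open>C\<^sup>2\<close> and \<open>f\<^sub>1\<close> is \<open>C\<^sup>1\<close>, so this is its \<open>L\<^sup>\<infinity>\<close> norm.
\<close>

definition data_norm :: "(real \<Rightarrow> real) \<Rightarrow> (real \<Rightarrow> real) \<Rightarrow> real" where
  "data_norm f0 f1 =
     (SUP r\<in>{0..}. Max {\<bar>f0 r\<bar>, \<bar>deriv_within {0..} f0 r\<bar>, \<bar>(deriv_within {0..} ^^ 2) f0 r\<bar>,
                        \<bar>f1 r\<bar>, \<bar>deriv_within {0..} f1 r\<bar>})"


subsection \<open>Moduli of continuity\<close>

definition modulus_of_continuity :: "(real \<Rightarrow> real) \<Rightarrow> bool" where
  "modulus_of_continuity \<mu> \<longleftrightarrow>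
     continuous_on {0..} \<mu> \<and> concave_on {0..} \<mu> \<and> mono_on {0..} \<mu> \<and>
     \<mu> ` {0..} \<subseteq> {0..} \<and> \<mu> 0 = 0"

definition dini :: "(real \<Rightarrow> real) \<Rightarrow> bool" where
  "dini \<mu> \<longleftrightarrow> (\<exists>\<tau>\<^sub>0>0. (\<integral>\<^sup>+\<tau>\<in>{0<..\<tau>\<^sub>0}. ennreal (\<mu> \<tau> / \<tau>) \<partial>lborel) < \<infinity>)"

definition symbol_like :: "(real \<Rightarrow> real) \<Rightarrow> bool" where
  "symbol_like \<mu> \<longleftrightarrow>
     Ck_on 2 {0<..} \<mu> \<and>
     (\<exists>\<tau>\<^sub>1>0. \<forall>k\<in>{1, 2}. \<exists>C>0. \<forall>\<tau>\<in>{0<..<\<tau>\<^sub>1}.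
        \<bar>(deriv_within {0<..} ^^ k) \<mu> \<tau>\<bar> \<le> C * (\<mu> \<tau> / \<tau> ^ k))"

definition dini_H :: "(real \<Rightarrow> real) \<Rightarrow> real \<Rightarrow> real \<Rightarrow> real" where
  "dini_H \<mu> \<tau>\<^sub>0 \<tau> = integral {\<tau>..\<tau>\<^sub>0} (\<lambda>\<sigma>. \<mu> \<sigma> / \<sigma>)"

definition dini_H_inv :: "(real \<Rightarrow> real) \<Rightarrow> real \<Rightarrow> real \<Rightarrow> real" where
  "dini_H_inv \<mu> \<tau>\<^sub>0 = the_inv_into {0<..\<tau>\<^sub>0} (dini_H \<mu> \<tau>\<^sub>0)"


subsection \<open>The radial Cauchy problem in space dimension three\<close>

text \<open>
  Since only \<open>r u\<close> is twice differentiable, the equation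
  \<open>u\<^sub>t\<^sub>t - u\<^sub>r\<^sub>r - (2/r) u\<^sub>r = |u\<^sub>t|\<^sup>2 \<mu>(|u\<^sub>t|)\<close> is imposed after multiplication by \<open>r\<close>.
\<close>

definition classical_solution ::
  "(real \<Rightarrow> real) \<Rightarrow> (real \<Rightarrow> real) \<Rightarrow> (real \<Rightarrow> real) \<Rightarrow> real \<Rightarrow> (real \<Rightarrow> real \<Rightarrow> real) \<Rightarrow> bool" where
  "classical_solution \<mu> u\<^sub>0 u\<^sub>1 T u \<longleftrightarrow>
     Ck2_on 1 T u \<and> Ck2_on 2 T (\<lambda>t r. r * u t r) \<and>
     (\<forall>t\<in>{0<..T}. \<forall>r\<ge>0.
        pd T 2 0 (\<lambda>t r. r * u t r) t r - pd T 0 2 (\<lambda>t r. r * u t r) t r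
          = r * (\<bar>pd_t T u t r\<bar>\<^sup>2 * \<mu> \<bar>pd_t T u t r\<bar>)) \<and>
     (\<forall>r\<ge>0. u 0 r = u\<^sub>0 r \<and> pd_t T u 0 r = u\<^sub>1 r)"

definition lifespan :: "(real \<Rightarrow> real) \<Rightarrow> (real \<Rightarrow> real) \<Rightarrow> (real \<Rightarrow> real) \<Rightarrow> ereal" where
  "lifespan \<mu> u\<^sub>0 u\<^sub>1 = Sup {ereal T | T. T > 0 \<and> (\<exists>u. classical_solution \<mu> u\<^sub>0 u\<^sub>1 T u)}"

end

theory Submission
  imports Defs
begin

text \<open>
  Put \<open>v = r u\<close> and extend \<open>v\<close> oddly to \<open>r < 0\<close>. On the line it solves
  \<open>v\<^sub>t\<^sub>t - v\<^sub>r\<^sub>r = F = r G(w)\<close> with \<open>w = u\<^sub>t = v\<^sub>t / r\<close> and \<open>G(s) = s\<^sup>2 \<mu>(\<bar>s\<bar>)\<close>. Because \<open>v\<close> is odd, the single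
  function \<open>a = v\<^sub>t + v\<^sub>r\<close> determines everything: \<open>v\<^sub>t\<close> and \<open>v\<^sub>r\<close> are its odd and even parts, \<open>u\<close> is the
  mean of \<open>a(t, \<cdot>)\<close> over \<open>[-r, r]\<close>, and \<open>w\<close> is the mean of \<open>\<alpha> = a\<^sub>r\<close>. The equation becomes the transport
  equation \<open>a\<^sub>t - a\<^sub>r = F\<close>. Differentiating in \<open>r\<close> and using that \<open>(r w)\<^sub>r\<close> is the even part of \<open>\<alpha>\<close>,
  one gets \<open>F\<^sub>r = G(w) + G'(w) ((r w)\<^sub>r - w)\<close>, which contains no derivative of \<open>\<alpha>\<close>. Hence \<open>\<alpha>\<close> solves a closed
  integral equation along the characteristics \<open>r + t = const\<close>, with no singularity at \<open>r = 0\<close>.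

  The a priori bound uses the weight \<open>\<omega> = 1 / (t - \<bar>r\<bar> + 2 R)\<close> on \<open>\<bar>r\<bar> \<le> t + R\<close>. If \<open>\<bar>\<alpha>\<bar>\<close> and \<open>\<bar>r w\<bar>\<close> are
  at most \<open>Q \<omega>\<close>, then \<open>(1 + \<bar>r\<bar>) \<bar>w\<bar> \<le> 2 Q \<omega>\<close>, and both \<open>F\<close> and \<open>F\<^sub>r\<close> are at most \<open>14 Q\<^sup>2 \<omega>\<^sup>2 h(r)\<close> with
  \<open>h(r) = \<mu>(\<kappa> / (1 + \<bar>r\<bar>)) / (1 + \<bar>r\<bar>)\<close> and \<open>\<kappa>\<close> proportional to \<open>\<epsilon>\<close> (\<open>forcing_bounds\<close>). Integration along a
  characteristic returns \<open>\<omega>\<close> times a multiple of \<open>Q\<^sup>2 (\<integral>h + \<mu>(\<kappa>))\<close> (\<open>duhamel_le\<close>). The substitution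
  \<open>\<sigma> = \<kappa> / (1 + y)\<close> turns \<open>\<integral>h\<close> over \<open>\<bar>y\<bar> \<le> 2 T + R\<close> into \<open>2 (H(\<kappa> / (1 + 2 T + R)) - H(\<kappa>))\<close>. Since \<open>Q\<close> is a
  multiple of \<open>\<epsilon>\<close>, the bound closes as long as this difference is at most a small constant times \<open>1 / \<epsilon>\<close>,
  and that is the stated restriction on \<open>T\<close> (\<open>weight_integral_le\<close>).

  Concavity gives \<open>\<tau> \<mu>'(\<tau>) \<le> \<mu>(\<tau>)\<close>, hence \<open>\<bar>G'(s)\<bar> \<le> 3 \<bar>s\<bar> \<mu>(\<bar>s\<bar>)\<close>; the constants of the a priori bound are
  therefore the same for all moduli. The bounds on \<open>\<mu>''\<close> make \<open>G'\<close> locally Lipschitz, so the integral equation is a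
  contraction for a norm with an exponential weight in time (\<open>fixed_point_exists\<close>). Uniqueness follows from a
  Gronwall argument along characteristics in backward cones (\<open>characteristic_gronwall\<close>).
\<close>

section \<open>Integrals along characteristics\<close>

text \<open>
  Derivatives are one-sided on the boundary of the strip, so the chain rule is stated relative to sets.
  Continuity of one of the two partial derivatives already gives total differentiability.
\<close>

lemma has_real_derivative_along_curve:
  fixes f ft fy :: "real \<Rightarrow> real \<Rightarrow> real"
  assumes ft: "((\<lambda>s. f s (c t)) has_real_derivative ft t (c t)) (at t within X)"
    and fy: "\<And>s y. s \<in> X \<Longrightarrow> y \<in> Y \<Longrightarrow> ((\<lambda>y. f s y) has_real_derivative fy s y) (at y within Y)"
    and cont: "continuous_on (X \<times> Y) (\<lambda>(s, y). fy s y)"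
    and X: "S \<subseteq> X" "t \<in> S" and Y: "convex Y" "c ` S \<subseteq> Y"
    and c: "(c has_real_derivative c') (at t within S)"
  shows "((\<lambda>s. f s (c s)) has_real_derivative ft t (c t) + fy t (c t) * c') (at t within S)"
proof -
  have tX: "t \<in> X" and cY: "c t \<in> Y" using X Y by auto
  have D: "((\<lambda>(x, y). f x y) has_derivative
      (\<lambda>(tx, ty). ft t (c t) * tx + blinfun_apply (blinfun_mult_left (fy t (c t))) ty))
      (at (t, c t) within X \<times> Y)"
  proof (rule has_derivative_partialsI[where fy="\<lambda>x y. blinfun_mult_left (fy x y)"])
    show "((\<lambda>x. f x (c t)) has_derivative (*) (ft t (c t))) (at t within X)"
      using ft by (simp add: has_field_derivative_def)
    show "((\<lambda>y. f x y) has_derivative blinfun_apply (blinfun_mult_left (fy x y))) (at y within Y)"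
      if "x \<in> X" "y \<in> Y" for x y
      using fy[OF that]
      by (rule has_field_derivative_imp_has_derivative[THEN has_derivative_eq_rhs]) 
         (auto simp: fun_eq_iff mult.commute)
    show "continuous (at (t, c t) within X \<times> Y) (\<lambda>(x, y). blinfun_mult_left (fy x y))"
    proof -
      have "continuous (at (t, c t) within X \<times> Y) (\<lambda>(x, y). fy x y)"
        using cont tX cY by (auto simp: continuous_on_eq_continuous_within)
      then have "continuous (at (t, c t) within X \<times> Y) (\<lambda>p. blinfun_mult_left ((\<lambda>(x, y). fy x y) p))"
        by (rule bounded_linear.continuous[OF bounded_linear_blinfun_mult_left])
      then show ?thesis by (simp add: case_prod_unfold)
    qed
  qed (use cY Y in auto)
  have C: "((\<lambda>s. (s, c s)) has_derivative (\<lambda>h. (h, c' * h))) (at t within S)"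
    using c unfolding has_field_derivative_def by (intro has_derivative_Pair has_derivative_ident)
  have "((\<lambda>s. (\<lambda>(x, y). f x y) (s, c s)) has_derivative
      (\<lambda>h. (\<lambda>(tx, ty). ft t (c t) * tx + blinfun_apply (blinfun_mult_left (fy t (c t))) ty) (h, c' * h)))
      (at t within S)"
    by (rule has_derivative_in_compose[OF C has_derivative_subset[OF D]]) (use X Y in auto)
  then show ?thesis
    by (simp add: has_field_derivative_def) (erule has_derivative_eq_rhs, auto simp: fun_eq_iff algebra_simps)
qed


lemma continuous_on_uncurried_compose:
  fixes f :: "real \<Rightarrow> real \<Rightarrow> real"
  assumes "continuous_on (X \<times> Y) (\<lambda>(t, r). f t r)" "continuous_on Z g" "continuous_on Z h"
    and "\<And>z. z \<in> Z \<Longrightarrow> g z \<in> X" "\<And>z. z \<in> Z \<Longrightarrow> h z \<in> Y"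
  shows "continuous_on Z (\<lambda>z. f (g z) (h z))"
proof -
  have "continuous_on Z (\<lambda>z. (\<lambda>(t, r). f t r) (g z, h z))"
    by (rule continuous_on_compose2[OF assms(1)]) (use assms(2-) in \<open>auto intro!: continuous_on_Pair\<close>)
  then show ?thesis by simp
qed

lemma has_integral_of_derivative:
  fixes f B :: "real \<Rightarrow> real"
  assumes "a \<le> b" "\<And>x. x \<in> {a..b} \<Longrightarrow> (B has_real_derivative f x) (at x within {a..b})"
  shows "(f has_integral (B b - B a)) {a..b}"
  using assms by (intro fundamental_theorem_of_calculus) (auto simp: has_real_derivative_iff_has_vector_derivative)

text \<open>
  With the endpoint moved into the integrand, joint continuity in the endpoint and in further parameters is
  continuity of a parameter integral over a fixed interval.
\<close>

lemma integral_rescale_unit: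
  fixes f :: "real \<Rightarrow> real"
  assumes t: "0 \<le> t" and f: "continuous_on {0..t} f"
  shows "integral {0..t} f = t * integral {0..1} (\<lambda>l. f (t * l))"
proof -
  define B where "B x = integral {0..x} f" for x
  have B: "(B has_real_derivative f x) (at x within {0..t})" if "x \<in> {0..t}" for x
    unfolding B_def by (rule integral_has_real_derivative[OF f that])
  have tl: "t * l \<in> {0..t}" if "l \<in> {0..1}" for l
    using that t by (auto intro: mult_left_le)
  have "((\<lambda>l. t * f (t * l)) has_integral (B (t * 1) - B (t * 0))) {0..1}"
  proof (rule has_integral_of_derivative)
    fix l :: real assume l: "l \<in> {0..1}"
    have "((\<lambda>l. B (t * l)) has_real_derivative f (t * l) * t) (at l within {0..1})"
    proof (rule DERIV_image_chain[of B, unfolded o_def])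
      show "(B has_real_derivative f (t * l)) (at (t * l) within (*) t ` {0..1})"
        by (rule DERIV_subset[OF B[OF tl[OF l]]]) (use tl in auto)
    qed (auto intro!: derivative_eq_intros)
    then show "((\<lambda>l. B (t * l)) has_real_derivative t * f (t * l)) (at l within {0..1})"
      by (simp add: mult.commute)
  qed simp
  then have "integral {0..1} (\<lambda>l. t * f (t * l)) = B t - B 0" by (auto dest: integral_unique)
  then show ?thesis by (simp add: B_def)
qed

text \<open>
  With \<open>p = r + t\<close> this is the solution with zero data of the transport equation \<open>a\<^sub>t - a\<^sub>r = S\<close>, as a function
  of \<open>t\<close> and of the label \<open>p\<close> of the characteristic.
\<close>

definition duhamel :: "(real \<Rightarrow> real \<Rightarrow> real) \<Rightarrow> real \<Rightarrow> real \<Rightarrow> real" where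
  "duhamel S t p = integral {0..t} (\<lambda>s. S s (p - s))"

context
  fixes T :: real and S :: "real \<Rightarrow> real \<Rightarrow> real"
  assumes S: "continuous_on ({0..T} \<times> UNIV) (\<lambda>(t, r). S t r)"
begin

lemma continuous_along_characteristic: "continuous_on {0..T} (\<lambda>s. S s (p - s))"
  by (intro continuous_on_uncurried_compose[OF S] continuous_intros) auto

lemma integrable_along_characteristic: "t \<in> {0..T} \<Longrightarrow> (\<lambda>s. S s (p - s)) integrable_on {0..t}"
  by (intro integrable_continuous_real continuous_on_subset[OF continuous_along_characteristic]) auto

lemma continuous_on_duhamel: "continuous_on ({0..T} \<times> UNIV) (\<lambda>(t, p). duhamel S t p)"
proof -
  have "continuous_on ({0..T} \<times> UNIV) (\<lambda>x. integral (cbox 0 1) ((\<lambda>x l. S (fst x * l) (snd x - fst x * l)) x))"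
    by (rule integral_continuous_on_param)
       (auto simp: case_prod_unfold mult_le_one
         intro!: continuous_on_uncurried_compose[OF S] continuous_intros mult_left_le order.trans[OF mult_left_le])
  then have "continuous_on ({0..T} \<times> UNIV) (\<lambda>x. fst x * integral {0..1} (\<lambda>l. S (fst x * l) (snd x - fst x * l)))"
    by (auto intro!: continuous_intros simp: cbox_interval)
  then show ?thesis
    by (rule continuous_on_eq)
       (auto simp: duhamel_def intro!: integral_rescale_unit[symmetric] continuous_on_subset[OF continuous_along_characteristic])
qed

lemma duhamel_has_time_derivative:
  assumes "t \<in> {0..T}"
  shows "((\<lambda>t. duhamel S t p) has_real_derivative S t (p - t)) (at t within {0..T})"
  unfolding duhamel_def by (rule integral_has_real_derivative[OF continuous_along_characteristic assms])

lemma duhamel_has_space_derivative: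
  assumes t: "t \<in> {0..T}"
    and B: "\<And>s y. s \<in> {0..T} \<Longrightarrow> ((\<lambda>y. B s y) has_real_derivative S s y) (at y)"
    and Bc: "continuous_on ({0..T} \<times> UNIV) (\<lambda>(t, r). B t r)"
  shows "((\<lambda>p. duhamel B t p) has_real_derivative duhamel S t p) (at p)"
proof -
  have "((\<lambda>p. integral (cbox 0 t) ((\<lambda>p s. B s (p - s)) p)) has_real_derivative
      integral (cbox 0 t) ((\<lambda>p s. S s (p - s)) p)) (at p within UNIV)"
  proof (rule leibniz_rule_field_derivative)
    show "((\<lambda>p. B s (p - s)) has_real_derivative S s (p - s)) (at p within UNIV)"
      if "p \<in> UNIV" "s \<in> cbox 0 t" for p s
      by (rule DERIV_chain2[OF B, THEN DERIV_cong]) (use that t in \<open>auto intro!: derivative_eq_intros\<close>)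
    show "(\<lambda>s. B s (p - s)) integrable_on cbox 0 t" for p
      unfolding cbox_interval
      by (intro integrable_continuous_real continuous_on_uncurried_compose[OF Bc] continuous_intros) (use t in auto)
    show "continuous_on (UNIV \<times> cbox 0 t) (\<lambda>(p, s). S s (p - s))"
      unfolding case_prod_unfold
      by (intro continuous_on_uncurried_compose[OF S] continuous_intros) (use t in auto)
  qed auto
  then show ?thesis by (simp add: duhamel_def)
qed

end

section \<open>Means over symmetric intervals\<close>

text \<open>
  The average of \<open>f\<close> over \<open>[-r, r]\<close>. The parametrisation by a fixed interval makes sense at \<open>r = 0\<close>, where it
  replaces the quotient \<open>v\<^sub>t / r\<close>.
\<close>

definition mean :: "(real \<Rightarrow> real) \<Rightarrow> real \<Rightarrow> real" where
  "mean f r = integral {-1..1} (\<lambda>l. f (l * r)) / 2"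

text \<open>
  The fundamental theorem of calculus for \<open>l \<mapsto> B (l r)\<close>. It trades a mean of \<open>f\<close> for values of a primitive, which
  is how the decay of \<open>r u\<^sub>t\<close> is read off from pointwise bounds for \<open>a\<close>.
\<close>

lemma radius_times_mean:
  assumes B: "\<And>y. (B has_real_derivative f y) (at y)"
  shows "r * mean f r = (B r - B (- r)) / 2"
proof -
  have "((\<lambda>l. r * f (l * r)) has_integral (B (1 * r) - B ((-1) * r))) {-1..1}"
  proof (rule has_integral_of_derivative)
    show "((\<lambda>l. B (l * r)) has_real_derivative r * f (l * r)) (at l within {-1..1})" for l
      by (rule DERIV_chain2[OF B, THEN DERIV_cong]) (auto intro!: derivative_eq_intros)
  qed auto
  then show ?thesis by (simp add: mean_def integral_unique flip: integral_mult_right)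
qed

lemma mean_minus [simp]: "mean f (- r) = mean f r"
proof -
  have "integral {-1..1} (\<lambda>l. f (l * - r)) = integral {-1..1} (\<lambda>l. f (l * r))"
    using Henstock_Kurzweil_Integration.integral_reflect_real[of 1 "-1" "\<lambda>l. f (l * r)"] by simp
  then show ?thesis by (simp add: mean_def)
qed

lemma mean_0 [simp]: "mean f 0 = f 0" by (simp add: mean_def)

lemma abs_mean_le:
  assumes f: "continuous_on UNIV f" and b: "\<And>y. \<bar>y\<bar> \<le> \<bar>r\<bar> \<Longrightarrow> \<bar>f y\<bar> \<le> c"
  shows "\<bar>mean f r\<bar> \<le> c"
proof -
  have "norm (integral {-1..1} (\<lambda>l. f (l * r))) \<le> integral {-1..1} (\<lambda>l::real. c)"
  proof (rule integral_norm_bound_integral)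
    show "(\<lambda>l. f (l * r)) integrable_on {-1..1}"
      by (intro integrable_continuous_real continuous_on_compose2[OF f] continuous_intros) auto
    show "norm (f (l * r)) \<le> c" if "l \<in> {-1..1}" for l
      using that by (auto simp: abs_mult intro!: b mult_left_le_one_le)
  qed auto
  then show ?thesis by (simp add: mean_def)
qed

lemma mean_diff:
  assumes "continuous_on UNIV f" "continuous_on UNIV g"
  shows "mean f r - mean g r = mean (\<lambda>y. f y - g y) r"
proof -
  have "(\<lambda>l. h (l * r)) integrable_on {-1..1}" if "continuous_on UNIV h" for h :: "real \<Rightarrow> real"
    by (intro integrable_continuous_real continuous_on_compose2[OF that] continuous_intros) auto
  then show ?thesis using assms by (simp add: mean_def integral_diff diff_divide_distrib)
qed

lemma radius_times_mean_has_derivative: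
  assumes f: "continuous_on UNIV f"
  shows "((\<lambda>r. r * mean f r) has_real_derivative (f r + f (- r)) / 2) (at r)"
proof -
  obtain B where B: "\<And>y. (B has_real_derivative f y) (at y)"
    using einterval_antiderivative[of "-\<infinity>" "\<infinity>" f] f
    by (auto simp: has_real_derivative_iff_has_vector_derivative continuous_on_eq_continuous_at)
  have "((\<lambda>r. (B r - B (- r)) / 2) has_real_derivative (f r + f (- r)) / 2) (at r)"
    by (auto intro!: derivative_eq_intros DERIV_chain2[OF B] B)
  then show ?thesis by (simp add: radius_times_mean[OF B])
qed

lemma continuous_on_mean:
  fixes f :: "real \<Rightarrow> real \<Rightarrow> real"
  assumes f: "continuous_on (X \<times> UNIV) (\<lambda>(t, r). f t r)"
  shows "continuous_on (X \<times> UNIV) (\<lambda>(t, r). mean (f t) r)"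
proof -
  have "continuous_on (X \<times> UNIV) (\<lambda>x. integral (cbox (-1) 1) ((\<lambda>x l. f (fst x) (l * snd x)) x))"
    by (rule integral_continuous_on_param)
       (auto simp: case_prod_unfold intro!: continuous_on_uncurried_compose[OF f] continuous_intros)
  then show ?thesis by (auto simp: mean_def case_prod_unfold cbox_interval intro!: continuous_intros)
qed

lemma mean_has_time_derivative:
  assumes ft: "\<And>t y. t \<in> X \<Longrightarrow> ((\<lambda>t. f t y) has_real_derivative ft t y) (at t within X)"
    and f: "\<And>t. t \<in> X \<Longrightarrow> continuous_on UNIV (f t)"
    and c: "continuous_on (X \<times> UNIV) (\<lambda>(t, r). ft t r)"
    and X: "t \<in> X" "convex X"
  shows "((\<lambda>t. mean (f t) r) has_real_derivative mean (ft t) r) (at t within X)"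
proof -
  have "((\<lambda>t. integral (cbox (-1) 1) ((\<lambda>t l. f t (l * r)) t)) has_real_derivative
      integral (cbox (-1) 1) ((\<lambda>t l. ft t (l * r)) t)) (at t within X)"
  proof (rule leibniz_rule_field_derivative)
    show "(\<lambda>l. f t (l * r)) integrable_on cbox (-1) 1" if "t \<in> X" for t
      unfolding cbox_interval
      by (intro integrable_continuous_real continuous_on_compose2[OF f[OF that]] continuous_intros) auto
    show "continuous_on (X \<times> cbox (-1) 1) (\<lambda>(t, l). ft t (l * r))"
      unfolding case_prod_unfold
      by (intro continuous_on_uncurried_compose[OF c] continuous_intros) auto
  qed (use ft X in auto)
  then show ?thesis by (auto simp: mean_def cbox_interval intro!: DERIV_cdivide)
qed

text \<open>
  The derivative of the mean of a primitive of \<open>f\<close>; it represents \<open>u\<^sub>r\<close> up to \<open>r = 0\<close>.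
\<close>

definition moment :: "(real \<Rightarrow> real) \<Rightarrow> real \<Rightarrow> real" where
  "moment f r = integral {-1..1} (\<lambda>l. l * f (l * r)) / 2"

lemma mean_has_derivative:
  assumes B: "\<And>y. (B has_real_derivative f y) (at y)" and f: "continuous_on UNIV f"
  shows "(mean B has_real_derivative moment f r) (at r)"
proof -
  have Bc: "continuous_on UNIV B" using B by (auto intro!: DERIV_continuous_on)
  have "((\<lambda>r. integral (cbox (-1) 1) ((\<lambda>r l. B (l * r)) r)) has_real_derivative
      integral (cbox (-1) 1) ((\<lambda>r l. l * f (l * r)) r)) (at r within UNIV)"
  proof (rule leibniz_rule_field_derivative)
    show "((\<lambda>r. B (l * r)) has_real_derivative l * f (l * r)) (at r within UNIV)" for r l
      by (rule DERIV_chain2[OF B, THEN DERIV_cong]) (auto intro!: derivative_eq_intros)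
    show "(\<lambda>l. B (l * r)) integrable_on cbox (-1) 1" for r
      unfolding cbox_interval
      by (intro integrable_continuous_real continuous_on_compose2[OF Bc] continuous_intros) auto
    show "continuous_on (UNIV \<times> cbox (-1) 1) (\<lambda>(r, l). l * f (l * r))"
      unfolding case_prod_unfold by (intro continuous_intros continuous_on_compose2[OF f]) auto
  qed auto
  then show ?thesis by (auto simp: mean_def[abs_def] moment_def cbox_interval intro!: DERIV_cdivide)
qed

lemma continuous_on_moment:
  fixes f :: "real \<Rightarrow> real \<Rightarrow> real"
  assumes f: "continuous_on (X \<times> UNIV) (\<lambda>(t, r). f t r)"
  shows "continuous_on (X \<times> UNIV) (\<lambda>(t, r). moment (f t) r)"
proof -
  have "continuous_on (X \<times> UNIV) (\<lambda>x. integral (cbox (-1) 1) ((\<lambda>x l. l * f (fst x) (l * snd x)) x))"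
    by (rule integral_continuous_on_param)
       (auto simp: case_prod_unfold intro!: continuous_on_uncurried_compose[OF f] continuous_intros)
  then show ?thesis by (auto simp: moment_def case_prod_unfold cbox_interval intro!: continuous_intros)
qed

lemma abs_moment_le:
  assumes f: "continuous_on UNIV f" and b: "\<And>y. \<bar>y\<bar> \<le> \<bar>r\<bar> \<Longrightarrow> \<bar>f y\<bar> \<le> c"
  shows "\<bar>moment f r\<bar> \<le> c"
proof -
  have "norm (integral {-1..1} (\<lambda>l. l * f (l * r))) \<le> integral {-1..1} (\<lambda>l::real. c)"
  proof (rule integral_norm_bound_integral)
    show "(\<lambda>l. l * f (l * r)) integrable_on {-1..1}"
      by (intro integrable_continuous_real continuous_intros continuous_on_compose2[OF f] ) auto
    show "norm (l * f (l * r)) \<le> c" if "l \<in> {-1..1}" for l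
    proof -
      have l: "\<bar>l\<bar> \<le> 1" using that by auto
      have "\<bar>f (l * r)\<bar> \<le> c" using l by (auto simp: abs_mult intro!: b mult_left_le_one_le)
      moreover have "\<bar>l * f (l * r)\<bar> \<le> \<bar>f (l * r)\<bar>" using l by (simp add: abs_mult mult_left_le_one_le)
      ultimately show ?thesis by simp
    qed
  qed auto
  then show ?thesis by (simp add: moment_def)
qed

section \<open>Moduli of continuity\<close>

lemma deriv_within_eqI:
  assumes "(f has_real_derivative D) (at x within S)" "at x within S \<noteq> bot"
  shows "deriv_within S f x = D"
  using assms by (simp add: deriv_within_def vector_derivative_within has_real_derivative_iff_has_vector_derivative)

lemma has_real_derivative_deriv_within:
  assumes "f differentiable_on S" "x \<in> S"
  shows "(f has_real_derivative deriv_within S f x) (at x within S)"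
  using assms unfolding differentiable_on_def deriv_within_def
  by (simp add: has_real_derivative_iff_has_vector_derivative flip: vector_derivative_works)

lemma modulusD:
  assumes "modulus_of_continuity \<mu>"
  shows "continuous_on {0..} \<mu>" "mono_on {0..} \<mu>" "\<And>x. 0 \<le> x \<Longrightarrow> 0 \<le> \<mu> x" "\<mu> 0 = 0" "concave_on {0..} \<mu>"
  using assms by (auto simp: modulus_of_continuity_def)

lemma modulus_mono: "modulus_of_continuity \<mu> \<Longrightarrow> 0 \<le> x \<Longrightarrow> x \<le> y \<Longrightarrow> \<mu> x \<le> \<mu> y"
  by (auto simp: modulus_of_continuity_def mono_on_def)

text \<open>
  A zero \<open>\<tau>\<close> of a nondecreasing modulus makes it vanish on \<open>[0, \<tau>]\<close>, and then the Dini integral over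
  \<open>(0, \<tau>]\<close> is zero.
\<close>

lemma modulus_pos:
  assumes \<mu>: "modulus_of_continuity \<mu>" and nd: "\<not> dini \<mu>" and "\<tau> > 0"
  shows "\<mu> \<tau> > 0"
proof (rule ccontr)
  assume "\<not> \<mu> \<tau> > 0"
  then have "\<mu> \<sigma> = 0" if "0 < \<sigma>" "\<sigma> \<le> \<tau>" for \<sigma>
    using modulus_mono[OF \<mu>, of \<sigma> \<tau>] modulusD(3)[OF \<mu>, of \<sigma>] that by auto
  then have "(\<integral>\<^sup>+\<sigma>\<in>{0<..\<tau>}. ennreal (\<mu> \<sigma> / \<sigma>) \<partial>lborel) = (\<integral>\<^sup>+\<sigma>. 0 \<partial>(lborel :: real measure))"
    by (intro nn_integral_cong) (auto simp: indicator_def)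
  then show False using nd \<open>\<tau> > 0\<close> by (auto simp: dini_def)
qed

lemma continuous_on_modulus_quotient:
  assumes \<mu>: "modulus_of_continuity \<mu>" and "0 < a"
  shows "continuous_on {a..b} (\<lambda>\<sigma>. \<mu> \<sigma> / \<sigma>)"
  using assms by (auto intro!: continuous_intros continuous_on_subset[OF modulusD(1)[OF \<mu>]])

lemma dini_H_diff:
  assumes \<mu>: "modulus_of_continuity \<mu>" and "0 < a" "a \<le> b" "b \<le> \<tau>\<^sub>0"
  shows "dini_H \<mu> \<tau>\<^sub>0 a - dini_H \<mu> \<tau>\<^sub>0 b = integral {a..b} (\<lambda>\<sigma>. \<mu> \<sigma> / \<sigma>)"
  using Henstock_Kurzweil_Integration.integral_combine[OF assms(3,4)
      integrable_continuous_real[OF continuous_on_modulus_quotient[OF \<mu> \<open>0 < a\<close>]]]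
  by (simp add: dini_H_def)

lemma dini_H_antimono:
  assumes \<mu>: "modulus_of_continuity \<mu>" and "0 < a" "a \<le> b" "b \<le> \<tau>\<^sub>0"
  shows "dini_H \<mu> \<tau>\<^sub>0 b \<le> dini_H \<mu> \<tau>\<^sub>0 a"
proof -
  have "0 \<le> integral {a..b} (\<lambda>\<sigma>. \<mu> \<sigma> / \<sigma>)"
    using assms modulusD(3)[OF \<mu>]
    by (intro integral_nonneg integrable_continuous_real continuous_on_modulus_quotient) auto
  then show ?thesis using dini_H_diff[OF assms] by simp
qed

lemma dini_H_strict_antimono:
  assumes \<mu>: "modulus_of_continuity \<mu>" and nd: "\<not> dini \<mu>" and "0 < a" "a < b" "b \<le> \<tau>\<^sub>0"
  shows "dini_H \<mu> \<tau>\<^sub>0 b < dini_H \<mu> \<tau>\<^sub>0 a"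
proof -
  have "integral {a..b} (\<lambda>\<sigma>. \<mu> a / b) \<le> integral {a..b} (\<lambda>\<sigma>. \<mu> \<sigma> / \<sigma>)"
    using assms modulusD(3)[OF \<mu>] modulus_mono[OF \<mu>]
    by (intro integral_le integrable_continuous_real continuous_on_modulus_quotient frac_le) auto
  moreover have "0 < (b - a) * (\<mu> a / b)"
    using modulus_pos[OF \<mu> nd \<open>0 < a\<close>] assms by (intro mult_pos_pos divide_pos_pos) auto
  ultimately show ?thesis using dini_H_diff[OF \<mu> \<open>0 < a\<close>, of b \<tau>\<^sub>0] assms by simp
qed

text \<open>
  Monotone convergence: an upper bound for the integrals over \<open>[1 / n, \<tau>\<^sub>0]\<close> bounds the integral over
  \<open>(0, \<tau>\<^sub>0]\<close>, which contradicts the failure of the Dini condition.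
\<close>

lemma dini_H_unbounded:
  assumes \<mu>: "modulus_of_continuity \<mu>" and nd: "\<not> dini \<mu>" and "\<tau>\<^sub>0 > 0"
  shows "\<exists>\<tau>\<in>{0<..\<tau>\<^sub>0}. y \<le> dini_H \<mu> \<tau>\<^sub>0 \<tau>"
proof (rule ccontr)
  assume "\<not> ?thesis"
  then have less: "dini_H \<mu> \<tau>\<^sub>0 \<tau> \<le> y" if "0 < \<tau>" "\<tau> \<le> \<tau>\<^sub>0" for \<tau> using that by force
  have le_y: "dini_H \<mu> \<tau>\<^sub>0 \<tau> \<le> max y 0" if "0 < \<tau>" for \<tau>
    using less[of \<tau>] that by (cases "\<tau> \<le> \<tau>\<^sub>0") (auto simp: dini_H_def)
  define f where "f n x = ennreal (\<mu> x / x) * indicator {1 / real (Suc n)..\<tau>\<^sub>0} x" for n x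
  have f_eq: "(\<integral>\<^sup>+x. f n x \<partial>lborel) = ennreal (dini_H \<mu> \<tau>\<^sub>0 (1 / real (Suc n)))" for n
  proof -
    let ?I = "{1 / real (Suc n)..\<tau>\<^sub>0}"
    have "(\<integral>\<^sup>+x. f n x \<partial>lborel) = (\<integral>\<^sup>+x\<in>?I. ennreal (\<mu> x / x) \<partial>lborel)" by (simp add: f_def)
    also have "\<dots> = ennreal (integral ?I (\<lambda>x. \<mu> x / x))"
    proof -
      have "0 \<le> \<mu> x / x" if "x \<in> ?I" for x
      proof -
        have "0 < 1 / real (Suc n)" by simp
        then have "0 < x" using that by (meson atLeastAtMost_iff less_le_trans)
        then show ?thesis using modulusD(3)[OF \<mu>, of x] by simp
      qed
      then show ?thesis
        by (intro nn_integral_has_integral_lebesgue' integrable_integral integrable_continuous_real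
            continuous_on_modulus_quotient[OF \<mu>]) auto
    qed
    finally show ?thesis by (simp add: dini_H_def)
  qed
  have SUP_f: "(SUP n. f n x) = ennreal (\<mu> x / x) * indicator {0<..\<tau>\<^sub>0} x" for x
  proof (cases "0 < x \<and> x \<le> \<tau>\<^sub>0")
    case True
    then obtain n where "1 / real (Suc n) < x" using reals_Archimedean[of x] by (auto simp: inverse_eq_divide)
    then have "f n x = ennreal (\<mu> x / x)" using True by (auto simp: f_def)
    moreover have "f m x \<le> ennreal (\<mu> x / x)" for m by (auto simp: f_def indicator_def)
    ultimately have "(SUP n. f n x) = ennreal (\<mu> x / x)"
      by (intro antisym SUP_least) (auto intro: SUP_upper2[of n])
    then show ?thesis using True by simp
  next
    case False
    have "f n x = 0" for n
    proof -
      have "0 < 1 / real (Suc n)" by simp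
      then have "x \<notin> {1 / real (Suc n)..\<tau>\<^sub>0}" using False less_le_trans[of 0 "1 / real (Suc n)" x]
        by (auto simp only: atLeastAtMost_iff)
      then show ?thesis by (simp add: f_def del: of_nat_Suc)
    qed
    then show ?thesis using False by (auto simp: indicator_def)
  qed
  have f_meas: "f n \<in> borel_measurable lborel" for n
  proof -
    have "(\<lambda>x. indicator {1 / real (Suc n)..\<tau>\<^sub>0} x *\<^sub>R (\<mu> x / x)) \<in> borel_measurable borel"
      by (intro borel_measurable_continuous_on_indicator continuous_on_modulus_quotient[OF \<mu>]) auto
    then have "(\<lambda>x. ennreal (indicator {1 / real (Suc n)..\<tau>\<^sub>0} x *\<^sub>R (\<mu> x / x))) \<in> borel_measurable borel"
      by measurable
    also have "(\<lambda>x. ennreal (indicator {1 / real (Suc n)..\<tau>\<^sub>0} x *\<^sub>R (\<mu> x / x))) = f n"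
      by (auto simp: f_def indicator_def fun_eq_iff)
    finally show ?thesis by simp
  qed
  have "incseq f"
  proof (intro incseq_SucI le_funI)
    fix n x
    have "1 / real (Suc (Suc n)) \<le> 1 / real (Suc n)" by (simp add: frac_le)
    then show "f n x \<le> f (Suc n) x" by (auto simp: f_def indicator_def simp del: of_nat_Suc)
  qed
  then have "(\<integral>\<^sup>+x\<in>{0<..\<tau>\<^sub>0}. ennreal (\<mu> x / x) \<partial>lborel) = (SUP n. \<integral>\<^sup>+x. f n x \<partial>lborel)"
    using nn_integral_monotone_convergence_SUP[OF _ f_meas, of "\<lambda>n. n"] by (simp add: SUP_f)
  also have "\<dots> \<le> ennreal (max y 0)"
    unfolding f_eq by (intro SUP_least ennreal_leI le_y) auto
  finally have "dini \<mu>"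
    using \<open>\<tau>\<^sub>0 > 0\<close> unfolding dini_def infinity_ennreal_def
    by (intro exI[of _ \<tau>\<^sub>0] conjI) (auto intro: le_less_trans[OF _ ennreal_less_top])
  with nd show False by simp
qed

text \<open>
  Strict monotonicity gives injectivity; unboundedness and the intermediate value theorem give that every
  nonnegative value is taken.
\<close>

lemma dini_H_inv:
  assumes \<mu>: "modulus_of_continuity \<mu>" and nd: "\<not> dini \<mu>" and "\<tau>\<^sub>0 > 0" and "0 \<le> y"
  shows "dini_H_inv \<mu> \<tau>\<^sub>0 y \<in> {0<..\<tau>\<^sub>0}" "dini_H \<mu> \<tau>\<^sub>0 (dini_H_inv \<mu> \<tau>\<^sub>0 y) = y"
proof -
  have inj: "inj_on (dini_H \<mu> \<tau>\<^sub>0) {0<..\<tau>\<^sub>0}"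
  proof (rule inj_onI)
    fix a b assume "a \<in> {0<..\<tau>\<^sub>0}" "b \<in> {0<..\<tau>\<^sub>0}" "dini_H \<mu> \<tau>\<^sub>0 a = dini_H \<mu> \<tau>\<^sub>0 b"
    then show "a = b"
      using dini_H_strict_antimono[OF \<mu> nd, of a b \<tau>\<^sub>0] dini_H_strict_antimono[OF \<mu> nd, of b a \<tau>\<^sub>0]
      by (cases a b rule: linorder_cases) auto
  qed
  obtain a where a: "0 < a" "a \<le> \<tau>\<^sub>0" "y \<le> dini_H \<mu> \<tau>\<^sub>0 a"
    using dini_H_unbounded[OF \<mu> nd \<open>\<tau>\<^sub>0 > 0\<close>, of y] by auto
  have "continuous_on {a..\<tau>\<^sub>0} (dini_H \<mu> \<tau>\<^sub>0)"
    unfolding dini_H_def[abs_def]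
    by (intro indefinite_integral_continuous_1' integrable_continuous_real
        continuous_on_modulus_quotient[OF \<mu> \<open>0 < a\<close>])
  moreover have "dini_H \<mu> \<tau>\<^sub>0 \<tau>\<^sub>0 = 0" by (simp add: dini_H_def)
  ultimately obtain x where "a \<le> x" "x \<le> \<tau>\<^sub>0" "dini_H \<mu> \<tau>\<^sub>0 x = y"
    using IVT2'[of "dini_H \<mu> \<tau>\<^sub>0" \<tau>\<^sub>0 y a] a \<open>0 \<le> y\<close> by auto
  then have "y \<in> dini_H \<mu> \<tau>\<^sub>0 ` {0<..\<tau>\<^sub>0}" using a by force
  then show "dini_H_inv \<mu> \<tau>\<^sub>0 y \<in> {0<..\<tau>\<^sub>0}" "dini_H \<mu> \<tau>\<^sub>0 (dini_H_inv \<mu> \<tau>\<^sub>0 y) = y"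
    using the_inv_into_into[OF inj, of y "{0<..\<tau>\<^sub>0}"] f_the_inv_into_f[OF inj, of y]
    by (auto simp: dini_H_inv_def)
qed

section \<open>The nonlinearity\<close>

definition nonlin :: "(real \<Rightarrow> real) \<Rightarrow> real \<Rightarrow> real" where
  "nonlin \<mu> s = s\<^sup>2 * \<mu> \<bar>s\<bar>"

text \<open>
  The derivative of the nonlinearity. At \<open>s = 0\<close> both terms vanish, whatever the value of the one-sided derivative
  of \<open>\<mu>\<close> there.
\<close>

definition nonlin' :: "(real \<Rightarrow> real) \<Rightarrow> real \<Rightarrow> real" where
  "nonlin' \<mu> s = 2 * s * \<mu> \<bar>s\<bar> + s * \<bar>s\<bar> * deriv_within {0<..} \<mu> \<bar>s\<bar>"

lemma abs_has_derivative:
  fixes s :: real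
  assumes "s \<noteq> 0"
  shows "(abs has_real_derivative sgn s) (at s)"
proof (cases "s > 0")
  case True
  show ?thesis
    by (rule has_field_derivative_transform_within_open[of "\<lambda>x. x" _ _ "{0<..}"])
       (use True in \<open>auto intro!: derivative_eq_intros\<close>)
next
  case False
  show ?thesis
    by (rule has_field_derivative_transform_within_open[of "\<lambda>x. - x" _ _ "{..<0}"])
       (use False assms in \<open>auto intro!: derivative_eq_intros\<close>)
qed

lemma at_within_Ioi: "0 < \<tau> \<Longrightarrow> at \<tau> within {0<..} = at (\<tau>::real)"
  by (rule at_within_open) auto

context
  fixes \<mu> :: "real \<Rightarrow> real"
  assumes \<mu>: "modulus_of_continuity \<mu>" and sl: "symbol_like \<mu>"
begin

lemma modulus_DERIV: "0 < \<tau> \<Longrightarrow> (\<mu> has_real_derivative deriv_within {0<..} \<mu> \<tau>) (at \<tau>)"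
  using has_real_derivative_deriv_within[of \<mu> "{0<..}" \<tau>] sl
  by (auto simp: symbol_like_def numeral_2_eq_2 at_within_Ioi)

text \<open>
  The tangent at \<open>\<tau>\<close> lies above the graph of a concave function: its value at \<open>0\<close>, where \<open>\<mu>\<close> vanishes, gives the
  upper bound, and its value at \<open>\<tau> + 1\<close> the sign.
\<close>

lemma modulus_deriv_bounds:
  assumes "0 < \<tau>"
  shows "0 \<le> deriv_within {0<..} \<mu> \<tau>" "\<tau> * deriv_within {0<..} \<mu> \<tau> \<le> \<mu> \<tau>"
proof -
  have "convex_on {0..} (\<lambda>x. - \<mu> x)" using modulusD(5)[OF \<mu>] by (simp add: concave_on_def)
  moreover have "\<tau> \<in> interior {0..}" using assms by (simp add: interior_real_atLeast)
  moreover have "((\<lambda>x. - \<mu> x) has_field_derivative - deriv_within {0<..} \<mu> \<tau>) (at \<tau> within {0..})"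
    by (rule DERIV_subset[OF DERIV_minus[OF modulus_DERIV[OF assms]]]) auto
  ultimately have tangent: "- \<mu> x + \<mu> \<tau> \<ge> - deriv_within {0<..} \<mu> \<tau> * (x - \<tau>)" if "0 \<le> x" for x
    using convex_on_imp_above_tangent[of "{0..}" "\<lambda>x. - \<mu> x" \<tau> x] that by force
  show "\<tau> * deriv_within {0<..} \<mu> \<tau> \<le> \<mu> \<tau>"
    using tangent[of 0] modulusD(4)[OF \<mu>] by (simp add: algebra_simps)
  show "0 \<le> deriv_within {0<..} \<mu> \<tau>"
    using tangent[of "\<tau> + 1"] modulus_mono[OF \<mu>, of \<tau> "\<tau> + 1"] assms by (auto simp: algebra_simps)
qed

text \<open>
  The constant does not depend on \<open>\<mu>\<close>; for this reason the same \<open>K\<close>, \<open>k1\<close>, \<open>k2\<close> serve for every modulus.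
\<close>

lemma abs_nonlin'_le: "\<bar>nonlin' \<mu> s\<bar> \<le> 3 * \<bar>s\<bar> * \<mu> \<bar>s\<bar>"
proof (cases "s = 0")
  case False
  then have s: "0 < \<bar>s\<bar>" by simp
  have "\<bar>nonlin' \<mu> s\<bar> \<le> \<bar>2 * s * \<mu> \<bar>s\<bar>\<bar> + \<bar>s * \<bar>s\<bar> * deriv_within {0<..} \<mu> \<bar>s\<bar>\<bar>"
    unfolding nonlin'_def by (rule abs_triangle_ineq)
  also have "\<dots> = 2 * \<bar>s\<bar> * \<mu> \<bar>s\<bar> + \<bar>s\<bar> * (\<bar>s\<bar> * deriv_within {0<..} \<mu> \<bar>s\<bar>)"
    using modulus_deriv_bounds[OF s] modulusD(3)[OF \<mu>, of "\<bar>s\<bar>"] by (simp add: abs_mult)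
  also have "\<dots> \<le> 2 * \<bar>s\<bar> * \<mu> \<bar>s\<bar> + \<bar>s\<bar> * \<mu> \<bar>s\<bar>"
    using modulus_deriv_bounds(2)[OF s] by (intro add_left_mono mult_left_mono) auto
  finally show ?thesis by (simp add: algebra_simps)
qed (simp add: nonlin'_def)

lemma nonlin_has_derivative: "(nonlin \<mu> has_real_derivative nonlin' \<mu> s) (at s)"
proof (cases "s = 0")
  case True
  have "((\<lambda>h. nonlin \<mu> h / h) \<longlongrightarrow> 0) (at 0)"
  proof (rule Lim_null_comparison)
    show "\<forall>\<^sub>F h in at 0. norm (nonlin \<mu> h / h) \<le> \<bar>h\<bar> * \<mu> 1"
    proof -
      have "norm (nonlin \<mu> h / h) \<le> \<bar>h\<bar> * \<mu> 1" if "h \<noteq> 0" "dist h 0 < 1" for h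
      proof -
        have "norm (nonlin \<mu> h / h) = \<bar>h\<bar> * \<mu> \<bar>h\<bar>"
          using that modulusD(3)[OF \<mu>, of "\<bar>h\<bar>"] by (simp add: nonlin_def power2_eq_square abs_mult)
        then show ?thesis using that modulus_mono[OF \<mu>, of "\<bar>h\<bar>" 1] by (simp add: mult_left_mono)
      qed
      then show ?thesis unfolding eventually_at by (intro exI[of _ 1]) auto
    qed
    show "((\<lambda>h. \<bar>h\<bar> * \<mu> 1) \<longlongrightarrow> 0) (at 0)" by (auto intro!: tendsto_eq_intros)
  qed
  then show ?thesis using True by (simp add: DERIV_def nonlin_def nonlin'_def)
next
  case False
  have abs: "(abs has_real_derivative sgn s) (at s)" using False by (rule abs_has_derivative)
  have "((\<lambda>s. \<mu> \<bar>s\<bar>) has_real_derivative deriv_within {0<..} \<mu> \<bar>s\<bar> * sgn s) (at s)"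
    using DERIV_chain2[OF modulus_DERIV abs] False by simp
  then have "((\<lambda>s. s\<^sup>2 * \<mu> \<bar>s\<bar>) has_real_derivative 2 * s * \<mu> \<bar>s\<bar> + deriv_within {0<..} \<mu> \<bar>s\<bar> * sgn s * s\<^sup>2) (at s)"
    by (auto intro!: derivative_eq_intros)
  moreover have "d * sgn s * s\<^sup>2 = s * \<bar>s\<bar> * d" for d
    by (simp add: power2_eq_square abs_sgn mult_ac)
  ultimately show ?thesis by (simp only: nonlin_def[abs_def] nonlin'_def)
qed

text \<open>
  For \<open>\<tau> > 0\<close> the second derivative of the nonlinearity is \<open>2 \<mu> + 4 \<tau> \<mu>' + \<tau>\<^sup>2 \<mu>''\<close>. Near \<open>0\<close> it is bounded by a
  multiple of \<open>\<mu>\<close> thanks to the symbol bound for \<open>\<mu>''\<close>, and on compact subintervals of \<open>(0, \<infinity>)\<close> by continuity.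
  Points of opposite sign are compared through \<open>0\<close>.
\<close>

lemma nonlin'_lipschitz: "\<exists>L\<ge>0. \<forall>x\<in>{-M..M}. \<forall>y\<in>{-M..M}. \<bar>nonlin' \<mu> x - nonlin' \<mu> y\<bar> \<le> L * \<bar>x - y\<bar>"
proof -
  define m1 where "m1 = deriv_within {0<..} \<mu>"
  define m2 where "m2 = deriv_within {0<..} m1"
  have m1: "m1 differentiable_on {0<..}" and m2: "continuous_on {0<..} m2" and m1c: "continuous_on {0<..} m1"
    using sl by (auto simp: symbol_like_def numeral_2_eq_2 m1_def m2_def differentiable_imp_continuous_on)
  have m2eq: "(deriv_within {0<..} ^^ 2) \<mu> = m2" by (simp add: numeral_2_eq_2 m1_def m2_def)
  obtain \<tau>\<^sub>1 C where \<tau>\<^sub>1: "\<tau>\<^sub>1 > 0" and C: "C > 0" "\<And>\<tau>. 0 < \<tau> \<Longrightarrow> \<tau> < \<tau>\<^sub>1 \<Longrightarrow> \<bar>m2 \<tau>\<bar> \<le> C * (\<mu> \<tau> / \<tau>\<^sup>2)"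
    using sl unfolding symbol_like_def by (auto simp: m2eq) 
  have muc: "continuous_on {0<..} \<mu>" by (rule continuous_on_subset[OF modulusD(1)[OF \<mu>]]) auto
  define D where "D \<tau> = 2 * \<mu> \<tau> + 4 * \<tau> * m1 \<tau> + \<tau>\<^sup>2 * m2 \<tau>" for \<tau>
  define N where "N = max M 1"
  have deriv: "(nonlin' \<mu> has_real_derivative D \<tau>) (at \<tau> within {0<..N})" if "0 < \<tau>" "\<tau> \<le> N" for \<tau>
  proof -
    have "(m1 has_real_derivative m2 \<tau>) (at \<tau>)"
      using has_real_derivative_deriv_within[OF m1, of \<tau>] that by (simp add: m2_def at_within_Ioi)
    then have "((\<lambda>s. 2 * s * \<mu> s + s\<^sup>2 * m1 s) has_real_derivative D \<tau>) (at \<tau>)"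
      using modulus_DERIV[OF that(1)] unfolding D_def m1_def
      by (auto intro!: derivative_eq_intros simp: power2_eq_square algebra_simps)
    then have "((\<lambda>s. 2 * s * \<mu> s + s\<^sup>2 * m1 s) has_real_derivative D \<tau>) (at \<tau> within {0<..N})"
      by (rule DERIV_subset) auto
    then show ?thesis
      by (rule has_field_derivative_transform_within[OF _ that(1)])
         (use that in \<open>auto simp: nonlin'_def m1_def power2_eq_square dist_real_def\<close>)
  qed
  define c where "c = min (\<tau>\<^sub>1 / 2) 1"
  have "c > 0" "c < \<tau>\<^sub>1" "c \<le> N" using \<tau>\<^sub>1 by (auto simp: c_def N_def)
  have "compact (D ` {c..N})"
    unfolding D_def[abs_def] using \<open>c > 0\<close>
    by (intro compact_continuous_image continuous_intros continuous_on_subset[OF m2]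
        continuous_on_subset[OF m1c] continuous_on_subset[OF muc]) auto
  then obtain B where B: "\<And>\<tau>. c \<le> \<tau> \<Longrightarrow> \<tau> \<le> N \<Longrightarrow> \<bar>D \<tau>\<bar> \<le> B"
    using compact_imp_bounded[of "D ` {c..N}"] by (force simp: bounded_iff)
  define L where "L = max B ((6 + C) * \<mu> N)"
  have D_le: "\<bar>D \<tau>\<bar> \<le> L" if "0 < \<tau>" "\<tau> \<le> N" for \<tau>
  proof (cases "c \<le> \<tau>")
    case False
    then have "\<bar>m2 \<tau>\<bar> \<le> C * (\<mu> \<tau> / \<tau>\<^sup>2)" using C \<open>c < \<tau>\<^sub>1\<close> that by auto
    then have "\<tau>\<^sup>2 * \<bar>m2 \<tau>\<bar> \<le> \<tau>\<^sup>2 * (C * (\<mu> \<tau> / \<tau>\<^sup>2))" by (rule mult_left_mono) auto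
    also have "\<dots> = C * \<mu> \<tau>" using that by simp
    finally have "\<bar>\<tau>\<^sup>2 * m2 \<tau>\<bar> \<le> C * \<mu> \<tau>" by (simp add: abs_mult)
    moreover have "\<bar>4 * \<tau> * m1 \<tau>\<bar> \<le> 4 * \<mu> \<tau>"
      using modulus_deriv_bounds[OF that(1)] that by (simp add: m1_def abs_mult)
    moreover have "0 \<le> \<mu> \<tau>" "\<mu> \<tau> \<le> \<mu> N" using that modulusD(3)[OF \<mu>] modulus_mono[OF \<mu>] by auto
    moreover have "(6 + C) * \<mu> \<tau> \<le> (6 + C) * \<mu> N" using C(1) calculation by (intro mult_left_mono) auto
    ultimately have "\<bar>D \<tau>\<bar> \<le> (6 + C) * \<mu> N" unfolding D_def by (simp add: algebra_simps)
    then show ?thesis by (simp add: L_def)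
  qed (use B that in \<open>auto simp: L_def le_max_iff_disj\<close>)
  have L0: "0 \<le> L" using D_le[of 1] by (auto simp: N_def)
  have lip_pos: "\<bar>nonlin' \<mu> x - nonlin' \<mu> y\<bar> \<le> L * \<bar>x - y\<bar>" if "0 < x" "x \<le> N" "0 < y" "y \<le> N" for x y
    using field_differentiable_bound[of "{0<..N}" "nonlin' \<mu>" D L x y] that deriv D_le by auto
  have odd: "nonlin' \<mu> (- x) = - nonlin' \<mu> x" for x by (simp add: nonlin'_def)
  have small: "\<bar>nonlin' \<mu> x\<bar> \<le> 3 * \<mu> N * \<bar>x\<bar>" if "\<bar>x\<bar> \<le> N" for x
    using abs_nonlin'_le[of x] mult_left_mono[OF modulus_mono[OF \<mu>, of "\<bar>x\<bar>" N], of "3 * \<bar>x\<bar>"] that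
    by (simp add: mult_ac)
  define K where "K = max L (3 * \<mu> N)"
  have "\<bar>nonlin' \<mu> x - nonlin' \<mu> y\<bar> \<le> K * \<bar>x - y\<bar>" if xy: "x \<in> {-M..M}" "y \<in> {-M..M}" for x y
  proof -
    have MN: "\<bar>x\<bar> \<le> N" "\<bar>y\<bar> \<le> N" using xy by (auto simp: N_def)
    consider "0 < x" "0 < y" | "x < 0" "y < 0" | "x * y \<le> 0" by (metis linorder_less_linear mult_eq_0_iff mult_less_0_iff order_le_less)
    then show ?thesis
    proof cases
      case 1
      then have "\<bar>nonlin' \<mu> x - nonlin' \<mu> y\<bar> \<le> L * \<bar>x - y\<bar>" using MN by (intro lip_pos) auto
      also have "\<dots> \<le> K * \<bar>x - y\<bar>" by (intro mult_right_mono) (auto simp: K_def)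
      finally show ?thesis .
    next
      case 2
      then have "\<bar>nonlin' \<mu> (- x) - nonlin' \<mu> (- y)\<bar> \<le> L * \<bar>- x - - y\<bar>" using MN by (intro lip_pos) auto
      also have "\<dots> \<le> K * \<bar>x - y\<bar>"
        using mult_right_mono[of L K "\<bar>x - y\<bar>"] by (auto simp: K_def abs_minus_commute)
      finally show ?thesis by (simp add: odd abs_minus_commute)
    next
      case 3
      then have "\<bar>x\<bar> + \<bar>y\<bar> = \<bar>x - y\<bar>" by (auto simp: mult_le_0_iff)
      moreover have "\<bar>nonlin' \<mu> x - nonlin' \<mu> y\<bar> \<le> 3 * \<mu> N * (\<bar>x\<bar> + \<bar>y\<bar>)"
        using small[OF MN(1)] small[OF MN(2)] by (simp add: distrib_left)
      moreover have "3 * \<mu> N * \<bar>x - y\<bar> \<le> K * \<bar>x - y\<bar>" by (intro mult_right_mono) (auto simp: K_def)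
      ultimately show ?thesis by simp
    qed
  qed
  moreover have "0 \<le> K" using L0 by (simp add: K_def)
  ultimately show ?thesis by blast
qed

end


section \<open>A weighted contraction principle\<close>

text \<open>
  Picard iteration for functions that matter only on \<open>D\<close>. The contraction hypothesis is about the best constant \<open>c\<close>
  in \<open>\<bar>f - g\<bar> \<le> c W\<close>; a weight \<open>W\<close> that grows exponentially in time turns an integral operator of Volterra type
  into a contraction on time intervals of any length.
\<close>

lemma weighted_contraction_fixed_point:
  fixes \<Phi> :: "('a \<Rightarrow> real) \<Rightarrow> 'a \<Rightarrow> real" and W :: "'a \<Rightarrow> real"
  assumes f0: "f0 \<in> P" and self: "\<And>f. f \<in> P \<Longrightarrow> \<Phi> f \<in> P"
    and closed: "\<And>F l. (\<And>n. F n \<in> P) \<Longrightarrow> uniform_limit D F l sequentially \<Longrightarrow> l \<in> P"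
    and W: "\<And>x. x \<in> D \<Longrightarrow> 0 \<le> W x" "\<And>x. x \<in> D \<Longrightarrow> W x \<le> B"
    and M: "0 \<le> M" "\<And>x. x \<in> D \<Longrightarrow> \<bar>\<Phi> f0 x - f0 x\<bar> \<le> M * W x"
    and contr: "\<And>f g c. f \<in> P \<Longrightarrow> g \<in> P \<Longrightarrow> 0 \<le> c \<Longrightarrow> (\<And>x. x \<in> D \<Longrightarrow> \<bar>f x - g x\<bar> \<le> c * W x) \<Longrightarrow>
      (\<And>x. x \<in> D \<Longrightarrow> \<bar>\<Phi> f x - \<Phi> g x\<bar> \<le> c / 2 * W x)"
  shows "\<exists>f\<in>P. \<forall>x\<in>D. \<Phi> f x = f x"
proof -
  define F where "F n = (\<Phi> ^^ n) f0" for n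
  have F_Suc: "F (Suc n) = \<Phi> (F n)" and F_0: "F 0 = f0" for n by (simp_all add: F_def)
  have FP: "F n \<in> P" for n by (induction n) (auto simp: F_Suc F_0 f0 self)
  have step: "\<bar>F (Suc n) x - F n x\<bar> \<le> M / 2 ^ n * W x" if "x \<in> D" for n x
    using that
  proof (induction n arbitrary: x)
    case (Suc n)
    have "\<bar>\<Phi> (F (Suc n)) x - \<Phi> (F n) x\<bar> \<le> M / 2 ^ n / 2 * W x"
      using M(1) by (intro contr FP Suc) auto
    then show ?case by (simp add: F_Suc field_simps)
  qed (use M in \<open>simp add: F_Suc F_0\<close>)
  have step': "norm (F (Suc n) x - F n x) \<le> M * \<bar>B\<bar> * (1 / 2) ^ n" if "x \<in> D" for n x
  proof -
    have "M / 2 ^ n * W x \<le> M / 2 ^ n * \<bar>B\<bar>" using W[OF that] M(1) by (intro mult_left_mono) auto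
    then show ?thesis using step[OF that, of n] by (simp add: field_simps)
  qed
  define l where "l x = f0 x + (\<Sum>n. F (Suc n) x - F n x)" for x
  have "uniform_limit D (\<lambda>n x. \<Sum>i<n. F (Suc i) x - F i x) (\<lambda>x. \<Sum>n. F (Suc n) x - F n x) sequentially"
    by (rule Weierstrass_m_test[OF step']) (auto intro!: summable_mult)
  then have "uniform_limit D (\<lambda>n x. f0 x + (\<Sum>i<n. F (Suc i) x - F i x)) l sequentially"
    unfolding l_def by (intro uniform_limit_add uniform_limit_const)
  moreover have "f0 x + (\<Sum>i<n. F (Suc i) x - F i x) = F n x" for n x
    unfolding sum_lessThan_telescope[of "\<lambda>i. F i x" n] F_0 by simp
  ultimately have lim: "uniform_limit D F l sequentially" by (simp only:)
  have lP: "l \<in> P" by (rule closed[OF FP lim])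
  have lim_pt: "(\<lambda>n. F n x) \<longlonglongrightarrow> l x" if "x \<in> D" for x
    using tendsto_uniform_limitI[OF lim that] .
  have tail: "\<bar>F n x - l x\<bar> \<le> 2 * M / 2 ^ n * W x" if x: "x \<in> D" for n x
  proof -
    have part: "\<bar>F n x - F (n + k) x\<bar> \<le> (2 * M / 2 ^ n - 2 * M / 2 ^ (n + k)) * W x" for k
    proof (induction k)
      case (Suc k)
      have "\<bar>F n x - F (n + Suc k) x\<bar> \<le> \<bar>F n x - F (n + k) x\<bar> + \<bar>F (Suc (n + k)) x - F (n + k) x\<bar>" by simp
      also have "\<dots> \<le> (2 * M / 2 ^ n - 2 * M / 2 ^ (n + k)) * W x + M / 2 ^ (n + k) * W x"
        by (intro add_mono Suc step x)
      also have "\<dots> = (2 * M / 2 ^ n - M / 2 ^ (n + k)) * W x" by (simp add: algebra_simps)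
      also have "M / 2 ^ (n + k) = 2 * M / 2 ^ (n + Suc k)" by simp
      finally show ?case .
    qed simp
    have "\<bar>F n x - F (n + k) x\<bar> \<le> 2 * M / 2 ^ n * W x" for k
    proof -
      have "(2 * M / 2 ^ n - 2 * M / 2 ^ (n + k)) * W x \<le> 2 * M / 2 ^ n * W x"
        using M(1) W(1)[OF x] by (intro mult_right_mono) auto
      with part[of k] show ?thesis by linarith
    qed
    moreover have "(\<lambda>k. \<bar>F n x - F (n + k) x\<bar>) \<longlonglongrightarrow> \<bar>F n x - l x\<bar>"
      using LIMSEQ_ignore_initial_segment[OF lim_pt[OF x], of n]
      by (intro tendsto_rabs tendsto_diff tendsto_const) (simp only: add.commute)
    ultimately show ?thesis by (intro LIMSEQ_le_const2[of _ "\<bar>F n x - l x\<bar>"] exI[of _ 0] allI impI) assumption+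
  qed
  have "\<Phi> l x = l x" if x: "x \<in> D" for x
  proof -
    have "\<bar>\<Phi> (F n) x - \<Phi> l x\<bar> \<le> 2 * M / 2 ^ n / 2 * W x" for n
      using M(1) by (intro contr FP lP tail x) auto
    then have "norm (F (Suc n) x - \<Phi> l x) \<le> (M * W x) * (1 / 2) ^ n" for n
      by (simp add: F_Suc field_simps)
    then have "(\<lambda>n. F (Suc n) x - \<Phi> l x) \<longlonglongrightarrow> 0"
      by (intro Lim_null_comparison[OF always_eventually tendsto_mult_right_zero[OF LIMSEQ_power_zero]] allI) auto
    moreover have "(\<lambda>n. F (Suc n) x - \<Phi> l x) \<longlonglongrightarrow> l x - \<Phi> l x"
      by (intro tendsto_diff tendsto_const LIMSEQ_Suc lim_pt x)
    ultimately have "l x - \<Phi> l x = 0" by (rule LIMSEQ_unique[symmetric])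
    then show ?thesis by simp
  qed
  with lP show ?thesis by blast
qed

section \<open>Extension of functions on the half line\<close>

text \<open>
  The even extension of \<open>E\<close> and the odd extension of \<open>H\<close> are differentiable at the origin because \<open>E'\<close> and \<open>H\<close>
  vanish there; elsewhere this is the chain rule.
\<close>

lemma even_odd_extension_has_derivative:
  fixes E H' E' H :: "real \<Rightarrow> real"
  assumes E: "\<And>r. 0 \<le> r \<Longrightarrow> (E has_real_derivative E' r) (at r within {0..})" "E' 0 = 0"
    and H: "\<And>r. 0 \<le> r \<Longrightarrow> (H has_real_derivative H' r) (at r within {0..})" "H 0 = 0"
  shows "((\<lambda>p. E \<bar>p\<bar> + sgn p * H \<bar>p\<bar>) has_real_derivative sgn p * E' \<bar>p\<bar> + H' \<bar>p\<bar>) (at p)"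
proof -
  have right: "((\<lambda>p. E p + H p) has_vector_derivative E' p + H' p) (at p within {0..})" if "0 \<le> p" for p
    using that E H by (auto intro!: derivative_eq_intros simp flip: has_real_derivative_iff_has_vector_derivative)
  have left: "((\<lambda>p. E (- p) - H (- p)) has_vector_derivative - E' (- p) + H' (- p)) (at p within {..0})"
    if "p \<le> 0" for p
  proof -
    have "(f \<circ> uminus has_real_derivative f' (- p) * (- 1)) (at p within {..0})"
      if "\<And>r. 0 \<le> r \<Longrightarrow> (f has_real_derivative f' r) (at r within {0..})" for f f' :: "real \<Rightarrow> real"
    proof (rule DERIV_image_chain)
      show "(f has_real_derivative f' (- p)) (at (- p) within uminus ` {..0})"
        using that[of "- p"] \<open>p \<le> 0\<close> by simp
    qed (auto intro!: derivative_eq_intros)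
    from this[OF E(1)] this[OF H(1)] show ?thesis
      unfolding has_real_derivative_iff_has_vector_derivative[symmetric] o_def
      by (auto intro!: derivative_eq_intros)
  qed
  have "((\<lambda>p. if p \<in> {0..} then E p + H p else E (- p) - H (- p)) has_vector_derivative
      (if p \<in> {0..} then E' p + H' p else - E' (- p) + H' (- p))) (at p within UNIV)"
  proof (rule has_vector_derivative_If_within_closures[where T="{..0}"])
    show "(UNIV :: real set) = {0..} \<union> {..0}" by auto
    have eq: "{0..} \<union> closure {0..} \<inter> closure {..0} = {0::real..}"
      "{..0} \<union> closure {0..} \<inter> closure {..0} = {..0::real}" by auto
    show "((\<lambda>p. E p + H p) has_vector_derivative E' p + H' p) (at p within {0..} \<union> closure {0..} \<inter> closure {..0})"
      if "p \<in> {0..} \<union> closure {0..} \<inter> closure {..0}"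
      using that right[of p] unfolding eq by auto
    show "((\<lambda>p. E (- p) - H (- p)) has_vector_derivative - E' (- p) + H' (- p))
        (at p within {..0} \<union> closure {0..} \<inter> closure {..0})"
      if "p \<in> {..0} \<union> closure {0..} \<inter> closure {..0}"
      using that left[of p] unfolding eq by auto
  qed (use E H in auto)
  moreover have "(\<lambda>p. if p \<in> {0..} then E p + H p else E (- p) - H (- p)) = (\<lambda>p. E \<bar>p\<bar> + sgn p * H \<bar>p\<bar>)"
    using H(2) by (auto simp: fun_eq_iff sgn_if)
  moreover have "(if p \<in> {0..} then E' p + H' p else - E' (- p) + H' (- p)) = sgn p * E' \<bar>p\<bar> + H' \<bar>p\<bar>"
    using E(2) by (auto simp: sgn_if)
  ultimately show ?thesis by (simp add: has_real_derivative_iff_has_vector_derivative)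
qed

lemma continuous_on_odd_even_extension:
  fixes E H :: "real \<Rightarrow> real"
  assumes "continuous_on {0..} E" "E 0 = 0" "continuous_on {0..} H"
  shows "continuous_on UNIV (\<lambda>p. sgn p * E \<bar>p\<bar> + H \<bar>p\<bar>)"
proof -
  have "continuous_on ({0..} \<union> {..0}) (\<lambda>p::real. if 0 \<le> p then E p else - E (- p))"
    by (rule continuous_on_If)
       (use assms in \<open>auto intro!: continuous_intros continuous_on_compose2[OF assms(1)]\<close>)
  moreover have "{0..} \<union> {..0} = (UNIV :: real set)" by auto
  moreover have "(if 0 \<le> p then E p else - E (- p)) = sgn p * E \<bar>p\<bar>" for p
    using assms(2) by (auto simp: sgn_if)
  moreover have "continuous_on UNIV (\<lambda>p. H \<bar>p\<bar>)"
    by (intro continuous_on_compose2[OF assms(3)] continuous_intros) auto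
  ultimately show ?thesis by (auto intro!: continuous_on_add)
qed

section \<open>Weighted estimates for the equation on the line\<close>

lemma continuous_on_slice:
  fixes f :: "real \<Rightarrow> real \<Rightarrow> real"
  assumes "continuous_on (X \<times> UNIV) (\<lambda>(t, r). f t r)" "t \<in> X"
  shows "continuous_on UNIV (f t)"
  using continuous_on_uncurried_compose[OF assms(1), of UNIV "\<lambda>_. t" "\<lambda>r. r"] assms(2) by (simp add: continuous_intros)

lemma continuous_mean:
  assumes f: "continuous_on UNIV f"
  shows "continuous_on UNIV (mean f)"
proof -
  have "continuous_on (UNIV \<times> UNIV) (\<lambda>(t :: real, r). f r)"
    unfolding case_prod_unfold by (intro continuous_on_compose2[OF f] continuous_intros) auto
  from continuous_on_slice[OF continuous_on_mean[OF this], of 0] show ?thesis by simp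
qed

lemma abs_half_sum_le: "\<bar>x\<bar> \<le> c \<Longrightarrow> \<bar>y\<bar> \<le> c \<Longrightarrow> \<bar>(x + y) / 2\<bar> \<le> c" for c :: real
  by (auto simp: abs_le_iff)

lemma abs_half_diff_le: "\<bar>x\<bar> \<le> c \<Longrightarrow> \<bar>y\<bar> \<le> c \<Longrightarrow> \<bar>(x - y) / 2\<bar> \<le> c" for c :: real
  by (auto simp: abs_le_iff)

text \<open>
  The data are \<open>a\<^sub>0 = v\<^sub>t + v\<^sub>r\<close> at time zero and its derivative \<open>\<alpha>\<^sub>0\<close>, both on the whole line. The number \<open>Q\<close> is
  the size of the solution in the weighted norm, and \<open>\<kappa> \<ge> 2 Q / R\<close> bounds \<open>(1 + \<bar>r\<bar>) \<bar>u\<^sub>t\<bar>\<close>. The bound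
  \<open>Q / (6 R)\<close> is half of \<open>Q \<omega>\<close> at the smallest value \<open>1 / (3 R)\<close> of the weight on the region reached by the free
  solution; the last assumption makes the nonlinear contribution fit into the other half.
\<close>

locale small_data_wave =
  fixes T R Q \<kappa> :: real and \<mu> a\<^sub>0 \<alpha>\<^sub>0 :: "real \<Rightarrow> real"
  assumes T: "0 < T" and R: "0 < R" and Q: "0 \<le> Q" and \<kappa>: "2 * Q / R \<le> \<kappa>"
    and \<mu>: "modulus_of_continuity \<mu>" and sl: "symbol_like \<mu>"
    and a0_deriv: "\<And>p. (a\<^sub>0 has_real_derivative \<alpha>\<^sub>0 p) (at p)" and \<alpha>0_cont: "continuous_on UNIV \<alpha>\<^sub>0"
    and data_support: "\<And>p. R < \<bar>p\<bar> \<Longrightarrow> a\<^sub>0 p = 0 \<and> \<alpha>\<^sub>0 p = 0"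
    and data_bound: "\<And>p. \<bar>a\<^sub>0 p\<bar> \<le> Q / (6 * R)" "\<And>p. \<bar>\<alpha>\<^sub>0 p\<bar> \<le> Q / (6 * R)"
    and small: "28 * Q * (integral {-(2*T+R)..2*T+R} (\<lambda>y. \<mu> (\<kappa> / (1 + \<bar>y\<bar>)) / (1 + \<bar>y\<bar>)) + 8 * \<mu> \<kappa>) \<le> R"
begin

definition \<omega> :: "real \<Rightarrow> real \<Rightarrow> real" where
  "\<omega> t r = (if \<bar>r\<bar> \<le> t + R then 1 / (t - \<bar>r\<bar> + 2 * R) else 0)"

definition h :: "real \<Rightarrow> real" where
  "h y = \<mu> (\<kappa> / (1 + \<bar>y\<bar>)) / (1 + \<bar>y\<bar>)"

definition forcing :: "(real \<Rightarrow> real \<Rightarrow> real) \<Rightarrow> real \<Rightarrow> real \<Rightarrow> real" where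
  "forcing \<alpha> t r = r * nonlin \<mu> (mean (\<alpha> t) r)"

text \<open>
  The space derivative of the source, written without any derivative of \<open>\<alpha>\<close>: if \<open>w\<close> is the mean of \<open>\<alpha>\<close>, then
  \<open>r w\<^sub>r = (r w)\<^sub>r - w\<close>, and \<open>(r w)\<^sub>r\<close> is the even part of \<open>\<alpha>\<close>.
\<close>

definition forcing_r :: "(real \<Rightarrow> real \<Rightarrow> real) \<Rightarrow> real \<Rightarrow> real \<Rightarrow> real" where
  "forcing_r \<alpha> t r = nonlin \<mu> (mean (\<alpha> t) r) +
     nonlin' \<mu> (mean (\<alpha> t) r) * ((\<alpha> t r + \<alpha> t (- r)) / 2 - mean (\<alpha> t) r)"

definition sol :: "(real \<Rightarrow> real \<Rightarrow> real) \<Rightarrow> real \<Rightarrow> real \<Rightarrow> real" where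
  "sol \<alpha> t r = a\<^sub>0 (r + t) + duhamel (forcing \<alpha>) t (r + t)"

definition sol_r :: "(real \<Rightarrow> real \<Rightarrow> real) \<Rightarrow> real \<Rightarrow> real \<Rightarrow> real" where
  "sol_r \<alpha> t r = \<alpha>\<^sub>0 (r + t) + duhamel (forcing_r \<alpha>) t (r + t)"

text \<open>
  The second bound is not a consequence of the first, which would give only a logarithmically larger bound for
  \<open>r u\<^sub>t\<close>. The value \<open>0\<close> of the weight for \<open>\<bar>r\<bar> > t + R\<close> encodes finite speed of propagation in both bounds.
\<close>

definition decaying :: "(real \<Rightarrow> real \<Rightarrow> real) set" where
  "decaying = {\<alpha>. continuous_on ({0..T} \<times> UNIV) (\<lambda>(t, r). \<alpha> t r) \<and>
     (\<forall>t\<in>{0..T}. \<forall>r. \<bar>\<alpha> t r\<bar> \<le> Q * \<omega> t r \<and> \<bar>r * mean (\<alpha> t) r\<bar> \<le> Q * \<omega> t r)}"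

lemma \<kappa>0: "0 \<le> \<kappa>" using Q R \<kappa> by (meson divide_nonneg_pos mult_nonneg_nonneg order_trans zero_le_numeral)

lemma \<omega>_nonneg: "0 \<le> \<omega> t r" and \<omega>_le: "\<omega> t r \<le> 1 / R"
  using R by (auto simp: \<omega>_def intro!: divide_left_mono)

lemma \<omega>_minus [simp]: "\<omega> t (- r) = \<omega> t r"
  by (simp add: \<omega>_def)

lemma \<omega>_mono: "\<bar>y\<bar> \<le> \<bar>r\<bar> \<Longrightarrow> \<bar>r\<bar> \<le> t + R \<Longrightarrow> \<omega> t y \<le> \<omega> t r"
  using R by (auto simp: \<omega>_def intro!: divide_left_mono)

lemma h_nonneg: "0 \<le> h y"
  using modulusD(3)[OF \<mu>, of "\<kappa> / (1 + \<bar>y\<bar>)"] \<kappa>0 by (auto simp: h_def)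

lemma continuous_on_h: "continuous_on UNIV h"
proof -
  have "continuous_on UNIV (\<lambda>y. \<mu> (\<kappa> / (1 + \<bar>y\<bar>)))"
    by (rule continuous_on_compose2[OF modulusD(1)[OF \<mu>]])
       (use \<kappa>0 in \<open>auto intro!: continuous_intros divide_nonneg_nonneg simp: add_pos_nonneg less_imp_neq[THEN not_sym] \<close>)
  then show ?thesis unfolding h_def[abs_def]
    by (auto intro!: continuous_intros simp: add_pos_nonneg less_imp_neq[THEN not_sym])
qed

context
  fixes \<alpha> :: "real \<Rightarrow> real \<Rightarrow> real" and t :: real
  assumes \<alpha>: "\<alpha> \<in> decaying" and t: "t \<in> {0..T}"
begin

lemma decaying_le: "\<bar>\<alpha> t r\<bar> \<le> Q * \<omega> t r" "\<bar>r * mean (\<alpha> t) r\<bar> \<le> Q * \<omega> t r"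
  using \<alpha> t by (auto simp: decaying_def)

lemma continuous_decaying: "continuous_on UNIV (\<alpha> t)"
  using \<alpha> t by (auto simp: decaying_def intro: continuous_on_slice)

text \<open>
  Inside the cone the weight increases with \<open>\<bar>r\<bar>\<close>, so it dominates the values that are averaged; outside, the
  bound on \<open>r\<close> times the mean forces the mean to vanish.
\<close>

lemma mean_decaying_le: "\<bar>mean (\<alpha> t) r\<bar> \<le> Q * \<omega> t r"
proof (cases "\<bar>r\<bar> \<le> t + R")
  case True
  then show ?thesis
    using \<omega>_mono[OF _ True] Q
    by (intro abs_mean_le continuous_decaying order_trans[OF decaying_le(1)] mult_left_mono) auto
next
  case False
  then have "\<omega> t r = 0" "r \<noteq> 0" using t R by (auto simp: \<omega>_def)
  then show ?thesis using decaying_le(2)[of r] by simp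
qed

text \<open>
  Adding the bounds for \<open>\<bar>w\<bar>\<close> and \<open>\<bar>r w\<bar>\<close> gives \<open>(1 + \<bar>r\<bar>) \<bar>w\<bar> \<le> 2 Q \<omega> \<le> \<kappa>\<close>. One factor \<open>\<bar>w\<bar>\<close> supplies the decay
  \<open>1 / (1 + \<bar>r\<bar>)\<close>, and monotonicity of \<open>\<mu>\<close> replaces \<open>\<mu>(\<bar>w\<bar>)\<close> by \<open>\<mu>(\<kappa> / (1 + \<bar>r\<bar>))\<close>.
\<close>

lemma forcing_bounds:
  "\<bar>forcing \<alpha> t r\<bar> \<le> 14 * Q\<^sup>2 * ((\<omega> t r)\<^sup>2 * h r)" "\<bar>forcing_r \<alpha> t r\<bar> \<le> 14 * Q\<^sup>2 * ((\<omega> t r)\<^sup>2 * h r)"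
proof -
  define w where "w = mean (\<alpha> t) r"
  define z where "z = (\<alpha> t r + \<alpha> t (- r)) / 2"
  define k where "k = 1 + \<bar>r\<bar>"
  define q where "q = Q * \<omega> t r"
  define m where "m = \<mu> (\<kappa> / k)"
  have k: "k \<ge> 1" by (simp add: k_def)
  have w: "\<bar>w\<bar> \<le> q" and rw: "\<bar>r\<bar> * \<bar>w\<bar> \<le> q" and q0: "0 \<le> q"
    using mean_decaying_le[of r] decaying_le(2)[of r] Q \<omega>_nonneg by (auto simp: w_def q_def abs_mult)
  have kw: "k * \<bar>w\<bar> \<le> 2 * q" using w rw by (simp add: k_def algebra_simps)
  have z: "\<bar>z\<bar> \<le> q"
    using decaying_le(1)[of r] decaying_le(1)[of "- r"] unfolding z_def q_def \<omega>_minus by (rule abs_half_sum_le)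
  have "2 * q \<le> \<kappa>"
    using mult_left_mono[OF \<omega>_le[of t r], of "2 * Q"] Q \<kappa> by (simp add: q_def)
  then have "k * \<bar>w\<bar> \<le> \<kappa>" using kw by simp
  then have "\<bar>w\<bar> \<le> \<kappa> / k" using k by (simp add: field_simps)
  then have mw: "\<mu> \<bar>w\<bar> \<le> m" "0 \<le> \<mu> \<bar>w\<bar>" "0 \<le> m"
    using modulus_mono[OF \<mu>, of "\<bar>w\<bar>" "\<kappa> / k"] modulusD(3)[OF \<mu>, of "\<bar>w\<bar>"] by (auto simp: m_def)
  have G: "\<bar>nonlin \<mu> w\<bar> \<le> \<bar>w\<bar> * \<bar>w\<bar> * m"
    using mw by (simp add: nonlin_def abs_mult power2_eq_square mult_mono)
  have rhs: "14 * Q\<^sup>2 * ((\<omega> t r)\<^sup>2 * h r) = 14 * q * q * m / k"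
    by (simp add: q_def h_def m_def k_def power2_eq_square)
  have "\<bar>r\<bar> * \<bar>nonlin \<mu> w\<bar> * k \<le> 14 * q * q * m"
  proof -
    have "\<bar>r\<bar> * \<bar>nonlin \<mu> w\<bar> * k \<le> \<bar>r\<bar> * (\<bar>w\<bar> * \<bar>w\<bar> * m) * k"
      using G k by (intro mult_right_mono mult_left_mono) auto
    also have "\<dots> = (\<bar>r\<bar> * \<bar>w\<bar>) * (k * \<bar>w\<bar>) * m" by simp
    also have "\<dots> \<le> q * (2 * q) * m" using mw q0 k by (intro mult_right_mono[OF mult_mono[OF rw kw]]) auto
    also have "\<dots> \<le> 14 * q * q * m" using mw q0 by (simp add: mult_ac)
    finally show ?thesis .
  qed
  then show "\<bar>forcing \<alpha> t r\<bar> \<le> 14 * Q\<^sup>2 * ((\<omega> t r)\<^sup>2 * h r)"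
    unfolding rhs using k by (simp add: forcing_def abs_mult flip: w_def) (simp add: field_simps)
  have "\<bar>nonlin \<mu> w + nonlin' \<mu> w * (z - w)\<bar> \<le> \<bar>nonlin \<mu> w\<bar> + \<bar>nonlin' \<mu> w\<bar> * (\<bar>z\<bar> + \<bar>w\<bar>)"
    by (rule order_trans[OF abs_triangle_ineq]) (auto simp: abs_mult intro!: mult_left_mono)
  also have "\<dots> \<le> \<bar>w\<bar> * q * m + (3 * \<bar>w\<bar> * m) * (q + q)"
  proof (intro add_mono mult_mono)
    show "\<bar>nonlin \<mu> w\<bar> \<le> \<bar>w\<bar> * q * m"
      using w mw by (intro order_trans[OF G] mult_right_mono mult_left_mono) simp_all
    show "\<bar>nonlin' \<mu> w\<bar> \<le> 3 * \<bar>w\<bar> * m"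
      by (rule order_trans[OF abs_nonlin'_le[OF \<mu> sl]]) (use mw in \<open>auto intro!: mult_left_mono\<close>)
  qed (use w z mw in auto)
  also have "\<dots> = 7 * \<bar>w\<bar> * q * m" by (simp add: algebra_simps)
  finally have *: "\<bar>nonlin \<mu> w + nonlin' \<mu> w * (z - w)\<bar> \<le> 7 * \<bar>w\<bar> * q * m" .
  have "7 * \<bar>w\<bar> * q * m * k \<le> 14 * q * q * m"
    using mult_right_mono[OF kw, of "7 * q * m"] mw q0 by (simp add: mult_ac)
  then have "7 * \<bar>w\<bar> * q * m \<le> 14 * q * q * m / k" using k by (simp add: field_simps)
  with * show "\<bar>forcing_r \<alpha> t r\<bar> \<le> 14 * Q\<^sup>2 * ((\<omega> t r)\<^sup>2 * h r)"
    unfolding rhs by (simp add: forcing_r_def flip: w_def z_def)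
qed

text \<open>
  Away from the axis \<open>w = (r w) / r\<close> is differentiable. At \<open>r = 0\<close> only \<open>w\<close> itself is known to be continuous, and
  the difference quotient of \<open>r G(w)\<close> is \<open>G(w)\<close>.
\<close>

lemma forcing_has_derivative: "(forcing \<alpha> t has_real_derivative forcing_r \<alpha> t r) (at r)"
proof -
  let ?w = "mean (\<alpha> t)"
  note c = continuous_decaying
  have V: "((\<lambda>r. r * ?w r) has_real_derivative (\<alpha> t r + \<alpha> t (- r)) / 2) (at r)" for r
    by (rule radius_times_mean_has_derivative[OF c])
  show ?thesis
  proof (cases "r = 0")
    case False
    have "((\<lambda>r. r * ?w r / r) has_real_derivative
        ((\<alpha> t r + \<alpha> t (- r)) / 2 * r - r * ?w r * 1) / (r * r)) (at r)"
      using False by (intro DERIV_divide V DERIV_ident)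
    also have "((\<alpha> t r + \<alpha> t (- r)) / 2 * r - r * ?w r * 1) / (r * r) = ((\<alpha> t r + \<alpha> t (- r)) / 2 - ?w r) / r"
      using False by (simp add: field_simps)
    finally have "(?w has_real_derivative ((\<alpha> t r + \<alpha> t (- r)) / 2 - ?w r) / r) (at r)"
      by (rule has_field_derivative_transform_within_open[of _ _ _ "- {0}"]) (use False in auto)
    then have "((\<lambda>r. nonlin \<mu> (?w r)) has_real_derivative
        nonlin' \<mu> (?w r) * (((\<alpha> t r + \<alpha> t (- r)) / 2 - ?w r) / r)) (at r)"
      by (rule DERIV_chain2[OF nonlin_has_derivative[OF \<mu> sl]])
    from DERIV_mult'[OF DERIV_ident this]
    have "((\<lambda>r. r * nonlin \<mu> (?w r)) has_real_derivative forcing_r \<alpha> t r) (at r)"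
      by (rule DERIV_cong) (use False in \<open>simp add: forcing_r_def\<close>)
    then show ?thesis by (simp add: forcing_def[abs_def])
  next
    case True
    have "isCont ?w 0"
      using continuous_mean[OF c] by (simp add: continuous_on_eq_continuous_at)
    then have "isCont (\<lambda>r. nonlin \<mu> (?w r)) 0"
      by (intro isCont_o2[OF _ DERIV_isCont[OF nonlin_has_derivative[OF \<mu> sl]]])
    then have "((\<lambda>h. nonlin \<mu> (?w h)) \<longlongrightarrow> nonlin \<mu> (\<alpha> t 0)) (at 0)"
      by (simp add: isCont_def)
    then have "((\<lambda>h. (forcing \<alpha> t (0 + h) - forcing \<alpha> t 0) / h) \<longlongrightarrow> nonlin \<mu> (\<alpha> t 0)) (at 0)"
      by (rule Lim_transform_eventually) (auto simp: forcing_def eventually_at_filter)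
    then show ?thesis using True by (simp add: DERIV_def forcing_r_def)
  qed
qed

end

lemma mean_continuous:
  "\<alpha> \<in> decaying \<Longrightarrow> continuous_on ({0..T} \<times> UNIV) (\<lambda>(t, r). mean (\<alpha> t) r)"
  by (rule continuous_on_mean) (simp add: decaying_def)

lemma continuous_on_nonlin: "continuous_on UNIV (nonlin \<mu>)"
  using nonlin_has_derivative[OF \<mu> sl] by (rule DERIV_continuous_on)

lemma continuous_on_nonlin': "continuous_on UNIV (nonlin' \<mu>)"
proof -
  have "isCont (nonlin' \<mu>) x" for x
  proof -
    define M where "M = \<bar>x\<bar> + 1"
    obtain L where L: "0 \<le> L" "\<forall>x\<in>{-M..M}. \<forall>y\<in>{-M..M}. \<bar>nonlin' \<mu> x - nonlin' \<mu> y\<bar> \<le> L * \<bar>x - y\<bar>"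
      using nonlin'_lipschitz[OF \<mu> sl] by blast
    then have "L-lipschitz_on {-M..M} (nonlin' \<mu>)" by (auto simp: lipschitz_on_def dist_real_def)
    then have "continuous_on {-M..M} (nonlin' \<mu>)" by (rule lipschitz_on_continuous_on)
    then show ?thesis by (rule continuous_on_interior) (auto simp: M_def)
  qed
  then show ?thesis by (simp add: continuous_on_eq_continuous_at)
qed

lemma forcing_continuous:
  assumes \<alpha>: "\<alpha> \<in> decaying"
  shows "continuous_on ({0..T} \<times> UNIV) (\<lambda>(t, r). forcing \<alpha> t r)"
    and "continuous_on ({0..T} \<times> UNIV) (\<lambda>(t, r). forcing_r \<alpha> t r)"
proof -
  note w = mean_continuous[OF \<alpha>, unfolded case_prod_unfold]
  have ac: "continuous_on ({0..T} \<times> UNIV) (\<lambda>(t, r). \<alpha> t r)" using \<alpha> by (simp add: decaying_def)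
  note intros = continuous_on_compose2[OF continuous_on_nonlin w] continuous_on_compose2[OF continuous_on_nonlin' w]
    continuous_on_uncurried_compose[OF ac] w
  show "continuous_on ({0..T} \<times> UNIV) (\<lambda>(t, r). forcing \<alpha> t r)"
    unfolding forcing_def case_prod_unfold by (intro intros continuous_intros) auto
  show "continuous_on ({0..T} \<times> UNIV) (\<lambda>(t, r). forcing_r \<alpha> t r)"
    unfolding forcing_r_def case_prod_unfold by (intro intros continuous_intros) auto
qed

text \<open>
  The point \<open>(t, r)\<close> is reached along the characteristic \<open>y = r + t - s\<close>. Where \<open>y < 0\<close> the weight is constant along
  it. Where \<open>y \<ge> 0\<close>, put \<open>k = 1 + y\<close> and \<open>b = s - y + 2 R\<close>: the sum \<open>2 k + b\<close> is at least \<open>1 / \<omega>(t, r)\<close>, so the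
  partial fraction \<open>1 / (k b) = (1 / k + 2 / b) / (2 k + b)\<close> extracts one factor \<open>\<omega>(t, r)\<close> and leaves two terms
  that are integrable in \<open>s\<close>.
\<close>

lemma weight_along_characteristic:
  assumes s: "0 \<le> s" "s \<le> t" and r: "\<bar>r\<bar> \<le> t + R"
  defines "y \<equiv> r + t - s"
  shows "(\<omega> s y)\<^sup>2 * h y \<le> \<omega> t r * (h y / R + \<mu> \<kappa> * (4 / (R\<^sup>2 + (2 * s - (r + t))\<^sup>2)))"
proof (cases "\<bar>y\<bar> \<le> s + R")
  case False
  then show ?thesis using h_nonneg[of y] modulusD(3)[OF \<mu> \<kappa>0] R \<omega>_nonneg[of t r] by (simp add: \<omega>_def)
next
  case yR: True
  have \<mu>\<kappa>: "0 \<le> \<mu> \<kappa>" by (rule modulusD(3)[OF \<mu> \<kappa>0])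
  define b where "b = s - \<bar>y\<bar> + 2 * R"
  have b: "R \<le> b" "\<omega> s y = 1 / b" using yR by (auto simp: b_def \<omega>_def)
  define c where "c = t - \<bar>r\<bar> + 2 * R"
  have c: "R \<le> c" "\<omega> t r = 1 / c" using r by (auto simp: c_def \<omega>_def)
  define X where "X = \<mu> \<kappa> * (4 / (R\<^sup>2 + (2 * s - (r + t))\<^sup>2))"
  have X: "0 \<le> X" using \<mu>\<kappa> by (simp add: X_def)
  have "(\<omega> s y)\<^sup>2 * h y = h y / b / b" using b by (simp add: power2_eq_square)
  also have "\<dots> \<le> (h y / R + X) / c"
  proof (cases "0 \<le> y")
    case False
    then have "b = c" using s by (simp add: b_def c_def y_def)
    moreover have "h y / b \<le> h y / R" using b R h_nonneg by (intro divide_left_mono) auto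
    moreover have "h y / R \<le> h y / R + X" using X by simp
    ultimately have "h y / b / c \<le> (h y / R + X) / c" using c R by (intro divide_right_mono) linarith+
    with \<open>b = c\<close> show ?thesis by simp
  next
    case True
    define k where "k = 1 + y"
    define m where "m = \<mu> (\<kappa> / k)"
    have k: "1 \<le> k" and hy: "h y = m / k" using True by (auto simp: k_def h_def m_def)
    have "\<kappa> / k \<le> \<kappa>" using k \<kappa>0 by (simp add: divide_le_eq mult_left_le mult_le_cancel_left1)
    then have m: "0 \<le> m" "m \<le> \<mu> \<kappa>"
      using modulus_mono[OF \<mu>, of "\<kappa> / k" \<kappa>] modulusD(3)[OF \<mu>, of "\<kappa> / k"] \<kappa>0 k by (auto simp: m_def)
    have cb: "c \<le> 2 * k + b" using s True by (simp add: c_def k_def b_def y_def)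
    have split: "1 / (k * b) = (1 / k + 2 / b) / (2 * k + b)"
    proof -
      have nz: "k \<noteq> 0" "b \<noteq> 0" "2 * k + b \<noteq> 0" using k b R by auto
      have "1 / k + 2 / b = (2 * k + b) / (k * b)" using nz by (simp add: field_simps)
      then show ?thesis using nz by simp
    qed
    have "h y / b / b = m * (1 / (k * b)) / b" by (simp add: hy)
    also have "\<dots> = m * (1 / k + 2 / b) / b / (2 * k + b)" by (simp add: split)
    also have "\<dots> \<le> m * (1 / k + 2 / b) / b / c"
      using cb c R b k m by (intro divide_left_mono) auto
    also have "\<dots> = (h y / b + m * (2 / b\<^sup>2)) / c" by (simp add: hy power2_eq_square distrib_left add_divide_distrib)
    also have "\<dots> \<le> (h y / R + X) / c"
    proof (intro divide_right_mono add_mono)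
      show "h y / b \<le> h y / R" using b R h_nonneg by (intro divide_left_mono) auto
      have bx: "2 * s - (r + t) = b - 2 * R" using True by (simp add: b_def y_def)
      \<comment> \<open>Valid since \<open>b \<ge> R\<close>: the difference of the two sides is \<open>(b - R) (b + 5 R)\<close>. It replaces \<open>1 / b\<^sup>2\<close> by a function that is integrable on the whole line.\<close>
      have "R\<^sup>2 + (b - 2 * R)\<^sup>2 \<le> 2 * b\<^sup>2"
      proof -
        have "0 \<le> (b - R) * (b + 5 * R)" using b R by simp
        then show ?thesis by (simp add: power2_eq_square algebra_simps)
      qed
      moreover have "0 < R\<^sup>2 + (b - 2 * R)\<^sup>2" using R by (simp add: add_pos_nonneg)
      ultimately have "2 / b\<^sup>2 \<le> 4 / (R\<^sup>2 + (b - 2 * R)\<^sup>2)"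
        using b(1) R by (simp add: divide_le_eq le_divide_eq)
      then have "m * (2 / b\<^sup>2) \<le> \<mu> \<kappa> * (4 / (R\<^sup>2 + (b - 2 * R)\<^sup>2))"
        using m by (intro mult_mono) auto
      then show "m * (2 / b\<^sup>2) \<le> X" by (simp add: X_def bx)
    qed (use c R in auto)
    finally show ?thesis .
  qed
  also have "\<dots> = \<omega> t r * (h y / R + X)" by (simp add: c)
  finally show ?thesis by (simp add: X_def)
qed

definition I :: real where
  "I = integral {-(2*T+R)..2*T+R} h"

lemma smallness: "28 * Q * (I + 8 * \<mu> \<kappa>) \<le> R"
  using small by (simp add: I_def h_def[abs_def])

text \<open>
  The two terms of the previous lemma integrate to at most \<open>I / R\<close> and, by a primitive of arctangent type, to
  \<open>8 \<mu>(\<kappa>) / R\<close>. The smallness assumption then leaves half of \<open>Q \<omega>\<close>.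
\<close>

lemma duhamel_le:
  assumes t: "t \<in> {0..T}"
    and S: "continuous_on ({0..T} \<times> UNIV) (\<lambda>(t, r). S t r)"
    and b: "\<And>s y. s \<in> {0..T} \<Longrightarrow> \<bar>S s y\<bar> \<le> 14 * Q\<^sup>2 * ((\<omega> s y)\<^sup>2 * h y)"
  shows "\<bar>duhamel S t (r + t)\<bar> \<le> Q / 2 * \<omega> t r"
proof (cases "\<bar>r\<bar> \<le> t + R")
  case False
  have "S s (r + t - s) = 0" if "s \<in> {0..t}" for s
  proof -
    have "\<omega> s (r + t - s) = 0" using False that by (auto simp: \<omega>_def)
    then show ?thesis using b[of s "r + t - s"] that t by auto
  qed
  then have "duhamel S t (r + t) = integral {0..t} (\<lambda>_. 0)"
    unfolding duhamel_def by (intro integral_cong) auto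
  then show ?thesis using Q \<omega>_nonneg by simp
next
  case r: True
  define p where "p = r + t"
  define A where "A s = 4 / (R\<^sup>2 + (2 * s - p)\<^sup>2)" for s
  obtain H where H: "\<And>y. (H has_real_derivative h y) (at y)"
    using einterval_antiderivative[of "-\<infinity>" "\<infinity>" h] continuous_on_h
    by (auto simp: has_real_derivative_iff_has_vector_derivative continuous_on_eq_continuous_at)
  have H_mono: "H x \<le> H y" if "x \<le> y" for x y
    using that H h_nonneg by (meson DERIV_nonneg_imp_nondecreasing)
  have h_int: "((\<lambda>s. h (p - s)) has_integral (- H (p - t)) - (- H (p - 0))) {0..t}"
  proof (rule has_integral_of_derivative)
    show "((\<lambda>s. - H (p - s)) has_real_derivative h (p - s)) (at s within {0..t})" for s
      by (rule DERIV_minus[OF DERIV_chain2[OF H], THEN DERIV_cong]) (auto intro!: derivative_eq_intros)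
  qed (use t in auto)
  have "(h has_integral H (2 * T + R) - H (- (2 * T + R))) {- (2 * T + R)..2 * T + R}"
    by (rule has_integral_of_derivative)
       (use T R H in \<open>auto intro: has_field_derivative_at_within\<close>)
  then have I: "I = H (2 * T + R) - H (- (2 * T + R))" unfolding I_def by (rule integral_unique)
  \<comment> \<open>The characteristic through \<open>(t, r)\<close> stays in \<open>[r, r + t]\<close>, which lies in \<open>[-(2 T + R), 2 T + R]\<close>.\<close>
  have "H p \<le> H (2 * T + R)" "H (- (2 * T + R)) \<le> H (p - t)"
    using r t T by (auto simp: p_def intro!: H_mono)
  then have h_le: "(- H (p - t)) - (- H (p - 0)) \<le> I" by (simp add: I)
  \<comment> \<open>A primitive of the second term of the pointwise bound, with oscillation at most \<open>2 \<pi> / R \<le> 8 / R\<close>.\<close>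
  define B where "B s = 2 / R * arctan ((2 * s - p) / R)" for s
  have A_int: "(A has_integral B t - B 0) {0..t}"
  proof (rule has_integral_of_derivative)
    fix s
    have "(B has_real_derivative 2 / R * (inverse (1 + ((2 * s - p) / R)\<^sup>2) * (2 / R))) (at s within {0..t})"
      unfolding B_def[abs_def]
      by (intro DERIV_cmult DERIV_chain2[OF DERIV_arctan]) (use R in \<open>auto intro!: derivative_eq_intros\<close>)
    also have "2 / R * (inverse (1 + ((2 * s - p) / R)\<^sup>2) * (2 / R)) = A s"
    proof -
      have "R\<^sup>2 + (2 * s - p)\<^sup>2 > 0" using R by (simp add: add_pos_nonneg)
      moreover have "1 + ((2 * s - p) / R)\<^sup>2 = (R\<^sup>2 + (2 * s - p)\<^sup>2) / R\<^sup>2"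
        using R by (simp add: power_divide add_divide_distrib)
      ultimately show ?thesis using R by (simp add: A_def power2_eq_square)
    qed
    finally show "(B has_real_derivative A s) (at s within {0..t})" .
  qed (use t in auto)
  have A_le: "B t - B 0 \<le> 8 / R"
  proof -
    have "arctan ((2 * t - p) / R) - arctan ((2 * 0 - p) / R) \<le> 4"
      using arctan_bounded[of "(2 * t - p) / R"] arctan_bounded[of "(2 * 0 - p) / R"] pi_less_4 by linarith
    then have "2 / R * (arctan ((2 * t - p) / R) - arctan ((2 * 0 - p) / R)) \<le> 2 / R * 4"
      using R by (intro mult_left_mono) auto
    then show ?thesis by (simp add: B_def right_diff_distrib)
  qed
  define c where "c = 14 * Q\<^sup>2 * \<omega> t r"
  have c0: "0 \<le> c" using \<omega>_nonneg by (simp add: c_def)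
  have bound_int: "((\<lambda>s. c * (h (p - s) / R + \<mu> \<kappa> * A s)) has_integral
      c * (((- H (p - t)) - (- H (p - 0))) / R + \<mu> \<kappa> * (B t - B 0))) {0..t}"
    by (intro has_integral_mult_right has_integral_add has_integral_divide h_int A_int)
  have "norm (duhamel S t p) \<le> integral {0..t} (\<lambda>s. c * (h (p - s) / R + \<mu> \<kappa> * A s))"
    unfolding duhamel_def
  proof (rule integral_norm_bound_integral)
    show "(\<lambda>s. S s (p - s)) integrable_on {0..t}" by (rule integrable_along_characteristic[OF S t])
    show "(\<lambda>s. c * (h (p - s) / R + \<mu> \<kappa> * A s)) integrable_on {0..t}"
      using bound_int by (rule has_integral_integrable)
    show "norm (S s (p - s)) \<le> c * (h (p - s) / R + \<mu> \<kappa> * A s)" if "s \<in> {0..t}" for s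
    proof -
      have "\<bar>S s (p - s)\<bar> \<le> 14 * Q\<^sup>2 * ((\<omega> s (p - s))\<^sup>2 * h (p - s))" using b that t by auto
      also have "\<dots> \<le> 14 * Q\<^sup>2 * (\<omega> t r * (h (p - s) / R + \<mu> \<kappa> * A s))"
        unfolding p_def A_def
        by (intro mult_left_mono weight_along_characteristic) (use that r in auto)
      finally show ?thesis by (simp add: c_def)
    qed
  qed
  also have "\<dots> = c * (((- H (p - t)) - (- H (p - 0))) / R + \<mu> \<kappa> * (B t - B 0))"
    using bound_int by (rule integral_unique)
  also have "\<dots> \<le> c * (I / R + \<mu> \<kappa> * (8 / R))"
    using h_le A_le R c0 modulusD(3)[OF \<mu> \<kappa>0]
    by (intro mult_left_mono add_mono divide_right_mono) auto
  also have "\<dots> = Q * \<omega> t r / (2 * R) * (28 * Q * (I + 8 * \<mu> \<kappa>))"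
    using R by (simp add: c_def power2_eq_square field_simps)
  also have "\<dots> \<le> Q * \<omega> t r / (2 * R) * R"
    using smallness Q R \<omega>_nonneg by (intro mult_left_mono) auto
  also have "\<dots> = Q / 2 * \<omega> t r" using R by simp
  finally show ?thesis by (simp add: p_def)
qed

text \<open>
  The free solution lives on \<open>\<bar>r + t\<bar> \<le> R\<close>, where \<open>t - \<bar>r\<bar> \<le> R\<close> and hence \<open>\<omega> \<ge> 1 / (3 R)\<close>.
\<close>

lemma data_le:
  assumes "0 \<le> t"
  shows "\<bar>a\<^sub>0 (r + t)\<bar> \<le> Q / 2 * \<omega> t r" "\<bar>\<alpha>\<^sub>0 (r + t)\<bar> \<le> Q / 2 * \<omega> t r"
proof -
  have *: "\<bar>x\<bar> \<le> Q / 2 * \<omega> t r" if x: "R < \<bar>r + t\<bar> \<Longrightarrow> x = 0" "\<bar>x\<bar> \<le> Q / (6 * R)" for x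
  proof (cases "R < \<bar>r + t\<bar>")
    case True
    then show ?thesis using x Q \<omega>_nonneg by simp
  next
    case False
    have w: "\<bar>r\<bar> \<le> t + R" "0 < t - \<bar>r\<bar> + 2 * R" "t - \<bar>r\<bar> + 2 * R \<le> 3 * R"
      using False assms R by auto
    then have "1 / (3 * R) \<le> \<omega> t r" using R by (auto simp: \<omega>_def intro!: divide_left_mono)
    then have "Q / 2 * (1 / (3 * R)) \<le> Q / 2 * \<omega> t r" using Q by (intro mult_left_mono) auto
    then show ?thesis using x(2) by simp
  qed
  show "\<bar>a\<^sub>0 (r + t)\<bar> \<le> Q / 2 * \<omega> t r" "\<bar>\<alpha>\<^sub>0 (r + t)\<bar> \<le> Q / 2 * \<omega> t r"
    by (intro *; simp add: data_support data_bound)+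
qed

context
  fixes \<alpha>
  assumes \<alpha>: "\<alpha> \<in> decaying"
begin

lemma sol_bounds:
  assumes t: "t \<in> {0..T}"
  shows "\<bar>sol \<alpha> t r\<bar> \<le> Q * \<omega> t r" "\<bar>sol_r \<alpha> t r\<bar> \<le> Q * \<omega> t r"
proof -
  have t0: "0 \<le> t" using t by simp
  have sum: "\<bar>x + y\<bar> \<le> Q * \<omega> t r" if "\<bar>x\<bar> \<le> Q / 2 * \<omega> t r" "\<bar>y\<bar> \<le> Q / 2 * \<omega> t r" for x y
    using abs_triangle_ineq[of x y] that by simp
  show "\<bar>sol \<alpha> t r\<bar> \<le> Q * \<omega> t r"
    unfolding sol_def
    by (rule sum[OF data_le(1)[OF t0] duhamel_le[OF t forcing_continuous(1)[OF \<alpha>] forcing_bounds(1)[OF \<alpha>]]])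
  show "\<bar>sol_r \<alpha> t r\<bar> \<le> Q * \<omega> t r"
    unfolding sol_r_def
    by (rule sum[OF data_le(2)[OF t0] duhamel_le[OF t forcing_continuous(2)[OF \<alpha>] forcing_bounds(2)[OF \<alpha>]]])
qed

lemma continuous_on_shifted_sum:
  fixes f :: "real \<Rightarrow> real" and g :: "real \<Rightarrow> real \<Rightarrow> real"
  assumes "continuous_on UNIV f" "continuous_on ({0..T} \<times> UNIV) (\<lambda>(t, p). g t p)"
  shows "continuous_on ({0..T} \<times> UNIV) (\<lambda>(t, r). f (r + t) + g t (r + t))"
  unfolding case_prod_unfold
proof (rule continuous_on_add)
  show "continuous_on ({0..T} \<times> UNIV) (\<lambda>x. f (snd x + fst x))"
    by (rule continuous_on_compose2[OF assms(1)]) (auto intro!: continuous_intros)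
  show "continuous_on ({0..T} \<times> UNIV) (\<lambda>x. g (fst x) (snd x + fst x))"
    by (rule continuous_on_uncurried_compose[OF assms(2)]) (auto intro!: continuous_intros)
qed

lemma sol_r_continuous: "continuous_on ({0..T} \<times> UNIV) (\<lambda>(t, r). sol_r \<alpha> t r)"
  unfolding sol_r_def
  by (rule continuous_on_shifted_sum[OF \<alpha>0_cont continuous_on_duhamel[OF forcing_continuous(2)[OF \<alpha>]]])

lemma sol_continuous: "continuous_on ({0..T} \<times> UNIV) (\<lambda>(t, r). sol \<alpha> t r)"
  unfolding sol_def
  by (rule continuous_on_shifted_sum[OF DERIV_continuous_on[OF has_field_derivative_at_within[OF a0_deriv]]
        continuous_on_duhamel[OF forcing_continuous(1)[OF \<alpha>]]])

lemma sol_has_space_derivative: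
  assumes t: "t \<in> {0..T}"
  shows "(sol \<alpha> t has_real_derivative sol_r \<alpha> t r) (at r)"
proof -
  have D: "((\<lambda>p. duhamel (forcing \<alpha>) t p) has_real_derivative duhamel (forcing_r \<alpha>) t p) (at p)" for p
    by (rule duhamel_has_space_derivative[OF forcing_continuous(2)[OF \<alpha>] t _ forcing_continuous(1)[OF \<alpha>]])
       (rule forcing_has_derivative[OF \<alpha>])
  have "((\<lambda>r. a\<^sub>0 (r + t) + duhamel (forcing \<alpha>) t (r + t)) has_real_derivative
      \<alpha>\<^sub>0 (r + t) * 1 + duhamel (forcing_r \<alpha>) t (r + t) * 1) (at r)"
    by (intro DERIV_add DERIV_chain2[OF a0_deriv] DERIV_chain2[OF D])
       (auto intro!: derivative_eq_intros)
  then show ?thesis by (simp add: sol_def[abs_def] sol_r_def)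
qed

text \<open>
  The bound for \<open>r\<close> times the mean of \<open>sol_r\<close> is a bound for the odd part of its primitive \<open>sol\<close>; for this reason
  the source and its derivative are estimated in parallel.
\<close>

lemma sol_r_decaying: "sol_r \<alpha> \<in> decaying"
proof -
  have "\<bar>r * mean (sol_r \<alpha> t) r\<bar> \<le> Q * \<omega> t r" if t: "t \<in> {0..T}" for t r
    using sol_bounds(1)[OF t, of r] sol_bounds(1)[OF t, of "- r"]
    unfolding radius_times_mean[OF sol_has_space_derivative[OF t]] \<omega>_minus by (rule abs_half_diff_le)
  then show ?thesis using sol_bounds(2) sol_r_continuous unfolding decaying_def by simp
qed

text \<open>
  The transport equation \<open>a\<^sub>t = a\<^sub>r + F\<close>.
\<close>

lemma sol_has_time_derivative:
  assumes t: "t \<in> {0..T}"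
  shows "((\<lambda>t. sol \<alpha> t r) has_real_derivative sol_r \<alpha> t r + forcing \<alpha> t r) (at t within {0..T})"
proof -
  note cF = forcing_continuous[OF \<alpha>]
  have "((\<lambda>s. duhamel (forcing \<alpha>) s (r + s)) has_real_derivative
      forcing \<alpha> t (r + t - t) + duhamel (forcing_r \<alpha>) t (r + t) * 1) (at t within {0..T})"
  proof (rule has_real_derivative_along_curve[where Y=UNIV and X="{0..T}" and f="duhamel (forcing \<alpha>)"
      and c="\<lambda>s. r + s" and ft="\<lambda>s y. forcing \<alpha> s (y - s)" and fy="duhamel (forcing_r \<alpha>)"])
    show "((\<lambda>s. duhamel (forcing \<alpha>) s (r + t)) has_real_derivative forcing \<alpha> t (r + t - t)) (at t within {0..T})"
      by (rule duhamel_has_time_derivative[OF cF(1) t])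
    show "(duhamel (forcing \<alpha>) s has_real_derivative duhamel (forcing_r \<alpha>) s y) (at y)" if "s \<in> {0..T}" for s y
      by (rule duhamel_has_space_derivative[OF cF(2) that _ cF(1)]) (rule forcing_has_derivative[OF \<alpha>])
  qed (use t continuous_on_duhamel[OF cF(2)] in \<open>auto intro!: derivative_eq_intros\<close>)
  moreover have "((\<lambda>s. a\<^sub>0 (r + s)) has_real_derivative \<alpha>\<^sub>0 (r + t) * 1) (at t within {0..T})"
    by (rule DERIV_chain2[OF a0_deriv]) (auto intro!: derivative_eq_intros)
  ultimately have "((\<lambda>s. a\<^sub>0 (r + s) + duhamel (forcing \<alpha>) s (r + s)) has_real_derivative
      \<alpha>\<^sub>0 (r + t) * 1 + (forcing \<alpha> t (r + t - t) + duhamel (forcing_r \<alpha>) t (r + t) * 1)) (at t within {0..T})"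
    by (intro DERIV_add)
  then show ?thesis by (simp add: sol_def[abs_def] sol_r_def add_ac)
qed

end

end

section \<open>The fixed point\<close>

context small_data_wave
begin

lemma decaying_closed:
  assumes F: "\<And>n. curry (F n) \<in> decaying" and lim: "uniform_limit ({0..T} \<times> UNIV) F l sequentially"
  shows "curry l \<in> decaying"
proof -
  have l_cont: "continuous_on ({0..T} \<times> UNIV) l"
    by (rule uniform_limit_theorem[OF _ lim]) (use F in \<open>auto simp: decaying_def case_prod_unfold\<close>)
  have pt: "(\<lambda>n. F n (t, r)) \<longlonglongrightarrow> l (t, r)" if "t \<in> {0..T}" for t r
    by (rule tendsto_uniform_limitI[OF lim]) (use that in auto)
  have mean_lim: "(\<lambda>n. mean (curry (F n) t) r) \<longlonglongrightarrow> mean (curry l t) r" if t: "t \<in> {0..T}" for t r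
  proof (rule LIMSEQ_I)
    fix e :: real assume "0 < e"
    obtain N where N: "\<And>n x. N \<le> n \<Longrightarrow> x \<in> {0..T} \<times> UNIV \<Longrightarrow> dist (F n x) (l x) < e / 2"
      using uniform_limitD[OF lim, of "e / 2"] \<open>0 < e\<close> by (auto simp: eventually_sequentially)
    have "norm (mean (curry (F n) t) r - mean (curry l t) r) < e" if "N \<le> n" for n
    proof -
      have c: "continuous_on UNIV (curry (F n) t)" "continuous_on UNIV (curry l t)"
        using continuous_decaying[OF F t] continuous_on_slice[of "{0..T}" "curry l" t] t l_cont by auto
      have "\<bar>mean (\<lambda>y. curry (F n) t y - curry l t y) r\<bar> \<le> e / 2"
        using N[OF that, of "(t, _)"] t
        by (intro abs_mean_le continuous_on_diff c) (auto simp: dist_real_def intro: less_imp_le)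
      then show ?thesis using \<open>0 < e\<close> by (simp add: mean_diff[OF c])
    qed
    then show "\<exists>N. \<forall>n\<ge>N. norm (mean (curry (F n) t) r - mean (curry l t) r) < e" by blast
  qed
  have "\<bar>l (t, r)\<bar> \<le> Q * \<omega> t r" if t: "t \<in> {0..T}" for t r
    using decaying_le(1)[OF F t, of _ r]
    by (intro LIMSEQ_le_const2[OF tendsto_rabs[OF pt[OF t]]]) auto
  moreover have "\<bar>r * mean (curry l t) r\<bar> \<le> Q * \<omega> t r" if t: "t \<in> {0..T}" for t r
    using decaying_le(2)[OF F t, of r]
    by (intro LIMSEQ_le_const2[OF tendsto_rabs[OF tendsto_mult[OF tendsto_const mean_lim[OF t]]]]) auto
  ultimately show ?thesis using l_cont by (simp add: decaying_def case_prod_unfold)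
qed

text \<open>
  The estimate is local in time: it compares the sources at time \<open>s\<close> in terms of the two functions at the same
  time, because the mean is taken in space only.
\<close>

lemma forcing_r_lipschitz:
  "\<exists>\<Lambda>>0. \<forall>\<alpha>\<in>decaying. \<forall>\<beta>\<in>decaying. \<forall>s\<in>{0..T}. \<forall>c r. (\<forall>y. \<bar>\<alpha> s y - \<beta> s y\<bar> \<le> c) \<longrightarrow>
     \<bar>forcing_r \<alpha> s r - forcing_r \<beta> s r\<bar> \<le> \<Lambda> * c"
proof -
  define M where "M = Q / R"
  have M0: "0 \<le> M" using Q R by (simp add: M_def)
  obtain L where L: "0 \<le> L" "\<And>x y. \<bar>x\<bar> \<le> M \<Longrightarrow> \<bar>y\<bar> \<le> M \<Longrightarrow> \<bar>nonlin' \<mu> x - nonlin' \<mu> y\<bar> \<le> L * \<bar>x - y\<bar>"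
    using nonlin'_lipschitz[OF \<mu> sl, of M] by (auto simp: abs_le_iff)
  define K where "K = 3 * M * \<mu> M"
  have K: "0 \<le> K" "\<bar>nonlin' \<mu> x\<bar> \<le> K" if "\<bar>x\<bar> \<le> M" for x
  proof -
    show "0 \<le> K" using modulusD(3)[OF \<mu> M0] M0 by (simp add: K_def)
    have "3 * \<bar>x\<bar> * \<mu> \<bar>x\<bar> \<le> K"
      unfolding K_def using that M0 modulus_mono[OF \<mu>, of "\<bar>x\<bar>" M] modulusD(3)[OF \<mu>]
      by (intro mult_mono) auto
    then show "\<bar>nonlin' \<mu> x\<bar> \<le> K" using abs_nonlin'_le[OF \<mu> sl, of x] by simp
  qed
  have K0: "0 \<le> K" using K(1)[of 0] M0 by simp
  have G: "\<bar>nonlin \<mu> x - nonlin \<mu> y\<bar> \<le> K * \<bar>x - y\<bar>" if "\<bar>x\<bar> \<le> M" "\<bar>y\<bar> \<le> M" for x y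
    using field_differentiable_bound[of "{-M..M}" "nonlin \<mu>" "nonlin' \<mu>" K x y] K(2) that
      has_field_derivative_at_within[OF nonlin_has_derivative[OF \<mu> sl]]
    by (auto simp: abs_le_iff)
  have bnd: "Q * \<omega> t r \<le> M" for t r
    using mult_left_mono[OF \<omega>_le[of t r] Q] by (simp add: M_def)
  show ?thesis
  proof (intro exI[of _ "3 * K + 2 * L * M + 1"] conjI ballI allI impI)
    show "0 < 3 * K + 2 * L * M + 1" using K0 L(1) M0 by (simp add: add_nonneg_pos)
    fix \<alpha> \<beta> s c r
    assume \<alpha>: "\<alpha> \<in> decaying" and \<beta>: "\<beta> \<in> decaying" and s: "s \<in> {0..T}"
      and "\<forall>y. \<bar>\<alpha> s y - \<beta> s y\<bar> \<le> c"
    then have diff: "\<bar>\<alpha> s y - \<beta> s y\<bar> \<le> c" for y by simp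
    have c0: "0 \<le> c" using diff[of 0] by linarith
    define w z w' z' where "w = mean (\<alpha> s) r" and "z = (\<alpha> s r + \<alpha> s (- r)) / 2"
      and "w' = mean (\<beta> s) r" and "z' = (\<beta> s r + \<beta> s (- r)) / 2"
    note ca = continuous_decaying[OF \<alpha> s] and cb = continuous_decaying[OF \<beta> s]
    have w: "\<bar>w\<bar> \<le> M" and w': "\<bar>w'\<bar> \<le> M"
      using mean_decaying_le[OF \<alpha> s, of r] mean_decaying_le[OF \<beta> s, of r] bnd[of s r] by (auto simp: w_def w'_def)
    have z': "\<bar>z'\<bar> \<le> M"
      unfolding z'_def
      by (rule abs_half_sum_le; rule order_trans[OF decaying_le(1)[OF \<beta> s] bnd])
    have ww: "\<bar>w - w'\<bar> \<le> c"
      unfolding w_def w'_def mean_diff[OF ca cb]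
      by (intro abs_mean_le continuous_on_diff ca cb diff)
    have zz: "\<bar>z - z'\<bar> \<le> c"
      using abs_half_sum_le[OF diff[of r] diff[of "- r"]] by (simp add: z_def z'_def field_simps)
    \<comment> \<open>The increment of \<open>z - w\<close> is paired with \<open>G'\<close> at one argument, the increment of \<open>G'\<close> with \<open>z' - w'\<close> at the other.\<close>
    have eq: "forcing_r \<alpha> s r - forcing_r \<beta> s r =
        (nonlin \<mu> w - nonlin \<mu> w') + nonlin' \<mu> w * ((z - z') - (w - w')) + (nonlin' \<mu> w - nonlin' \<mu> w') * (z' - w')"
      by (simp add: forcing_r_def w_def z_def w'_def z'_def algebra_simps)
    have "\<bar>nonlin \<mu> w - nonlin \<mu> w'\<bar> \<le> K * c"
      using G[OF w w'] mult_left_mono[OF ww K0] by linarith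
    moreover have "\<bar>nonlin' \<mu> w * ((z - z') - (w - w'))\<bar> \<le> K * (2 * c)"
      unfolding abs_mult using K(2)[OF w] ww zz K0 by (intro mult_mono) auto
    moreover have "\<bar>(nonlin' \<mu> w - nonlin' \<mu> w') * (z' - w')\<bar> \<le> (L * c) * (2 * M)"
    proof -
      have "\<bar>nonlin' \<mu> w - nonlin' \<mu> w'\<bar> \<le> L * c"
        using L(2)[OF w w'] mult_left_mono[OF ww L(1)] by linarith
      then show ?thesis
        unfolding abs_mult using z' w' L(1) c0 M0 by (intro mult_mono) auto
    qed
    ultimately have "\<bar>forcing_r \<alpha> s r - forcing_r \<beta> s r\<bar> \<le> K * c + K * (2 * c) + (L * c) * (2 * M)"
      unfolding eq by linarith
    also have "\<dots> \<le> (3 * K + 2 * L * M + 1) * c" using c0 by (simp add: algebra_simps)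
    finally show "\<bar>forcing_r \<alpha> s r - forcing_r \<beta> s r\<bar> \<le> (3 * K + 2 * L * M + 1) * c" .
  qed
qed

text \<open>
  With the weight \<open>exp (2 \<Lambda> t)\<close> the integral in time of the Lipschitz bound gains the factor \<open>1 / 2\<close>.
\<close>

lemma fixed_point_exists: "\<exists>\<alpha>\<in>decaying. \<forall>t\<in>{0..T}. \<forall>r. sol_r \<alpha> t r = \<alpha> t r"
proof -
  obtain \<Lambda> where \<Lambda>: "0 < \<Lambda>"
    and lip: "\<And>\<alpha> \<beta> s c r. \<alpha> \<in> decaying \<Longrightarrow> \<beta> \<in> decaying \<Longrightarrow> s \<in> {0..T} \<Longrightarrow>
      (\<And>y. \<bar>\<alpha> s y - \<beta> s y\<bar> \<le> c) \<Longrightarrow> \<bar>forcing_r \<alpha> s r - forcing_r \<beta> s r\<bar> \<le> \<Lambda> * c"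
    using forcing_r_lipschitz by auto
  define W :: "real \<times> real \<Rightarrow> real" where "W x = exp (2 * \<Lambda> * fst x)" for x
  have zero: "curry (\<lambda>_. 0) \<in> decaying"
    using Q \<omega>_nonneg by (auto simp: decaying_def mean_def)
  have "\<exists>f\<in>{f. curry f \<in> decaying}. \<forall>x\<in>{0..T} \<times> UNIV. (\<lambda>(t, r). sol_r (curry f) t r) x = f x"
  proof (rule weighted_contraction_fixed_point[where ?f0.0="\<lambda>_. 0" and W=W and B="exp (2 * \<Lambda> * T)" and M="M" for M])
    show "(\<lambda>_. 0) \<in> {f. curry f \<in> decaying}" using zero by simp
    show "(\<lambda>(t, r). sol_r (curry f) t r) \<in> {f. curry f \<in> decaying}" if "f \<in> {f. curry f \<in> decaying}" for f
      using sol_r_decaying[of "curry f"] that by (simp add: curry_def)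
    show "l \<in> {f. curry f \<in> decaying}"
      if "\<And>n. F n \<in> {f. curry f \<in> decaying}" "uniform_limit ({0..T} \<times> UNIV) F l sequentially" for F l
      using decaying_closed[of F l] that by simp
    show "0 \<le> W x" for x by (simp add: W_def)
    show "W x \<le> exp (2 * \<Lambda> * T)" if "x \<in> {0..T} \<times> UNIV" for x
      using that \<Lambda> by (auto simp: W_def)
    show "0 \<le> Q / R" using Q R by simp
    show "\<bar>(\<lambda>(t, r). sol_r (curry (\<lambda>_. 0)) t r) x - 0\<bar> \<le> Q / R * W x" if x: "x \<in> {0..T} \<times> UNIV" for x
    proof -
      have "\<bar>sol_r (curry (\<lambda>_. 0)) (fst x) (snd x)\<bar> \<le> Q * \<omega> (fst x) (snd x)"
        using sol_bounds(2)[OF zero] x by auto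
      also have "\<dots> \<le> Q / R * 1" using mult_left_mono[OF \<omega>_le Q] by simp
      also have "\<dots> \<le> Q / R * W x" using x \<Lambda> Q R by (intro mult_left_mono) (auto simp: W_def)
      finally show ?thesis by (simp add: case_prod_unfold)
    qed
  next
    fix f g and c :: real and x :: "real \<times> real"
    assume f: "f \<in> {f. curry f \<in> decaying}" and g: "g \<in> {f. curry f \<in> decaying}" and c: "0 \<le> c"
      and d: "\<And>x. x \<in> {0..T} \<times> UNIV \<Longrightarrow> \<bar>f x - g x\<bar> \<le> c * W x" and x: "x \<in> {0..T} \<times> UNIV"
    obtain t r where [simp]: "x = (t, r)" by (cases x)
    have t: "t \<in> {0..T}" using x by simp
    let ?p = "r + t"
    let ?N = "\<lambda>h s. forcing_r (curry h) s (?p - s)"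
    have ci: "(\<lambda>s. ?N h s) integrable_on {0..t}" if "curry h \<in> decaying" for h
      by (rule integrable_along_characteristic[OF forcing_continuous(2)[OF that] t])
    have E: "((\<lambda>s. \<Lambda> * (c * exp (2 * \<Lambda> * s))) has_integral c / 2 * exp (2 * \<Lambda> * t) - c / 2 * exp (2 * \<Lambda> * 0)) {0..t}"
      by (rule has_integral_of_derivative) (use t in \<open>auto intro!: derivative_eq_intros\<close>)
    have "norm (integral {0..t} (\<lambda>s. ?N f s - ?N g s)) \<le> integral {0..t} (\<lambda>s. \<Lambda> * (c * exp (2 * \<Lambda> * s)))"
    proof (rule integral_norm_bound_integral)
      show "(\<lambda>s. ?N f s - ?N g s) integrable_on {0..t}" using f g by (intro integrable_diff ci) auto
      show "(\<lambda>s. \<Lambda> * (c * exp (2 * \<Lambda> * s))) integrable_on {0..t}" using E by (rule has_integral_integrable)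
      show "norm (?N f s - ?N g s) \<le> \<Lambda> * (c * exp (2 * \<Lambda> * s))" if s: "s \<in> {0..t}" for s
        unfolding real_norm_def
      proof (rule lip)
        show "\<bar>curry f s y - curry g s y\<bar> \<le> c * exp (2 * \<Lambda> * s)" for y
          using d[of "(s, y)"] s t by (simp add: W_def)
      qed (use f g s t in auto)
    qed
    also have "\<dots> = c / 2 * exp (2 * \<Lambda> * t) - c / 2 * exp (2 * \<Lambda> * 0)" using E by (rule integral_unique)
    also have "\<dots> \<le> c / 2 * W x" using c by (simp add: W_def)
    finally have "\<bar>integral {0..t} (?N f) - integral {0..t} (?N g)\<bar> \<le> c / 2 * W x"
      using integral_diff[OF ci ci, of f g] f g by simp
    then show "\<bar>(\<lambda>(t, r). sol_r (curry f) t r) x - (\<lambda>(t, r). sol_r (curry g) t r) x\<bar> \<le> c / 2 * W x"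
      by (simp add: sol_r_def duhamel_def)
  qed
  then obtain f where f: "curry f \<in> decaying" "\<And>x. x \<in> {0..T} \<times> UNIV \<Longrightarrow> (\<lambda>(t, r). sol_r (curry f) t r) x = f x" by auto
  show ?thesis
  proof (intro bexI[of _ "curry f"] ballI allI)
    fix t r assume "t \<in> {0..T}"
    then show "sol_r (curry f) t r = curry f t r" using f(2)[of "(t, r)"] by simp
  qed (rule f)
qed

end

section \<open>From the fixed point to a classical solution\<close>

lemma at_within_Ici_neq_bot: "0 \<le> r \<Longrightarrow> at r within {0..} \<noteq> bot" for r :: real
  using islimpt_subset[of r "{0..r + 1}" "{0..}"] by (simp add: trivial_limit_within islimpt_Icc)

lemma at_within_Icc_neq_bot: "0 < T \<Longrightarrow> t \<in> {0..T} \<Longrightarrow> at t within {0..T} \<noteq> bot" for t T :: real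
  by (simp add: trivial_limit_within islimpt_Icc)

text \<open>
  The derivative within a set is a Hilbert choice, so congruence is proved for the relation that it selects from.
\<close>

lemma deriv_within_cong:
  assumes "x \<in> S" "\<And>y. y \<in> S \<Longrightarrow> f y = g y"
  shows "deriv_within S f x = deriv_within S g x"
proof -
  have "(f has_vector_derivative D) (at x within S) \<longleftrightarrow> (g has_vector_derivative D) (at x within S)" for D
    using assms by (intro has_vector_derivative_cong_ev) (auto simp: eventually_at_filter)
  then show ?thesis by (simp add: deriv_within_def vector_derivative_def)
qed

lemma deriv_within_transform_eqI:
  assumes "(f has_real_derivative D) (at x within S)" "at x within S \<noteq> bot" "x \<in> S"
    and "\<And>y. y \<in> S \<Longrightarrow> g y = f y"
  shows "deriv_within S g x = D"
  using deriv_within_cong[of x S g f] deriv_within_eqI assms by metis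

lemma pd_t_eqI:
  assumes "0 < T" "t \<in> {0..T}" "((\<lambda>s. u s r) has_real_derivative D) (at t within {0..T})"
    and "\<And>s. s \<in> {0..T} \<Longrightarrow> u' s r = u s r"
  shows "pd_t T u' t r = D"
  unfolding pd_t_def using assms by (intro deriv_within_transform_eqI at_within_Icc_neq_bot) auto

lemma pd_r_eqI:
  assumes "0 \<le> r" "(u t has_real_derivative D) (at r within {0..})" "\<And>r. 0 \<le> r \<Longrightarrow> u' t r = u t r"
  shows "pd_r u' t r = D"
  unfolding pd_r_def using assms by (intro deriv_within_transform_eqI at_within_Ici_neq_bot) auto

lemma differentiable_on_cong:
  assumes "\<And>x. x \<in> S \<Longrightarrow> f x = g x"
  shows "f differentiable_on S \<longleftrightarrow> g differentiable_on S"
proof -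
  have "g differentiable_on S" if "\<And>x. x \<in> S \<Longrightarrow> g x = f x" "f differentiable_on S" for f g
    using that unfolding differentiable_on_def differentiable_def by (meson has_derivative_transform)
  from this[of g f] this[of f g] assms show ?thesis by fastforce
qed

lemma Ck2_on_cong:
  assumes "\<And>t r. t \<in> {0..T} \<Longrightarrow> 0 \<le> r \<Longrightarrow> u t r = u' t r"
  shows "Ck2_on k T u \<longleftrightarrow> Ck2_on k T u'"
  using assms
proof (induction k arbitrary: u u')
  case 0
  then show ?case by (auto intro!: continuous_on_cong)
next
  case (Suc k)
  have "continuous_on ({0..T} \<times> {0..}) (\<lambda>(t, r). u t r) \<longleftrightarrow> continuous_on ({0..T} \<times> {0..}) (\<lambda>(t, r). u' t r)"
    using Suc.prems by (intro continuous_on_cong) auto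
  moreover have "(\<lambda>s. u s r) differentiable_on {0..T} \<longleftrightarrow> (\<lambda>s. u' s r) differentiable_on {0..T}" if "0 \<le> r" for r
    using Suc.prems that by (intro differentiable_on_cong) auto
  moreover have "u t differentiable_on {0..} \<longleftrightarrow> u' t differentiable_on {0..}" if "t \<in> {0..T}" for t
    using Suc.prems that by (intro differentiable_on_cong) auto
  moreover have "Ck2_on k T (pd_t T u) \<longleftrightarrow> Ck2_on k T (pd_t T u')"
    using Suc.prems by (intro Suc.IH) (auto simp: pd_t_def intro!: deriv_within_cong)
  moreover have "Ck2_on k T (pd_r u) \<longleftrightarrow> Ck2_on k T (pd_r u')"
    using Suc.prems by (intro Suc.IH) (auto simp: pd_r_def intro!: deriv_within_cong)
  ultimately show ?case by auto
qed

lemma Ck2_on_SucI: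
  assumes T: "0 < T"
    and c: "continuous_on ({0..T} \<times> {0..}) (\<lambda>(t, r). u t r)"
    and t: "\<And>t r. t \<in> {0..T} \<Longrightarrow> 0 \<le> r \<Longrightarrow> ((\<lambda>s. u s r) has_real_derivative ut t r) (at t within {0..T})"
    and r: "\<And>t r. t \<in> {0..T} \<Longrightarrow> 0 \<le> r \<Longrightarrow> (u t has_real_derivative ur t r) (at r within {0..})"
    and C: "Ck2_on k T ut" "Ck2_on k T ur"
  shows "Ck2_on (Suc k) T u"
proof -
  have "Ck2_on k T (pd_t T u)"
    using C(1) by (subst Ck2_on_cong[where u'=ut]) (auto intro!: pd_t_eqI[OF T] t)
  moreover have "Ck2_on k T (pd_r u)"
    using C(2) by (subst Ck2_on_cong[where u'=ur]) (auto intro!: pd_r_eqI r)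
  moreover have "(\<lambda>s. u s r) differentiable_on {0..T}" if "0 \<le> r" for r
    using t that unfolding differentiable_on_def differentiable_def has_field_derivative_def by blast
  moreover have "u t differentiable_on {0..}" if "t \<in> {0..T}" for t
    using r that unfolding differentiable_on_def differentiable_def has_field_derivative_def by blast
  ultimately show ?thesis using c by simp
qed

lemma Ck2_on_0I:
  assumes "continuous_on ({0..T} \<times> UNIV) (\<lambda>(t, r). u t r)"
  shows "Ck2_on 0 T u"
  unfolding Ck2_on.simps by (rule continuous_on_subset[OF assms]) auto

lemma mean_odd_eq_0:
  assumes "\<And>y. f (- y) = - f y"
  shows "mean f r = 0"
proof -
  have "mean f (- r) = - mean f r" using assms by (simp add: mean_def)
  then show ?thesis by simp
qed

lemma mean_add:
  assumes "continuous_on UNIV f" "continuous_on UNIV g"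
  shows "mean (\<lambda>y. f y + g y) r = mean f r + mean g r"
  using mean_diff[of f "\<lambda>y. - g y" r] assms
  by (simp add: mean_def continuous_intros)

context small_data_wave
begin

lemma forcing_le_weight:
  assumes "\<alpha> \<in> decaying" "t \<in> {0..T}"
  shows "\<bar>forcing \<alpha> t r\<bar> \<le> Q * \<omega> t r"
proof -
  have \<mu>\<kappa>: "0 \<le> \<mu> \<kappa>" by (rule modulusD(3)[OF \<mu> \<kappa>0])
  have "0 \<le> I" unfolding I_def
    by (rule integral_nonneg)
       (auto intro!: h_nonneg integrable_continuous_real continuous_on_subset[OF continuous_on_h])
  then have "Q * \<mu> \<kappa> \<le> Q * (I + 8 * \<mu> \<kappa>)" using Q \<mu>\<kappa> by (intro mult_left_mono) auto
  then have s: "14 * (Q * \<mu> \<kappa>) \<le> R" using smallness mult_nonneg_nonneg[OF Q \<mu>\<kappa>] by linarith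
  have "h r \<le> \<mu> \<kappa> / 1"
    unfolding h_def using \<kappa>0 \<mu>\<kappa>
    by (intro frac_le modulus_mono[OF \<mu>]) (auto simp: divide_le_eq mult_le_cancel_left1 intro!: mult_left_le)
  then have "14 * Q\<^sup>2 * ((\<omega> t r)\<^sup>2 * h r) \<le> 14 * Q\<^sup>2 * ((\<omega> t r * (1 / R)) * \<mu> \<kappa>)"
    using \<omega>_nonneg[of t r] mult_left_mono[OF \<omega>_le \<omega>_nonneg, of t r t r] h_nonneg R
    by (intro mult_left_mono mult_mono) (auto simp: power2_eq_square)
  also have "\<dots> = Q * \<omega> t r * (14 * (Q * \<mu> \<kappa>) / R)" by (simp add: power2_eq_square)
  also have "\<dots> \<le> Q * \<omega> t r * 1" using s R Q \<omega>_nonneg by (intro mult_left_mono) auto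
  finally show ?thesis using forcing_bounds(1)[OF assms, of r] by simp
qed

text \<open>
  With \<open>a\<close> the primitive of the fixed point \<open>\<alpha>\<close>, the solution \<open>u\<close> is the mean of \<open>a\<close>. The first derivatives of
  \<open>v = r u\<close> are the odd and even parts of \<open>a\<close>, and its second derivatives those of \<open>\<alpha>\<close> and of \<open>\<alpha> + F\<close>, so all
  regularity and decay statements reduce to those for \<open>a\<close>, \<open>\<alpha>\<close> and \<open>F\<close>. As \<open>F\<close> is odd, it does not contribute to
  means.
\<close>

theorem classical_solution_exists:
  assumes u0: "\<And>r. 0 \<le> r \<Longrightarrow> mean a\<^sub>0 r = u\<^sub>0 r" and u1: "\<And>r. 0 \<le> r \<Longrightarrow> mean \<alpha>\<^sub>0 r = u\<^sub>1 r"
    and u0_support: "\<And>r. R < r \<Longrightarrow> u\<^sub>0 r = 0"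
  shows "\<exists>u. classical_solution \<mu> u\<^sub>0 u\<^sub>1 T u \<and>
    closure (support_on ({0..T} \<times> {0..}) (\<lambda>(t, r). u t r)) \<subseteq> {(t, r). t \<in> {0..T} \<and> r \<ge> 0 \<and> r \<le> t + R} \<and>
    (\<forall>t\<in>{0..T}. \<forall>r\<in>{0..t + R}.
      (\<forall>a b. a + b \<le> 1 \<longrightarrow> \<bar>pd T a b u t r\<bar> \<le> 2 * Q * inverse (t - r + 2 * R)) \<and>
      (\<forall>a b. 1 \<le> a + b \<and> a + b \<le> 2 \<longrightarrow>
        \<bar>pd T a b (\<lambda>t r. r * u t r) t r\<bar> \<le> 2 * Q * inverse (t - r + 2 * R)))"
proof -
  obtain \<alpha> where \<alpha>: "\<alpha> \<in> decaying" and fp: "\<And>t r. t \<in> {0..T} \<Longrightarrow> sol_r \<alpha> t r = \<alpha> t r"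
    using fixed_point_exists by blast
  define a where "a = sol \<alpha>"
  define F where "F = forcing \<alpha>"
  define u where "u t r = mean (a t) r" for t r
  define v where "v t r = r * u t r" for t r
  have a_r: "(a t has_real_derivative \<alpha> t r) (at r)" if "t \<in> {0..T}" for t r
    using sol_has_space_derivative[OF \<alpha> that, of r] fp[OF that] by (simp add: a_def)
  have a_t: "((\<lambda>t. a t r) has_real_derivative \<alpha> t r + F t r) (at t within {0..T})" if "t \<in> {0..T}" for t r
    using sol_has_time_derivative[OF \<alpha> that, of r] fp[OF that] by (simp add: a_def F_def)
  have ac: "continuous_on ({0..T} \<times> UNIV) (\<lambda>(t, r). a t r)"
    using sol_continuous[OF \<alpha>] by (simp add: a_def)
  have \<alpha>c: "continuous_on ({0..T} \<times> UNIV) (\<lambda>(t, r). \<alpha> t r)" using \<alpha> by (simp add: decaying_def)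
  have Fc: "continuous_on ({0..T} \<times> UNIV) (\<lambda>(t, r). F t r)"
    using forcing_continuous(1)[OF \<alpha>] by (simp add: F_def)
  note asl = continuous_on_slice[OF ac] and \<alpha>sl = continuous_on_slice[OF \<alpha>c] and Fsl = continuous_on_slice[OF Fc]
  have F_odd: "F t (- r) = - F t r" for t r by (simp add: F_def forcing_def)
  have a_init: "a 0 = a\<^sub>0" by (simp add: a_def sol_def duhamel_def fun_eq_iff)
  have \<alpha>_init: "\<alpha> 0 = \<alpha>\<^sub>0" using fp[of 0] T by (simp add: sol_r_def duhamel_def fun_eq_iff)

  have u_t: "((\<lambda>t. u t r) has_real_derivative mean (\<alpha> t) r) (at t within {0..T})" if t: "t \<in> {0..T}" for t r
  proof -
    have "((\<lambda>t. mean (a t) r) has_real_derivative mean (\<lambda>y. \<alpha> t y + F t y) r) (at t within {0..T})"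
    proof (rule mean_has_time_derivative[where ft="\<lambda>t y. \<alpha> t y + F t y"])
      show "continuous_on ({0..T} \<times> UNIV) (\<lambda>(t, r). \<alpha> t r + F t r)"
        using continuous_on_add[OF \<alpha>c Fc] by (simp add: case_prod_unfold)
    qed (use a_t asl t in auto)
    also have "mean (\<lambda>y. \<alpha> t y + F t y) r = mean (\<alpha> t) r"
      using mean_odd_eq_0[of "F t" r] F_odd by (simp add: mean_add[OF \<alpha>sl[OF t] Fsl[OF t]])
    finally show ?thesis by (simp add: u_def)
  qed
  have u_r: "(u t has_real_derivative moment (\<alpha> t) r) (at r within S)" if t: "t \<in> {0..T}" for t r S
    using has_field_derivative_at_within[OF mean_has_derivative[OF a_r[OF t] \<alpha>sl[OF t]]]
    by (simp add: u_def[abs_def])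
  have C1: "Ck2_on 1 T u"
    unfolding One_nat_def
    by (rule Ck2_on_SucI[OF T _ u_t u_r Ck2_on_0I Ck2_on_0I])
       (use continuous_on_mean[OF \<alpha>c] continuous_on_moment[OF \<alpha>c] continuous_on_mean[OF ac]
        in \<open>auto simp: u_def intro: continuous_on_subset\<close>)

  define vt where "vt t r = (a t r - a t (- r)) / 2" for t r
  define vr where "vr t r = (a t r + a t (- r)) / 2" for t r
  define z where "z t r = (\<alpha> t r + \<alpha> t (- r)) / 2" for t r
  define vrr where "vrr t r = (\<alpha> t r - \<alpha> t (- r)) / 2" for t r
  have v_t: "((\<lambda>t. v t r) has_real_derivative vt t r) (at t within {0..T})" if t: "t \<in> {0..T}" for t r
    using DERIV_cmult[OF u_t[OF t], of r r] radius_times_mean[OF a_r[OF t], of r] by (simp add: v_def vt_def)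
  have v_r: "(v t has_real_derivative vr t r) (at r within S)" if t: "t \<in> {0..T}" for t r S
    using has_field_derivative_at_within[OF radius_times_mean_has_derivative[OF asl[OF t]]]
    by (simp add: v_def[abs_def] u_def[abs_def] vr_def)
  have vt_t: "((\<lambda>t. vt t r) has_real_derivative vrr t r + F t r) (at t within {0..T})" if t: "t \<in> {0..T}" for t r
    using DERIV_cdivide[OF DERIV_diff[OF a_t[OF t, of r] a_t[OF t, of "- r"]], of 2]
    by (simp add: vt_def vrr_def F_odd field_simps)
  have vr_t: "((\<lambda>t. vr t r) has_real_derivative z t r) (at t within {0..T})" if t: "t \<in> {0..T}" for t r
    using DERIV_cdivide[OF DERIV_add[OF a_t[OF t, of r] a_t[OF t, of "- r"]], of 2]
    by (simp add: vr_def z_def F_odd field_simps)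
  have a_r': "((\<lambda>r. a t (- r)) has_real_derivative - \<alpha> t (- r)) (at r)" if t: "t \<in> {0..T}" for t r
    by (rule DERIV_chain2[OF a_r[OF t], THEN DERIV_cong]) (auto intro!: derivative_eq_intros)
  have vt_r: "(vt t has_real_derivative z t r) (at r within S)" if t: "t \<in> {0..T}" for t r S
    using has_field_derivative_at_within[OF DERIV_cdivide[OF DERIV_diff[OF a_r[OF t] a_r'[OF t]], of 2]]
    by (simp add: vt_def[abs_def] z_def)
  have vr_r: "(vr t has_real_derivative vrr t r) (at r within S)" if t: "t \<in> {0..T}" for t r S
    using has_field_derivative_at_within[OF DERIV_cdivide[OF DERIV_add[OF a_r[OF t] a_r'[OF t]], of 2]]
    by (simp add: vr_def[abs_def] vrr_def)
  have refl: "continuous_on ({0..T} \<times> UNIV) (\<lambda>(t, r). f t (- r))"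
    if "continuous_on ({0..T} \<times> UNIV) (\<lambda>(t, r). f t r)" for f :: "real \<Rightarrow> real \<Rightarrow> real"
    unfolding case_prod_unfold
    by (rule continuous_on_uncurried_compose[OF that]) (auto intro!: continuous_intros)
  note ac' = ac refl[OF ac] and \<alpha>c' = \<alpha>c refl[OF \<alpha>c]
  have vtc: "continuous_on ({0..T} \<times> UNIV) (\<lambda>(t, r). vt t r)"
    and vrc: "continuous_on ({0..T} \<times> UNIV) (\<lambda>(t, r). vr t r)"
    and zc: "continuous_on ({0..T} \<times> UNIV) (\<lambda>(t, r). z t r)"
    and vrrc: "continuous_on ({0..T} \<times> UNIV) (\<lambda>(t, r). vrr t r)"
    using ac' \<alpha>c' unfolding vt_def vr_def z_def vrr_def case_prod_unfold
    by (auto intro!: continuous_intros)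
  have vttc: "continuous_on ({0..T} \<times> UNIV) (\<lambda>(t, r). vrr t r + F t r)"
    using continuous_on_add[OF vrrc Fc] by (simp add: case_prod_unfold)
  have vc: "continuous_on ({0..T} \<times> UNIV) (\<lambda>(t, r). v t r)"
    using continuous_on_mean[OF ac] unfolding v_def u_def case_prod_unfold by (auto intro!: continuous_intros)
  have C2: "Ck2_on 2 T v"
    unfolding numeral_2_eq_2
  proof (rule Ck2_on_SucI[OF T _ v_t v_r])
    show "Ck2_on (Suc 0) T vt"
      by (rule Ck2_on_SucI[OF T continuous_on_subset[OF vtc] vt_t vt_r Ck2_on_0I[OF vttc] Ck2_on_0I[OF zc]]) auto
    show "Ck2_on (Suc 0) T vr"
      by (rule Ck2_on_SucI[OF T continuous_on_subset[OF vrc] vr_t vr_r Ck2_on_0I[OF zc] Ck2_on_0I[OF vrrc]]) auto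
  qed (auto intro: continuous_on_subset[OF vc])

  have pdt_u: "pd_t T u t r = mean (\<alpha> t) r" if "t \<in> {0..T}" for t r
    by (rule pd_t_eqI[OF T that u_t[OF that]]) simp
  have pdr_u: "pd_r u t r = moment (\<alpha> t) r" if "t \<in> {0..T}" "0 \<le> r" for t r
    by (rule pd_r_eqI[where u=u, OF that(2) u_r[OF that(1)]]) simp
  have pdt_v: "pd_t T v t r = vt t r" if "t \<in> {0..T}" for t r
    by (rule pd_t_eqI[OF T that v_t[OF that]]) simp
  have pdr_v: "pd_r v t r = vr t r" if "t \<in> {0..T}" "0 \<le> r" for t r
    by (rule pd_r_eqI[where u=v, OF that(2) v_r[OF that(1)]]) simp
  have pdtt_v: "pd_t T (pd_t T v) t r = vrr t r + F t r" if "t \<in> {0..T}" for t r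
    by (rule pd_t_eqI[OF T that vt_t[OF that]]) (rule pdt_v)
  have pdtr_v: "pd_t T (pd_r v) t r = z t r" if "t \<in> {0..T}" "0 \<le> r" for t r
    by (rule pd_t_eqI[OF T that(1) vr_t[OF that(1)]]) (rule pdr_v[OF _ that(2)])
  have pdrr_v: "pd_r (pd_r v) t r = vrr t r" if "t \<in> {0..T}" "0 \<le> r" for t r
    by (rule pd_r_eqI[where u=vr, OF that(2) vr_r[OF that(1)]]) (rule pdr_v[OF that(1)])

  have "classical_solution \<mu> u\<^sub>0 u\<^sub>1 T u"
    unfolding classical_solution_def v_def[abs_def, symmetric]
  proof (intro conjI ballI allI impI C1 C2)
    fix t r :: real assume "t \<in> {0<..T}" "0 \<le> r"
    then show "pd T 2 0 v t r - pd T 0 2 v t r = r * (\<bar>pd_t T u t r\<bar>\<^sup>2 * \<mu> \<bar>pd_t T u t r\<bar>)"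
      by (simp add: pd_def numeral_2_eq_2 pdtt_v pdrr_v pdt_u F_def forcing_def nonlin_def)
  next
    fix r :: real assume "0 \<le> r"
    then show "u 0 r = u\<^sub>0 r" "pd_t T u 0 r = u\<^sub>1 r"
      using u0 u1 T by (auto simp: u_def a_init \<alpha>_init pdt_u)
  qed
  moreover have "closure (support_on ({0..T} \<times> {0..}) (\<lambda>(t, r). u t r))
      \<subseteq> {(t, r). t \<in> {0..T} \<and> r \<ge> 0 \<and> r \<le> t + R}" (is "_ \<subseteq> ?K")
  proof (rule closure_minimal)
    have "?K = ({0..T} \<times> {0..}) \<inter> {x. snd x \<le> fst x + R}" by auto
    moreover have "closed ({0..T} \<times> {0::real..})" by (intro closed_Times) auto
    moreover have "closed {x :: real \<times> real. snd x \<le> fst x + R}"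
      by (intro closed_Collect_le continuous_intros)
    ultimately show "closed ?K" by (simp add: closed_Int)
    \<comment> \<open>Outside the cone \<open>u\<^sub>t\<close> vanishes on the whole segment from time zero, so \<open>u\<close> keeps its initial value.\<close>
    have "u t r = 0" if t: "t \<in> {0..T}" and r: "t + R < r" for t r
    proof -
      have "((\<lambda>s. u s r) has_real_derivative 0) (at s within {0..t})" if "s \<in> {0..t}" for s
      proof -
        have s: "s \<in> {0..T}" using that t by auto
        have "\<omega> s r = 0" using that r R t by (auto simp: \<omega>_def)
        then have "mean (\<alpha> s) r = 0" using mean_decaying_le[OF \<alpha> s, of r] by simp
        then show ?thesis using DERIV_subset[OF u_t[OF s, of r], of "{0..t}"] t by auto
      qed
      then obtain c where "\<forall>s\<in>{0..t}. u s r = c"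
        using has_field_derivative_zero_constant[of "{0..t}" "\<lambda>s. u s r"] by auto
      then have "u t r = u 0 r" using t by auto
      also have "\<dots> = 0" using u0 u0_support r R t by (simp add: u_def a_init)
      finally show ?thesis .
    qed
    then show "support_on ({0..T} \<times> {0..}) (\<lambda>(t, r). u t r) \<subseteq> ?K"
      by (force simp: support_on_def not_less)
  qed
  moreover have "(\<forall>a b. a + b \<le> 1 \<longrightarrow> \<bar>pd T a b u t r\<bar> \<le> 2 * Q * inverse (t - r + 2 * R)) \<and>
      (\<forall>a b. 1 \<le> a + b \<and> a + b \<le> 2 \<longrightarrow>
        \<bar>pd T a b v t r\<bar> \<le> 2 * Q * inverse (t - r + 2 * R))"
    if t: "t \<in> {0..T}" and r: "r \<in> {0..t + R}" for t r
  proof -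
    define W where "W = Q * \<omega> t r"
    have "\<omega> t r = inverse (t - r + 2 * R)" using r by (simp add: \<omega>_def inverse_eq_divide)
    then have W: "2 * Q * inverse (t - r + 2 * R) = 2 * W" "0 \<le> W"
      using Q \<omega>_nonneg[of t r] by (simp_all add: W_def)
    have ball_le: "\<bar>y\<bar> \<le> \<bar>r\<bar> \<Longrightarrow> Q * \<omega> t y \<le> W" for y
      unfolding W_def using r by (intro mult_left_mono \<omega>_mono Q) auto
    have ab: "\<bar>a t y\<bar> \<le> W" "\<bar>\<alpha> t y\<bar> \<le> W" if "\<bar>y\<bar> \<le> \<bar>r\<bar>" for y
      using sol_bounds(1)[OF \<alpha> t, of y] decaying_le(1)[OF \<alpha> t, of y] ball_le[OF that] by (auto simp: a_def)
    have r0: "0 \<le> r" using r by simp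
    have u_le: "\<bar>u t r\<bar> \<le> W" unfolding u_def by (intro abs_mean_le asl t ab)
    have ut_le: "\<bar>mean (\<alpha> t) r\<bar> \<le> W" by (intro abs_mean_le \<alpha>sl t ab)
    have ur_le: "\<bar>moment (\<alpha> t) r\<bar> \<le> W" by (intro abs_moment_le \<alpha>sl t ab)
    have v_le: "\<bar>vt t r\<bar> \<le> W" "\<bar>vr t r\<bar> \<le> W" "\<bar>z t r\<bar> \<le> W" "\<bar>vrr t r\<bar> \<le> W"
      unfolding vt_def vr_def z_def vrr_def by (intro abs_half_sum_le abs_half_diff_le ab; simp)+
    have vtt_le: "\<bar>vrr t r + F t r\<bar> \<le> 2 * W"
      using v_le(4) forcing_le_weight[OF \<alpha> t, of r] abs_triangle_ineq[of "vrr t r" "F t r"]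
      by (simp add: F_def W_def)
    have "\<bar>pd T a b u t r\<bar> \<le> 2 * W" if "a + b \<le> 1" for a b
    proof -
      from that consider "a = 0" "b = 0" | "a = 1" "b = 0" | "a = 0" "b = 1" by linarith
      then show ?thesis
        using u_le ut_le ur_le W(2) pdt_u[OF t, of r] pdr_u[OF t r0] by cases (simp_all add: pd_def)
    qed
    moreover have "\<bar>pd T a b v t r\<bar> \<le> 2 * W" if "1 \<le> a + b \<and> a + b \<le> 2" for a b
    proof -
      from that consider "a = 1" "b = 0" | "a = 0" "b = 1" | "a = 2" "b = 0" | "a = 1" "b = 1" | "a = 0" "b = 2"
        by linarith
      then show ?thesis
        using v_le vtt_le W(2) pdt_v[OF t, of r] pdr_v[OF t r0] pdtt_v[OF t, of r] pdtr_v[OF t r0] pdrr_v[OF t r0]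
        by cases (simp_all add: pd_def numeral_2_eq_2)
    qed
    ultimately show ?thesis unfolding W(1) by blast
  qed
  ultimately show ?thesis unfolding v_def[abs_def] by blast
qed

end

section \<open>Uniqueness in backward cones\<close>

lemma Ck2_on_SucD:
  assumes "Ck2_on (Suc k) T u"
  shows "\<And>t r. t \<in> {0..T} \<Longrightarrow> 0 \<le> r \<Longrightarrow> ((\<lambda>s. u s r) has_real_derivative pd_t T u t r) (at t within {0..T})"
    and "\<And>t r. t \<in> {0..T} \<Longrightarrow> 0 \<le> r \<Longrightarrow> (u t has_real_derivative pd_r u t r) (at r within {0..})"
    and "Ck2_on k T (pd_t T u)" "Ck2_on k T (pd_r u)"
  using assms by (auto simp: pd_t_def pd_r_def intro!: has_real_derivative_deriv_within)

lemma Ck2_on_continuous: "Ck2_on k T u \<Longrightarrow> continuous_on ({0..T} \<times> {0..}) (\<lambda>(t, r). u t r)"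
  by (cases k) auto

text \<open>
  Differentiate \<open>v(t, y) - v(t, 0) = \<integral>\<^sub>0\<^sup>y v\<^sub>r(t, \<rho>) d\<rho>\<close> in \<open>t\<close> under the integral, and then in \<open>y\<close>.
\<close>

lemma mixed_derivatives_commute:
  assumes T: "0 < T" and v: "Ck2_on 2 T v" and t: "t \<in> {0..T}" and r: "0 \<le> r"
  shows "pd_r (pd_t T v) t r = pd_t T (pd_r v) t r"
proof -
  have v2: "Ck2_on (Suc (Suc 0)) T v" using v by (simp add: numeral_2_eq_2)
  note D = Ck2_on_SucD[OF v2]
  note Dt = Ck2_on_SucD[OF D(3)] and Dr = Ck2_on_SucD[OF D(4)]
  let ?vr = "pd_r v" and ?vrt = "pd_t T (pd_r v)"
  have vr_c: "continuous_on ({0..T} \<times> {0..}) (\<lambda>(t, r). ?vr t r)"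
    and vrt_c: "continuous_on ({0..T} \<times> {0..}) (\<lambda>(t, r). ?vrt t r)"
    using Ck2_on_continuous D(4) Dr(3) by auto
  have line: "continuous_on {0..y} (f s)"
    if "continuous_on ({0..T} \<times> {0..}) (\<lambda>(t, r). f t r)" "s \<in> {0..T}" for f :: "real \<Rightarrow> real \<Rightarrow> real" and s y
    using continuous_on_uncurried_compose[OF that(1), of "{0..y}" "\<lambda>_. s" "\<lambda>y. y"] that(2)
    by (simp add: continuous_intros)
  have int_v: "integral {0..y} (?vr s) = v s y - v s 0" if s: "s \<in> {0..T}" and y: "0 \<le> y" for s y
    by (rule integral_unique, rule has_integral_of_derivative[OF y])
       (use s in \<open>auto intro!: DERIV_subset[OF D(2)]\<close>)
  have diff: "pd_t T v t y = pd_t T v t 0 + integral {0..y} (?vrt t)" if y: "0 \<le> y" for y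
  proof -
    have "((\<lambda>s. integral (cbox 0 y) (?vr s)) has_real_derivative integral (cbox 0 y) (?vrt t)) (at t within {0..T})"
    proof (rule leibniz_rule_field_derivative)
      show "?vr s integrable_on cbox 0 y" if "s \<in> {0..T}" for s
        unfolding cbox_interval by (intro integrable_continuous_real line[OF vr_c that])
      show "continuous_on ({0..T} \<times> cbox 0 y) (\<lambda>(s, y). ?vrt s y)"
        by (rule continuous_on_subset[OF vrt_c]) auto
    qed (use t in \<open>auto intro: Dr(1)\<close>)
    then have "((\<lambda>s. v s 0 + integral {0..y} (?vr s)) has_real_derivative
        pd_t T v t 0 + integral {0..y} (?vrt t)) (at t within {0..T})"
      unfolding cbox_interval by (intro DERIV_add D(1) t) auto
    then show ?thesis by (rule pd_t_eqI[OF T t]) (use int_v y in auto)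
  qed
  have "((\<lambda>y. pd_t T v t 0 + integral {0..y} (?vrt t)) has_real_derivative 0 + ?vrt t r) (at r within {0..r + 1})"
    using r by (intro DERIV_add DERIV_const integral_has_real_derivative line[OF vrt_c t]) auto
  then have *: "((\<lambda>y. pd_t T v t 0 + integral {0..y} (?vrt t)) has_vector_derivative ?vrt t r) (at r within {0..r + 1})"
    by (simp add: has_real_derivative_iff_has_vector_derivative)
  have "((\<lambda>y. pd_t T v t y) has_vector_derivative ?vrt t r) (at r within {0..r + 1})"
    by (rule has_vector_derivative_transform[OF _ _ *]) (use r in \<open>auto intro: diff\<close>)
  moreover have "((\<lambda>y. pd_t T v t y) has_vector_derivative pd_r (pd_t T v) t r) (at r within {0..r + 1})"
    using DERIV_subset[OF Dt(2)[OF t r], of "{0..r + 1}"]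
    by (auto simp: has_real_derivative_iff_has_vector_derivative)
  ultimately show ?thesis
    using vector_derivative_unique_within[of r "{0..r + 1}"] r at_within_Icc_neq_bot[of "r + 1" r] by auto
qed

text \<open>
  The mixed derivatives cancel, and what remains is the wave operator applied to \<open>v\<close>.
\<close>

lemma derivative_along_characteristics:
  assumes T: "0 < T" and v: "Ck2_on 2 T v" and s: "0 < s" "s < T"
  shows "s < p \<Longrightarrow> ((\<lambda>s. pd_t T v s (p - s) + pd_r v s (p - s)) has_real_derivative
      pd T 2 0 v s (p - s) - pd T 0 2 v s (p - s)) (at s)"
    and "0 < q + s \<Longrightarrow> ((\<lambda>s. pd_t T v s (q + s) - pd_r v s (q + s)) has_real_derivative
      pd T 2 0 v s (q + s) - pd T 0 2 v s (q + s)) (at s)"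
proof -
  have v2: "Ck2_on (Suc (Suc 0)) T v" using v by (simp add: numeral_2_eq_2)
  note D = Ck2_on_SucD[OF v2]
  note Dt = Ck2_on_SucD[OF D(3)] and Dr = Ck2_on_SucD[OF D(4)]
  note c = Ck2_on_continuous[OF Dt(4)] Ck2_on_continuous[OF Dr(4)]
  have sT: "s \<in> {0..T}" using s by simp
  have along: "((\<lambda>s. f s (g s)) has_real_derivative pd_t T f s (g s) + pd_r f s (g s) * g') (at s)"
    if f: "f = pd_t T v \<or> f = pd_r v" and g: "(g has_real_derivative g') (at s)" "0 < g s"
      "\<And>x. x \<in> S \<Longrightarrow> 0 \<le> g x" and S: "open S" "s \<in> S" "S \<subseteq> {0..T}" for f g g' S
  proof -
    have "((\<lambda>s. f s (g s)) has_real_derivative pd_t T f s (g s) + pd_r f s (g s) * g') (at s within S)"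
    proof (rule has_real_derivative_along_curve[where X="{0..T}" and Y="{0..}"
          and f=f and c=g and ft="pd_t T f" and fy="pd_r f"])
      show "((\<lambda>s'. f s' (g s)) has_real_derivative pd_t T f s (g s)) (at s within {0..T})"
        using f Dt(1)[OF sT] Dr(1)[OF sT] g(2) by auto
      show "(f s' has_real_derivative pd_r f s' y) (at y within {0..})" if "s' \<in> {0..T}" "y \<in> {0..}" for s' y
        using f Dt(2)[OF that(1)] Dr(2)[OF that(1)] that(2) by auto
      show "continuous_on ({0..T} \<times> {0..}) (\<lambda>(s, y). pd_r f s y)" using f c by auto
    qed (use g S in \<open>auto intro: has_field_derivative_at_within\<close>)
    then show ?thesis using at_within_open[OF S(2,1)] by simp
  qed
  have comm: "pd_r (pd_t T v) s y = pd_t T (pd_r v) s y" if "0 \<le> y" for y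
    by (rule mixed_derivatives_commute[OF T v sT that])
  show "((\<lambda>s. pd_t T v s (p - s) + pd_r v s (p - s)) has_real_derivative
      pd T 2 0 v s (p - s) - pd T 0 2 v s (p - s)) (at s)" if "s < p"
  proof -
    have 1: "((\<lambda>s. p - s) has_real_derivative -1) (at s)" by (auto intro!: derivative_eq_intros)
    have S: "open {0<..<min T p}" "s \<in> {0<..<min T p}" "{0<..<min T p} \<subseteq> {0..T}" using s that by auto
    have "((\<lambda>s. f s (p - s)) has_real_derivative pd_t T f s (p - s) + pd_r f s (p - s) * -1) (at s)"
      if "f = pd_t T v \<or> f = pd_r v" for f
      by (rule along[OF that 1 _ _ S]) (use \<open>s < p\<close> in auto)
    from DERIV_add[OF this[of "pd_t T v"] this[of "pd_r v"]] show ?thesis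
      using that by (simp add: pd_def numeral_2_eq_2 comm)
  qed
  show "((\<lambda>s. pd_t T v s (q + s) - pd_r v s (q + s)) has_real_derivative
      pd T 2 0 v s (q + s) - pd T 0 2 v s (q + s)) (at s)" if "0 < q + s"
  proof -
    have 1: "((\<lambda>s. q + s) has_real_derivative 1) (at s)" by (auto intro!: derivative_eq_intros)
    have S: "open {max 0 (- q)<..<T}" "s \<in> {max 0 (- q)<..<T}" "{max 0 (- q)<..<T} \<subseteq> {0..T}" using s that by auto
    have "((\<lambda>s. f s (q + s)) has_real_derivative pd_t T f s (q + s) + pd_r f s (q + s) * 1) (at s)"
      if "f = pd_t T v \<or> f = pd_r v" for f
      by (rule along[OF that 1 _ _ S]) (use \<open>0 < q + s\<close> in auto)
    from DERIV_diff[OF this[of "pd_t T v"] this[of "pd_r v"]] show ?thesis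
      using that by (simp add: pd_def numeral_2_eq_2 comm)
  qed
qed

definition backward_cone :: "real \<Rightarrow> real \<Rightarrow> (real \<times> real) set" where
  "backward_cone T \<rho> = {(t, r). 0 \<le> t \<and> t \<le> T \<and> 0 \<le> r \<and> t + r \<le> \<rho>}"

lemma compact_backward_cone: "compact (backward_cone T \<rho>)"
proof -
  have "backward_cone T \<rho> = ({0..T} \<times> {0..\<rho>}) \<inter> {x. fst x + snd x \<le> \<rho>}" by (auto simp: backward_cone_def)
  moreover have "closed {x :: real \<times> real. fst x + snd x \<le> \<rho>}"
    by (intro closed_Collect_le continuous_intros)
  ultimately show ?thesis by (auto intro!: compact_Int_closed compact_Times)
qed

text \<open>
  Here \<open>a\<close> and \<open>b\<close> stand for the differences of \<open>v\<^sub>t + v\<^sub>r\<close> and \<open>v\<^sub>t - v\<^sub>r\<close> for two solutions. Let \<open>N\<close> be the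
  maximum over the compact cone of \<open>max \<bar>a\<bar> \<bar>b\<bar>\<close> times \<open>exp (- 2 L t)\<close>. Integration along incoming characteristics
  from time zero, and along outgoing ones from time zero or from the axis, where \<open>b = - a\<close>, gives
  \<open>max \<bar>a\<bar> \<bar>b\<bar> \<le> N / 2 (exp (2 L t) - 1)\<close>. At the maximum point this forces \<open>N = 0\<close>.
\<close>

lemma characteristic_gronwall:
  fixes a b e :: "real \<Rightarrow> real \<Rightarrow> real"
  assumes c: "continuous_on (backward_cone T \<rho>) (\<lambda>(t, r). a t r)" "continuous_on (backward_cone T \<rho>) (\<lambda>(t, r). b t r)"
    and init: "\<And>r. (0, r) \<in> backward_cone T \<rho> \<Longrightarrow> a 0 r = 0 \<and> b 0 r = 0"
    and axis: "\<And>t. (t, 0) \<in> backward_cone T \<rho> \<Longrightarrow> a t 0 + b t 0 = 0"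
    and a: "\<And>s p. 0 < s \<Longrightarrow> s < T \<Longrightarrow> s < p \<Longrightarrow> p \<le> \<rho> \<Longrightarrow>
      ((\<lambda>s. a s (p - s)) has_real_derivative e s (p - s)) (at s)"
    and b: "\<And>s q. 0 < s \<Longrightarrow> s < T \<Longrightarrow> 0 < q + s \<Longrightarrow> q + 2 * s \<le> \<rho> \<Longrightarrow>
      ((\<lambda>s. b s (q + s)) has_real_derivative e s (q + s)) (at s)"
    and L: "0 < L" "\<And>s y. (s, y) \<in> backward_cone T \<rho> \<Longrightarrow> 0 < s \<Longrightarrow> \<bar>e s y\<bar> \<le> L * max \<bar>a s y\<bar> \<bar>b s y\<bar>"
    and x: "(t, r) \<in> backward_cone T \<rho>"
  shows "a t r = 0" "b t r = 0"
proof -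
  define m where "m x = max \<bar>a (fst x) (snd x)\<bar> \<bar>b (fst x) (snd x)\<bar> * exp (- (2 * L * fst x))" for x
  have "continuous_on (backward_cone T \<rho>) m"
    unfolding m_def using c by (intro continuous_intros) (auto simp: case_prod_unfold)
  then have "\<exists>x0\<in>backward_cone T \<rho>. \<forall>x\<in>backward_cone T \<rho>. m x \<le> m x0"
    using x by (intro continuous_attains_sup compact_backward_cone) auto
  then obtain x0 where x0: "x0 \<in> backward_cone T \<rho>" "\<And>x. x \<in> backward_cone T \<rho> \<Longrightarrow> m x \<le> m x0"
    by blast
  define N where "N = m x0"
  have N: "max \<bar>a s y\<bar> \<bar>b s y\<bar> \<le> N * exp (2 * L * s)" if "(s, y) \<in> backward_cone T \<rho>" for s y
  proof -
    have "max \<bar>a s y\<bar> \<bar>b s y\<bar> = m (s, y) * exp (2 * L * s)" by (simp add: m_def exp_minus)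
    also have "\<dots> \<le> N * exp (2 * L * s)" unfolding N_def by (intro mult_right_mono x0(2) that) simp
    finally show ?thesis .
  qed
  have N0: "0 \<le> N" by (simp add: N_def m_def)
  have e_le: "\<bar>e s y\<bar> \<le> N / 2 * (exp (2 * L * s) * (2 * L))" if "(s, y) \<in> backward_cone T \<rho>" "0 < s" for s y
    using order_trans[OF L(2)[OF that] mult_left_mono[OF N[OF that(1)]]] L(1) by (simp add: mult_ac)
  have path: "\<bar>f s1 - f s0\<bar> \<le> N / 2 * exp (2 * L * s1) - N / 2 * exp (2 * L * s0)"
    if "s0 \<le> s1" "continuous_on {s0..s1} f"
      "\<And>s. s0 < s \<Longrightarrow> s < s1 \<Longrightarrow> (f has_real_derivative e s (g s)) (at s)"
      "\<And>s. s0 < s \<Longrightarrow> s < s1 \<Longrightarrow> (s, g s) \<in> backward_cone T \<rho> \<and> 0 < s" for f g :: "real \<Rightarrow> real" and s0 s1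
  proof (cases "s0 = s1")
    case False
    then have "s0 < s1" using that by simp
    have "norm (f s1 - f s0) \<le> N / 2 * exp (2 * L * s1) - N / 2 * exp (2 * L * s0)"
    proof (rule differentiable_bound_general[OF \<open>s0 < s1\<close> that(2)])
      fix s assume s: "s0 < s" "s < s1"
      show "(f has_vector_derivative e s (g s)) (at s)"
        using that(3)[OF s] by (simp add: has_real_derivative_iff_has_vector_derivative)
      have "((\<lambda>s. N / 2 * exp (2 * L * s)) has_real_derivative N / 2 * (exp (2 * L * s) * (2 * L))) (at s)"
        by (auto intro!: derivative_eq_intros)
      then show "((\<lambda>s. N / 2 * exp (2 * L * s)) has_vector_derivative N / 2 * (exp (2 * L * s) * (2 * L))) (at s)"
        by (simp add: has_real_derivative_iff_has_vector_derivative)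
      show "norm (e s (g s)) \<le> N / 2 * (exp (2 * L * s) * (2 * L))"
        using that(4)[OF s] e_le[of s "g s"] by simp
    qed (intro continuous_intros)
    then show ?thesis by simp
  qed simp
  have a_le: "\<bar>a t r\<bar> \<le> N / 2 * exp (2 * L * t) - N / 2" if tr: "(t, r) \<in> backward_cone T \<rho>" for t r
  proof -
    have "\<bar>a t (t + r - t) - a 0 (t + r - 0)\<bar> \<le> N / 2 * exp (2 * L * t) - N / 2 * exp (2 * L * 0)"
    proof (rule path[where f="\<lambda>s. a s (t + r - s)" and g="\<lambda>s. t + r - s"])
      show "continuous_on {0..t} (\<lambda>s. a s (t + r - s))"
        using continuous_on_compose2[OF c(1), of "{0..t}" "\<lambda>s. (s, t + r - s)"] tr
        by (force simp: backward_cone_def intro!: continuous_intros)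
    qed (use tr in \<open>auto simp: backward_cone_def intro!: a\<close>)
    then show ?thesis using init[of "t + r"] tr by (auto simp: backward_cone_def)
  qed
  have b_le: "\<bar>b t r\<bar> \<le> N / 2 * exp (2 * L * t) - N / 2" if tr: "(t, r) \<in> backward_cone T \<rho>" for t r
  proof -
    define s0 where "s0 = max 0 (t - r)"
    have s0: "0 \<le> s0" "s0 \<le> t" "t - r \<le> s0" using tr by (auto simp: s0_def backward_cone_def)
    have cn: "(s, r - t + s) \<in> backward_cone T \<rho>" if "s0 \<le> s" "s \<le> t" for s
      using tr that s0 by (auto simp: backward_cone_def)
    have "\<bar>b t (r - t + t) - b s0 (r - t + s0)\<bar> \<le> N / 2 * exp (2 * L * t) - N / 2 * exp (2 * L * s0)"
    proof (rule path[where f="\<lambda>s. b s (r - t + s)" and g="\<lambda>s. r - t + s"])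
      show "continuous_on {s0..t} (\<lambda>s. b s (r - t + s))"
        using continuous_on_compose2[OF c(2), of "{s0..t}" "\<lambda>s. (s, r - t + s)"] cn
        by (force intro!: continuous_intros)
      show "((\<lambda>s. b s (r - t + s)) has_real_derivative e s (r - t + s)) (at s)" if "s0 < s" "s < t" for s
        using that s0 tr by (intro b) (auto simp: backward_cone_def)
    qed (use s0 cn in auto)
    moreover have "\<bar>b s0 (r - t + s0)\<bar> \<le> N / 2 * exp (2 * L * s0) - N / 2"
    proof (cases "t \<le> r")
      case True
      then have "s0 = 0" by (simp add: s0_def)
      then show ?thesis using init[of "r - t"] cn[of 0] s0 by simp
    next
      case False
      then have "r - t + s0 = 0" by (simp add: s0_def)
      moreover have "(s0, 0) \<in> backward_cone T \<rho>" using cn[of s0] s0 \<open>r - t + s0 = 0\<close> by simp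
      ultimately show ?thesis using axis[of s0] a_le[of s0 0] by simp
    qed
    ultimately show ?thesis by simp
  qed
  obtain t0 r0 where x0_eq: "x0 = (t0, r0)" by (cases x0)
  have "N * exp (2 * L * t0) \<le> N / 2 * exp (2 * L * t0) - N / 2"
  proof -
    have "N * exp (2 * L * t0) = max \<bar>a t0 r0\<bar> \<bar>b t0 r0\<bar>"
      by (simp add: N_def m_def x0_eq exp_minus)
    then show ?thesis using a_le[of t0 r0] b_le[of t0 r0] x0(1) by (simp add: x0_eq)
  qed
  moreover have "0 \<le> N * exp (2 * L * t0)" using N0 by simp
  ultimately have "N = 0" using N0 by linarith
  then have "max \<bar>a t r\<bar> \<bar>b t r\<bar> \<le> 0" using N[OF x] by simp
  then show "a t r = 0" "b t r = 0" by auto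
qed

text \<open>
  In a backward cone both solutions have bounded \<open>u\<^sub>t\<close>, so the nonlinearity is Lipschitz there and
  \<open>r \<bar>G(w\<^sub>1) - G(w\<^sub>2)\<bar> \<le> L \<bar>r w\<^sub>1 - r w\<^sub>2\<bar>\<close>, where \<open>r w\<^sub>i\<close> is the time derivative of \<open>r u\<^sub>i\<close>. Equality of the
  derivatives of \<open>r u\<close> gives equality of \<open>u\<close>: on the axis because \<open>(r u)\<^sub>r = u\<close> at \<open>r = 0\<close>, elsewhere by
  integration in time.
\<close>

theorem classical_solution_unique:
  assumes \<mu>: "modulus_of_continuity \<mu>" and sl: "symbol_like \<mu>" and T: "0 < T"
    and u: "classical_solution \<mu> u\<^sub>0 u\<^sub>1 T u" and w: "classical_solution \<mu> u\<^sub>0 u\<^sub>1 T w"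
    and t: "t \<in> {0..T}" and r: "0 \<le> r"
  shows "w t r = u t r"
proof -
  define V where "V f t r = r * f t r" for f :: "real \<Rightarrow> real \<Rightarrow> real" and t r
  define S where "S = {u, w}"
  have S: "Ck2_on 1 T f" "Ck2_on 2 T (V f)"
      "\<And>t r. t \<in> {0<..T} \<Longrightarrow> 0 \<le> r \<Longrightarrow> pd T 2 0 (V f) t r - pd T 0 2 (V f) t r = r * nonlin \<mu> (pd_t T f t r)"
      "\<And>r. 0 \<le> r \<Longrightarrow> f 0 r = u\<^sub>0 r \<and> pd_t T f 0 r = u\<^sub>1 r" if "f \<in> S" for f
  proof -
    have "classical_solution \<mu> u\<^sub>0 u\<^sub>1 T f" using that u w by (auto simp: S_def)
    then have C: "Ck2_on 1 T f" "Ck2_on 2 T (V f)"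
      "\<forall>t\<in>{0<..T}. \<forall>r\<ge>0. pd T 2 0 (V f) t r - pd T 0 2 (V f) t r = r * (\<bar>pd_t T f t r\<bar>\<^sup>2 * \<mu> \<bar>pd_t T f t r\<bar>)"
      "\<forall>r\<ge>0. f 0 r = u\<^sub>0 r \<and> pd_t T f 0 r = u\<^sub>1 r"
      unfolding classical_solution_def V_def[abs_def] by blast+
    show "Ck2_on 1 T f" "Ck2_on 2 T (V f)" by (fact C)+
    show "pd T 2 0 (V f) t r - pd T 0 2 (V f) t r = r * nonlin \<mu> (pd_t T f t r)" if "t \<in> {0<..T}" "0 \<le> r" for t r
      using bspec[OF C(3) that(1)] that(2) by (simp add: nonlin_def)
    show "f 0 r = u\<^sub>0 r \<and> pd_t T f 0 r = u\<^sub>1 r" if "0 \<le> r" for r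
      using C(4) that by blast
  qed
  have S1: "Ck2_on (Suc 0) T f" and S2: "Ck2_on (Suc 1) T (V f)" if "f \<in> S" for f
    using S(1)[OF that] S(2)[OF that] by (simp_all only: One_nat_def numeral_2_eq_2)
  have D: "((\<lambda>s. f s r) has_real_derivative pd_t T f t r) (at t within {0..T})"
       "(f t has_real_derivative pd_r f t r) (at r within {0..})"
       if "f \<in> S" "t \<in> {0..T}" "0 \<le> r" for f t r
    using Ck2_on_SucD(1)[OF S1[OF that(1)] that(2,3)] Ck2_on_SucD(2)[OF S1[OF that(1)] that(2,3)] .
  have pdt_V: "pd_t T (V f) t r = r * pd_t T f t r" if "f \<in> S" "t \<in> {0..T}" "0 \<le> r" for f t r
  proof (rule pd_t_eqI[OF T that(2)])
    show "((\<lambda>s. r * f s r) has_real_derivative r * pd_t T f t r) (at t within {0..T})"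
      by (rule DERIV_cmult[OF D(1)[OF that]])
  qed (simp add: V_def)
  have pdr_V: "pd_r (V f) t r = f t r + r * pd_r f t r" if "f \<in> S" "t \<in> {0..T}" "0 \<le> r" for f t r
  proof (rule pd_r_eqI[where u="V f", OF that(3)])
    have "((\<lambda>r. r * f t r) has_real_derivative r * pd_r f t r + 1 * f t r) (at r within {0..})"
      by (rule DERIV_mult'[OF DERIV_ident D(2)[OF that]])
    then show "(V f t has_real_derivative f t r + r * pd_r f t r) (at r within {0..})"
      by (simp add: V_def[abs_def] add.commute)
  qed simp
  have ct: "continuous_on ({0..T} \<times> {0..}) (\<lambda>(t, r). pd_t T f t r)" if "f \<in> S" for f
    by (rule Ck2_on_continuous[OF Ck2_on_SucD(3)[OF S1[OF that]]])
  have cV: "continuous_on ({0..T} \<times> {0..}) (\<lambda>(t, r). pd_t T (V f) t r)"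
     "continuous_on ({0..T} \<times> {0..}) (\<lambda>(t, r). pd_r (V f) t r)" if "f \<in> S" for f
    by (rule Ck2_on_continuous[OF Ck2_on_SucD(3)[OF S2[OF that]]])
       (rule Ck2_on_continuous[OF Ck2_on_SucD(4)[OF S2[OF that]]])
  define A where "A f t r = pd_t T (V f) t r + pd_r (V f) t r" for f t r
  define B where "B f t r = pd_t T (V f) t r - pd_r (V f) t r" for f t r
  define E where "E f t r = pd T 2 0 (V f) t r - pd T 0 2 (V f) t r" for f t r

  have zero: "A w t r - A u t r = 0 \<and> B w t r - B u t r = 0" if t: "t \<in> {0..T}" and r: "0 \<le> r" for t r
  proof -
    define \<rho> where "\<rho> = t + r"
    have sub: "backward_cone T \<rho> \<subseteq> {0..T} \<times> {0..}" by (auto simp: backward_cone_def)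
    have uS: "u \<in> S" and wS: "w \<in> S" by (auto simp: S_def)
    have "bounded ((\<lambda>(t, r). pd_t T f t r) ` backward_cone T \<rho>)" if "f \<in> S" for f
      by (rule compact_imp_bounded[OF compact_continuous_image[OF continuous_on_subset[OF ct[OF that] sub] compact_backward_cone]])
    then have bnd: "\<exists>M. \<forall>x\<in>backward_cone T \<rho>. \<bar>pd_t T f (fst x) (snd x)\<bar> \<le> M" if "f \<in> S" for f
      using that unfolding bounded_iff by (simp add: case_prod_unfold)
    obtain Mu where Mu: "\<And>x. x \<in> backward_cone T \<rho> \<Longrightarrow> \<bar>pd_t T u (fst x) (snd x)\<bar> \<le> Mu" using bnd[OF uS] by blast
    obtain Mw where Mw: "\<And>x. x \<in> backward_cone T \<rho> \<Longrightarrow> \<bar>pd_t T w (fst x) (snd x)\<bar> \<le> Mw" using bnd[OF wS] by blast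
    define N where "N = max Mu Mw"
    have N: "\<bar>pd_t T f s y\<bar> \<le> N" if "f \<in> S" "(s, y) \<in> backward_cone T \<rho>" for f s y
      using Mu[OF that(2)] Mw[OF that(2)] that(1) by (auto simp: N_def S_def)
    have xin: "(t, r) \<in> backward_cone T \<rho>" using t r by (simp add: backward_cone_def \<rho>_def)
    have N0: "0 \<le> N" using N[OF uS xin] by simp
    define L where "L = 3 * N * \<mu> N + 1"
    have L: "0 < L" using modulusD(3)[OF \<mu> N0] N0 by (simp add: L_def add_nonneg_pos)
    have lip: "\<bar>nonlin \<mu> x - nonlin \<mu> y\<bar> \<le> L * \<bar>x - y\<bar>" if "\<bar>x\<bar> \<le> N" "\<bar>y\<bar> \<le> N" for x y
    proof -
      have d: "norm (nonlin' \<mu> z) \<le> L" if z: "z \<in> {-N..N}" for z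
      proof -
        have zN: "\<bar>z\<bar> \<le> N" using z by (simp add: abs_le_iff)
        have "3 * \<bar>z\<bar> * \<mu> \<bar>z\<bar> \<le> 3 * N * \<mu> N"
          by (intro mult_mono modulus_mono[OF \<mu>] modulusD(3)[OF \<mu>]) (use zN N0 in simp_all)
        then show ?thesis using abs_nonlin'_le[OF \<mu> sl, of z] by (simp add: L_def)
      qed
      have "norm (nonlin \<mu> x - nonlin \<mu> y) \<le> L * norm (x - y)"
        by (rule field_differentiable_bound[of "{-N..N}" "nonlin \<mu>" "nonlin' \<mu>",
              OF _ has_field_derivative_at_within[OF nonlin_has_derivative[OF \<mu> sl]] d])
           (use that in \<open>simp_all add: abs_le_iff\<close>)
      then show ?thesis by simp
    qed
    have axis_eq: "A f s 0 + B f s 0 = 0" if "f \<in> S" "s \<in> {0..T}" for f s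
      using pdt_V[OF that, of 0] by (simp add: A_def B_def)
    have pdr_init: "pd_r f 0 y = pd_r u 0 y" if "f \<in> S" "0 \<le> y" for f y
      unfolding pd_r_def using S(4)[OF that(1)] S(4)[OF uS] that by (intro deriv_within_cong) auto
    have init: "A f 0 y = y * u\<^sub>1 y + (u\<^sub>0 y + y * pd_r u 0 y)" "B f 0 y = y * u\<^sub>1 y - (u\<^sub>0 y + y * pd_r u 0 y)"
      if "f \<in> S" "0 \<le> y" for f y
    proof -
      have z: "0 \<in> {0..T}" using T by simp
      have "pd_t T (V f) 0 y = y * u\<^sub>1 y" "pd_r (V f) 0 y = u\<^sub>0 y + y * pd_r u 0 y"
        using pdt_V[OF that(1) z that(2)] pdr_V[OF that(1) z that(2)] S(4)[OF that] pdr_init[OF that]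
        by simp_all
      then show "A f 0 y = y * u\<^sub>1 y + (u\<^sub>0 y + y * pd_r u 0 y)" "B f 0 y = y * u\<^sub>1 y - (u\<^sub>0 y + y * pd_r u 0 y)"
        by (simp_all add: A_def B_def)
    qed
    have cAB: "continuous_on (backward_cone T \<rho>) (\<lambda>(t, r). A w t r - A u t r)"
       "continuous_on (backward_cone T \<rho>) (\<lambda>(t, r). B w t r - B u t r)"
      unfolding A_def B_def case_prod_unfold
      using cV[THEN continuous_on_subset, OF _ sub, unfolded case_prod_unfold] uS wS
      by (auto intro!: continuous_intros)
    have charA: "((\<lambda>s. A f s (p - s)) has_real_derivative E f s (p - s)) (at s)"
      if "f \<in> S" "0 < s" "s < T" "s < p" for f s p
      unfolding A_def E_def using derivative_along_characteristics(1)[OF T S(2)[OF that(1)] that(2-4)] .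
    have charB: "((\<lambda>s. B f s (q + s)) has_real_derivative E f s (q + s)) (at s)"
      if "f \<in> S" "0 < s" "s < T" "0 < q + s" for f s q
      unfolding B_def E_def using derivative_along_characteristics(2)[OF T S(2)[OF that(1)] that(2-4)] .
    have E_le: "\<bar>E w s y - E u s y\<bar> \<le> L * max \<bar>A w s y - A u s y\<bar> \<bar>B w s y - B u s y\<bar>"
      if sy: "(s, y) \<in> backward_cone T \<rho>" and s: "0 < s" for s y
    proof -
      have s': "s \<in> {0<..T}" "s \<in> {0..T}" and y: "0 \<le> y" using sy s by (auto simp: backward_cone_def)
      have "E w s y - E u s y = y * (nonlin \<mu> (pd_t T w s y) - nonlin \<mu> (pd_t T u s y))"
        by (simp add: E_def S(3)[OF _ s'(1) y] uS wS right_diff_distrib)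
      also have "\<bar>\<dots>\<bar> \<le> y * (L * \<bar>pd_t T w s y - pd_t T u s y\<bar>)"
        unfolding abs_mult using y by (intro mult_mono lip N uS wS sy) auto
      also have "\<dots> = L * \<bar>pd_t T (V w) s y - pd_t T (V u) s y\<bar>"
        using y by (simp add: pdt_V[OF _ s'(2) y] uS wS abs_mult flip: right_diff_distrib)
      also have "pd_t T (V w) s y - pd_t T (V u) s y = ((A w s y - A u s y) + (B w s y - B u s y)) / 2"
        by (simp add: A_def B_def field_simps)
      also have "L * \<bar>((A w s y - A u s y) + (B w s y - B u s y)) / 2\<bar>
          \<le> L * max \<bar>A w s y - A u s y\<bar> \<bar>B w s y - B u s y\<bar>"
        using L by (intro mult_left_mono abs_half_sum_le) auto
      finally show ?thesis .
    qed
    have ax: "A w s 0 - A u s 0 + (B w s 0 - B u s 0) = 0" if "(s, 0) \<in> backward_cone T \<rho>" for s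
      using axis_eq[OF uS, of s] axis_eq[OF wS, of s] that by (simp add: backward_cone_def)
    have ini: "A w 0 y - A u 0 y = 0 \<and> B w 0 y - B u 0 y = 0" if "(0, y) \<in> backward_cone T \<rho>" for y
      using init[OF wS, of y] init[OF uS, of y] that by (simp add: backward_cone_def)
    have dA: "((\<lambda>s. A w s (p - s) - A u s (p - s)) has_real_derivative E w s (p - s) - E u s (p - s)) (at s)"
      if "0 < s" "s < T" "s < p" "p \<le> \<rho>" for s p
      by (rule DERIV_diff[OF charA[OF wS that(1-3)] charA[OF uS that(1-3)]])
    have dB: "((\<lambda>s. B w s (q + s) - B u s (q + s)) has_real_derivative E w s (q + s) - E u s (q + s)) (at s)"
      if "0 < s" "s < T" "0 < q + s" "q + 2 * s \<le> \<rho>" for s q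
      by (rule DERIV_diff[OF charB[OF wS that(1-3)] charB[OF uS that(1-3)]])
    show ?thesis
      using characteristic_gronwall[where a="\<lambda>t r. A w t r - A u t r" and b="\<lambda>t r. B w t r - B u t r"
        and e="\<lambda>t r. E w t r - E u t r", OF cAB ini ax dA dB L E_le xin] by simp
  qed
  have eqs: "pd_t T (V w) t r = pd_t T (V u) t r" "pd_r (V w) t r = pd_r (V u) t r" if "t \<in> {0..T}" "0 \<le> r" for t r
    using zero[OF that] by (simp_all add: A_def B_def)
  show ?thesis
  proof (cases "r = 0")
    case True
    then show ?thesis using eqs(2)[OF t r] pdr_V[OF _ t r] by (simp add: S_def)
  next
    case False
    have "((\<lambda>s. w s r - u s r) has_real_derivative 0) (at s within {0..T})" if s: "s \<in> {0..T}" for s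
    proof -
      have "pd_t T w s r = pd_t T u s r"
        using eqs(1)[OF s r] pdt_V[OF _ s r] False by (simp add: S_def)
      then show ?thesis using DERIV_diff[OF D(1)[of w s r] D(1)[of u s r]] s r by (simp add: S_def)
    qed
    then obtain c where "\<forall>s\<in>{0..T}. w s r - u s r = c"
      using has_field_derivative_zero_constant[of "{0..T}" "\<lambda>s. w s r - u s r"] by auto
    then have "w t r - u t r = w 0 r - u 0 r" using t T by auto
    then show ?thesis using S(4)[of u r] S(4)[of w r] r by (simp add: S_def)
  qed
qed

section \<open>The admissible times\<close>

text \<open>
  The substitution \<open>\<sigma> = \<kappa> / (1 + y)\<close>, for which \<open>dy / (1 + y) = - d\<sigma> / \<sigma>\<close>, on each half of the interval.
\<close>

lemma integral_modulus_weight: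
  assumes \<mu>: "modulus_of_continuity \<mu>" and \<kappa>: "0 < \<kappa>" and S: "0 \<le> S"
  shows "integral {-S..S} (\<lambda>y. \<mu> (\<kappa> / (1 + \<bar>y\<bar>)) / (1 + \<bar>y\<bar>))
    = 2 * integral {\<kappa> / (1 + S)..\<kappa>} (\<lambda>\<sigma>. \<mu> \<sigma> / \<sigma>)"
proof -
  define h where "h y = \<mu> (\<kappa> / (1 + \<bar>y\<bar>)) / (1 + \<bar>y\<bar>)" for y
  define c where "c = \<kappa> / (1 + S)"
  have c: "0 < c" "c \<le> \<kappa>" using \<kappa> S by (auto simp: c_def field_simps)
  define P where "P \<sigma> = integral {c..\<sigma>} (\<lambda>\<sigma>. \<mu> \<sigma> / \<sigma>)" for \<sigma>
  have P: "(P has_real_derivative \<mu> \<sigma> / \<sigma>) (at \<sigma> within {c..\<kappa>})" if "\<sigma> \<in> {c..\<kappa>}" for \<sigma>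
    unfolding P_def by (rule integral_has_real_derivative[OF continuous_on_modulus_quotient[OF \<mu> c(1)] that])
  have range: "\<kappa> / (1 + y) \<in> {c..\<kappa>}" if "y \<in> {0..S}" for y
  proof -
    have "\<kappa> / (1 + S) \<le> \<kappa> / (1 + y)" "\<kappa> / (1 + y) \<le> \<kappa> / 1"
      using that \<kappa> S by (intro divide_left_mono; auto)+
    then show ?thesis by (simp add: c_def)
  qed
  have half: "(h has_integral (- P (\<kappa> / (1 + S))) - (- P (\<kappa> / (1 + 0)))) {0..S}"
  proof (rule has_integral_of_derivative[OF S])
    fix y assume y: "y \<in> {0..S}"
    have inner: "((\<lambda>y. \<kappa> / (1 + y)) has_real_derivative - \<kappa> / (1 + y)\<^sup>2) (at y within {0..S})"
      using y by (auto intro!: derivative_eq_intros simp: power2_eq_square)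
    have "((\<lambda>y. P (\<kappa> / (1 + y))) has_real_derivative
        (\<mu> (\<kappa> / (1 + y)) / (\<kappa> / (1 + y))) * (- \<kappa> / (1 + y)\<^sup>2)) (at y within {0..S})"
    proof (rule DERIV_image_chain[of P, unfolded o_def, OF _ inner])
      show "(P has_real_derivative \<mu> (\<kappa> / (1 + y)) / (\<kappa> / (1 + y)))
          (at (\<kappa> / (1 + y)) within (\<lambda>y. \<kappa> / (1 + y)) ` {0..S})"
        by (rule DERIV_subset[OF P[OF range[OF y]]]) (use range in auto)
    qed
    then have "((\<lambda>y. - P (\<kappa> / (1 + y))) has_real_derivative
        - ((\<mu> (\<kappa> / (1 + y)) / (\<kappa> / (1 + y))) * (- \<kappa> / (1 + y)\<^sup>2))) (at y within {0..S})"
      by (rule DERIV_minus)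
    moreover have "- ((\<mu> (\<kappa> / (1 + y)) / (\<kappa> / (1 + y))) * (- \<kappa> / (1 + y)\<^sup>2)) = h y"
      using y \<kappa> by (simp add: h_def power2_eq_square)
    ultimately show "((\<lambda>y. - P (\<kappa> / (1 + y))) has_real_derivative h y) (at y within {0..S})" by simp
  qed
  have "P c = 0" by (simp add: P_def)
  then have right: "(h has_integral P \<kappa>) {0..S}" using half by (simp add: c_def)
  have "((\<lambda>y. h (- y)) has_integral P \<kappa>) {- S..- 0}"
    using right by (subst has_integral_reflect_real) auto
  moreover have "(\<lambda>y. h (- y)) = h" by (simp add: h_def fun_eq_iff)
  ultimately have left: "(h has_integral P \<kappa>) {- S..0}" by simp
  have "(h has_integral P \<kappa> + P \<kappa>) {- S..S}"
    by (rule has_integral_combine[OF _ S left right]) (use S in simp)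
  then have "integral {-S..S} h = 2 * P \<kappa>" by (simp add: integral_unique)
  then show ?thesis by (simp add: h_def[abs_def] P_def c_def)
qed

text \<open>
  Let \<open>\<eta>\<close> be the value of the inverse of \<open>H\<close> in the bound for \<open>T\<close>, and \<open>\<kappa> = k2 \<epsilon>\<close>. By the previous lemma the
  integral equals \<open>2 (H(\<kappa> / (1 + 2 T + R)) - H(\<kappa>))\<close>, so it suffices that \<open>\<eta> (1 + 2 T + R) \<le> \<kappa>\<close>. The part
  \<open>2 T \<eta>\<close> is at most \<open>\<kappa> / 2\<close> by the bound for \<open>T\<close>, and the part \<open>(1 + R) \<eta>\<close> is at most \<open>\<kappa> / 2\<close> for small \<open>\<epsilon>\<close>.
\<close>

lemma weight_integral_le:
  assumes \<mu>: "modulus_of_continuity \<mu>" and nd: "\<not> dini \<mu>" and \<tau>\<^sub>0: "0 < \<tau>\<^sub>0"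
    and pos: "0 < \<epsilon>" "0 < k1" "0 < k2" "0 < R" and le: "k2 * \<epsilon> \<le> \<tau>\<^sub>0"
    and small: "2 * (1 + R) * \<mu> (k2 * \<epsilon>) \<le> k1 / \<epsilon>"
    and T: "0 < T" "T \<le> k2 / 4 * \<epsilon> * inverse (dini_H_inv \<mu> \<tau>\<^sub>0 (k1 * inverse \<epsilon> + dini_H \<mu> \<tau>\<^sub>0 (k2 * \<epsilon>)))"
  shows "integral {-(2*T+R)..2*T+R} (\<lambda>y. \<mu> (k2 * \<epsilon> / (1 + \<bar>y\<bar>)) / (1 + \<bar>y\<bar>)) \<le> 2 * k1 / \<epsilon>"
proof -
  define \<kappa> where "\<kappa> = k2 * \<epsilon>"
  define Y where "Y = k1 * inverse \<epsilon> + dini_H \<mu> \<tau>\<^sub>0 \<kappa>"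
  define \<eta> where "\<eta> = dini_H_inv \<mu> \<tau>\<^sub>0 Y"
  have \<kappa>: "0 < \<kappa>" "\<kappa> \<le> \<tau>\<^sub>0" using pos le by (auto simp: \<kappa>_def)
  have "dini_H \<mu> \<tau>\<^sub>0 \<tau>\<^sub>0 \<le> dini_H \<mu> \<tau>\<^sub>0 \<kappa>" by (rule dini_H_antimono[OF \<mu> \<kappa>]) simp
  then have "0 \<le> dini_H \<mu> \<tau>\<^sub>0 \<kappa>" by (simp add: dini_H_def)
  then have "0 \<le> Y" using pos by (simp add: Y_def)
  then have \<eta>: "0 < \<eta>" "\<eta> \<le> \<tau>\<^sub>0" "dini_H \<mu> \<tau>\<^sub>0 \<eta> = Y"
    using dini_H_inv[OF \<mu> nd \<tau>\<^sub>0] by (auto simp: \<eta>_def)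
  \<comment> \<open>A level that \<open>\<eta>\<close> cannot exceed: passing from \<open>\<kappa>\<close> to \<open>c\<close> increases \<open>H\<close> by at most \<open>k1 / \<epsilon>\<close>.\<close>
  define c where "c = \<kappa> / (2 * (1 + R))"
  have "1 * \<kappa> \<le> 2 * (1 + R) * \<kappa>" using pos \<kappa> by (intro mult_right_mono) auto
  then have c: "0 < c" "c \<le> \<kappa>" using \<kappa> pos by (auto simp: c_def divide_le_eq mult.commute)
  have "dini_H \<mu> \<tau>\<^sub>0 c - dini_H \<mu> \<tau>\<^sub>0 \<kappa> = integral {c..\<kappa>} (\<lambda>\<sigma>. \<mu> \<sigma> / \<sigma>)"
    by (rule dini_H_diff[OF \<mu> c \<kappa>(2)])
  also have "\<dots> \<le> integral {c..\<kappa>} (\<lambda>\<sigma>. \<mu> \<kappa> / c)"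
    using c \<kappa> modulusD(3)[OF \<mu>] modulus_mono[OF \<mu>]
    by (intro integral_le integrable_continuous_real continuous_on_modulus_quotient[OF \<mu>] frac_le) auto
  also have "\<dots> = (\<kappa> - c) * (\<mu> \<kappa> / c)" using c by simp
  also have "\<dots> \<le> \<kappa> * (\<mu> \<kappa> / c)"
    using c modulusD(3)[OF \<mu>, of \<kappa>] \<kappa> by (intro mult_right_mono) auto
  also have "\<dots> = 2 * (1 + R) * \<mu> \<kappa>" using \<kappa> pos by (simp add: c_def)
  also have "\<dots> \<le> k1 / \<epsilon>" using small by (simp add: \<kappa>_def)
  finally have "dini_H \<mu> \<tau>\<^sub>0 c \<le> dini_H \<mu> \<tau>\<^sub>0 \<eta>" by (simp add: \<eta> Y_def inverse_eq_divide)
  then have \<eta>c: "\<eta> \<le> c" using dini_H_strict_antimono[OF \<mu> nd c(1), of \<eta> \<tau>\<^sub>0] \<eta>(2) by force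
  have "T * \<eta> \<le> \<kappa> / 4"
  proof -
    have "T \<le> \<kappa> / 4 * inverse \<eta>" using T(2) by (simp add: \<kappa>_def Y_def \<eta>_def)
    then have "T * \<eta> \<le> \<kappa> / 4 * inverse \<eta> * \<eta>" using \<eta>(1) by (intro mult_right_mono) auto
    also have "\<kappa> / 4 * inverse \<eta> * \<eta> = \<kappa> / 4" using \<eta>(1) by simp
    finally show ?thesis .
  qed
  moreover have "(1 + R) * \<eta> \<le> (1 + R) * c" using \<eta>c pos by (intro mult_left_mono) auto
  moreover have "(1 + R) * c = \<kappa> / 2"
  proof -
    have "x * (\<kappa> / (2 * x)) = \<kappa> / 2" if "x \<noteq> 0" for x using that by simp
    from this[of "1 + R"] show ?thesis using pos by (simp add: c_def)
  qed
  ultimately have "(1 + (2 * T + R)) * \<eta> \<le> \<kappa>" by (simp add: algebra_simps)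
  note le_\<kappa> = this
  define d where "d = \<kappa> / (1 + (2 * T + R))"
  have N: "1 \<le> 1 + (2 * T + R)" using T pos by simp
  have d: "\<eta> \<le> d" "0 < d" "d \<le> \<kappa>"
  proof -
    show "\<eta> \<le> d" unfolding d_def using le_\<kappa> N by (subst le_divide_eq) (simp add: mult.commute)
    show "0 < d" unfolding d_def using N \<kappa> by (intro divide_pos_pos) auto
    have "\<kappa> / (1 + (2 * T + R)) \<le> \<kappa> / 1" using N \<kappa> by (intro divide_left_mono) auto
    then show "d \<le> \<kappa>" by (simp add: d_def)
  qed
  have "integral {-(2*T+R)..2*T+R} (\<lambda>y. \<mu> (\<kappa> / (1 + \<bar>y\<bar>)) / (1 + \<bar>y\<bar>)) = 2 * integral {d..\<kappa>} (\<lambda>\<sigma>. \<mu> \<sigma> / \<sigma>)"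
    unfolding d_def using T pos by (intro integral_modulus_weight \<mu> \<kappa>) auto
  also have "integral {d..\<kappa>} (\<lambda>\<sigma>. \<mu> \<sigma> / \<sigma>) = dini_H \<mu> \<tau>\<^sub>0 d - dini_H \<mu> \<tau>\<^sub>0 \<kappa>"
    by (rule dini_H_diff[OF \<mu> d(2,3) \<kappa>(2), symmetric])
  also have "\<dots> \<le> k1 / \<epsilon>"
    using dini_H_antimono[OF \<mu> \<eta>(1) d(1), of \<tau>\<^sub>0] d(3) \<kappa>(2) \<eta>(3) by (simp add: Y_def inverse_eq_divide)
  finally show ?thesis by (simp add: \<kappa>_def)
qed

section \<open>Initial data\<close>

lemma bounded_if_support_bounded:
  fixes f :: "real \<Rightarrow> real"
  assumes "continuous_on {0..} f" "\<And>r. R < r \<Longrightarrow> f r = 0"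
  shows "\<exists>M. \<forall>r\<ge>0. \<bar>f r\<bar> \<le> M"
proof -
  have "compact (f ` {0..R})"
    using assms(1) by (intro compact_continuous_image) (auto intro: continuous_on_subset)
  then obtain M where M: "\<And>r. r \<in> {0..R} \<Longrightarrow> \<bar>f r\<bar> \<le> M"
    using compact_imp_bounded[of "f ` {0..R}"] by (force simp: bounded_iff)
  have "\<bar>f r\<bar> \<le> max M 0" if "0 \<le> r" for r
    using M[of r] assms(2)[of r] that by (cases "r \<le> R") auto
  then show ?thesis by blast
qed

lemma deriv_within_eq_0_outside_support:
  assumes R: "0 < R" and f: "\<And>r. R < r \<Longrightarrow> f r = 0" and r: "R < r"
  shows "deriv_within {0..} f r = 0"
proof (rule deriv_within_eqI)
  have "(f has_real_derivative 0) (at r)"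
    by (rule has_field_derivative_transform_within_open[of "\<lambda>_. 0" _ _ "{R<..}"]) (use f r in auto)
  then show "(f has_real_derivative 0) (at r within {0..})" by (rule has_field_derivative_at_within)
  show "at r within {0..} \<noteq> bot" using R r by (intro at_within_Ici_neq_bot) auto
qed

lemma mean_scaled: "mean (\<lambda>y. c * f y) r = c * mean f r"
  by (simp add: mean_def)

text \<open>
  Initial data at unit size, before multiplication by \<open>\<epsilon>\<close>.
\<close>

locale radial_data =
  fixes f0 f1 :: "real \<Rightarrow> real" and R :: real
  assumes R: "R > 0"
    and f0: "Ck_on 2 {0..} f0" and f1: "Ck_on 1 {0..} f1"
    and s0: "closure (support_on {0..} f0) \<subseteq> {0..R}"
    and s1: "closure (support_on {0..} f1) \<subseteq> {0..R}"
    and f0': "deriv_within {0..} f0 0 = 0"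
begin

abbreviation "f0_r \<equiv> deriv_within {0..} f0"
abbreviation "f0_rr \<equiv> deriv_within {0..} f0_r"
abbreviation "f1_r \<equiv> deriv_within {0..} f1"

lemma data_derivatives:
  "\<And>r. 0 \<le> r \<Longrightarrow> (f0 has_real_derivative f0_r r) (at r within {0..})"
  "\<And>r. 0 \<le> r \<Longrightarrow> (f0_r has_real_derivative f0_rr r) (at r within {0..})"
  "\<And>r. 0 \<le> r \<Longrightarrow> (f1 has_real_derivative f1_r r) (at r within {0..})"
  using f0 f1 by (auto simp: numeral_2_eq_2 intro!: has_real_derivative_deriv_within)

lemma data_continuous:
  "continuous_on {0..} f0" "continuous_on {0..} f0_r" "continuous_on {0..} f0_rr"
  "continuous_on {0..} f1" "continuous_on {0..} f1_r"
  using f0 f1 by (auto simp: numeral_2_eq_2 differentiable_imp_continuous_on)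

lemma data_vanish:
  assumes "R < r"
  shows "f0 r = 0" "f0_r r = 0" "f0_rr r = 0" "f1 r = 0" "f1_r r = 0"
proof -
  have z: "f r = 0" if s: "closure (support_on {0..} f) \<subseteq> {0..R}" and r: "R < r" for f :: "real \<Rightarrow> real" and r
  proof (rule ccontr)
    assume "f r \<noteq> 0"
    then have "r \<in> support_on {0..} f" using R r by (simp add: support_on_def)
    then have "r \<in> {0..R}" using s closure_subset by blast
    then show False using r by simp
  qed
  note z0 = z[OF s0] and z1 = z[OF s1]
  have z2: "f0_r r = 0" if "R < r" for r by (rule deriv_within_eq_0_outside_support[OF R z0 that])
  show "f0 r = 0" "f0_r r = 0" "f1 r = 0" using z0 z1 z2 assms by blast+
  show "f0_rr r = 0" using R z2 assms by (rule deriv_within_eq_0_outside_support)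
  show "f1_r r = 0" using R z1 assms by (rule deriv_within_eq_0_outside_support)
qed

lemma data_norm_bounds:
  assumes "0 \<le> r"
  shows "\<bar>f0 r\<bar> \<le> data_norm f0 f1" "\<bar>f0_r r\<bar> \<le> data_norm f0 f1" "\<bar>f0_rr r\<bar> \<le> data_norm f0 f1"
    "\<bar>f1 r\<bar> \<le> data_norm f0 f1" "\<bar>f1_r r\<bar> \<le> data_norm f0 f1"
proof -
  let ?g = "\<lambda>r. Max {\<bar>f0 r\<bar>, \<bar>f0_r r\<bar>, \<bar>f0_rr r\<bar>, \<bar>f1 r\<bar>, \<bar>f1_r r\<bar>}"
  have "\<exists>M. \<forall>r\<ge>0. \<bar>f r\<bar> \<le> M" if "f \<in> {f0, f0_r, f0_rr, f1, f1_r}" for f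
    using that bounded_if_support_bounded[of f R] data_continuous data_vanish by auto
  then obtain M where M: "\<And>f r. f \<in> {f0, f0_r, f0_rr, f1, f1_r} \<Longrightarrow> 0 \<le> r \<Longrightarrow> \<bar>f r\<bar> \<le> M f"
    by metis
  define B where "B = Max (M ` {f0, f0_r, f0_rr, f1, f1_r})"
  have B: "\<bar>f r\<bar> \<le> B" if "f \<in> {f0, f0_r, f0_rr, f1, f1_r}" "0 \<le> r" for f r
    unfolding B_def by (rule order_trans[OF M[OF that] Max_ge]) (use that in blast)+
  have "bdd_above (?g ` {0..})"
  proof (rule bdd_aboveI2)
    show "?g r \<le> B" if "r \<in> {0..}" for r
    proof (rule Max.boundedI)
      fix x assume "x \<in> {\<bar>f0 r\<bar>, \<bar>f0_r r\<bar>, \<bar>f0_rr r\<bar>, \<bar>f1 r\<bar>, \<bar>f1_r r\<bar>}"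
      then obtain f where "f \<in> {f0, f0_r, f0_rr, f1, f1_r}" "x = \<bar>f r\<bar>" by blast
      then show "x \<le> B" using B that by (simp only: atLeast_iff)
    qed simp_all
  qed
  then have "?g r \<le> (SUP r\<in>{0..}. ?g r)" by (rule cSUP_upper[rotated]) (use assms in simp)
  also have "\<dots> = data_norm f0 f1" by (simp only: data_norm_def numeral_2_eq_2 funpow.simps o_def id_apply)
  finally have *: "?g r \<le> data_norm f0 f1" .
  have "x \<le> data_norm f0 f1" if "x \<in> {\<bar>f0 r\<bar>, \<bar>f0_r r\<bar>, \<bar>f0_rr r\<bar>, \<bar>f1 r\<bar>, \<bar>f1_r r\<bar>}" for x
    by (rule order_trans[OF Max_ge[OF _ that] *]) simp
  then show "\<bar>f0 r\<bar> \<le> data_norm f0 f1" "\<bar>f0_r r\<bar> \<le> data_norm f0 f1" "\<bar>f0_rr r\<bar> \<le> data_norm f0 f1"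
    "\<bar>f1 r\<bar> \<le> data_norm f0 f1" "\<bar>f1_r r\<bar> \<le> data_norm f0 f1" by blast+
qed

text \<open>
  The value of \<open>v\<^sub>t + v\<^sub>r\<close> at time zero for the odd extension of \<open>v = r u\<close>: the even part is \<open>(r f0)'\<close> and the odd
  part is \<open>r f1\<close>.
\<close>

definition a\<^sub>1 :: "real \<Rightarrow> real" where
  "a\<^sub>1 p = (f0 \<bar>p\<bar> + \<bar>p\<bar> * f0_r \<bar>p\<bar>) + sgn p * (\<bar>p\<bar> * f1 \<bar>p\<bar>)"

definition \<alpha>\<^sub>1 :: "real \<Rightarrow> real" where
  "\<alpha>\<^sub>1 p = sgn p * (2 * f0_r \<bar>p\<bar> + \<bar>p\<bar> * f0_rr \<bar>p\<bar>) + (f1 \<bar>p\<bar> + \<bar>p\<bar> * f1_r \<bar>p\<bar>)"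

lemma a1_has_derivative: "(a\<^sub>1 has_real_derivative \<alpha>\<^sub>1 p) (at p)"
  unfolding a\<^sub>1_def[abs_def] \<alpha>\<^sub>1_def
  by (rule even_odd_extension_has_derivative[where E="\<lambda>r. f0 r + r * f0_r r" and H="\<lambda>r. r * f1 r"
        and E'="\<lambda>r. 2 * f0_r r + r * f0_rr r" and H'="\<lambda>r. f1 r + r * f1_r r"])
     (auto intro!: derivative_eq_intros data_derivatives simp: f0')

lemma continuous_alpha1: "continuous_on UNIV \<alpha>\<^sub>1"
  unfolding \<alpha>\<^sub>1_def[abs_def]
  by (rule continuous_on_odd_even_extension[where E="\<lambda>r. 2 * f0_r r + r * f0_rr r" and H="\<lambda>r. f1 r + r * f1_r r"])
     (auto intro!: continuous_intros data_continuous simp: f0')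

text \<open>
  The odd part of \<open>a\<^sub>1\<close> has mean zero, and the even part has the primitive \<open>p f0(\<bar>p\<bar>)\<close>. Together with the
  corresponding fact for \<open>\<alpha>\<^sub>1\<close> this recovers the initial conditions for \<open>u\<close> and \<open>u\<^sub>t\<close>.
\<close>

lemma mean_a1:
  assumes r: "0 \<le> r"
  shows "mean a\<^sub>1 r = f0 r"
proof -
  let ?E = "\<lambda>p. f0 \<bar>p\<bar> + \<bar>p\<bar> * f0_r \<bar>p\<bar>" and ?H = "\<lambda>p. sgn p * (\<bar>p\<bar> * f1 \<bar>p\<bar>)"
  have cE: "continuous_on UNIV ?E"
    by (intro continuous_intros continuous_on_compose2[OF data_continuous(1)] continuous_on_compose2[OF data_continuous(2)]) auto
  have "continuous_on {0..} (\<lambda>r. r * f1 r)" by (intro continuous_intros data_continuous)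
  then have cH: "continuous_on UNIV ?H"
    using continuous_on_odd_even_extension[of "\<lambda>r. r * f1 r" "\<lambda>_. 0"] by simp
  have "mean a\<^sub>1 r = mean ?E r + mean ?H r"
    unfolding a\<^sub>1_def[abs_def] by (rule mean_add[OF cE cH])
  also have "mean ?H r = 0" by (rule mean_odd_eq_0) (simp add: sgn_minus)
  also have "mean ?E r + 0 = f0 r"
  proof (cases "r = 0")
    case False
    have "((\<lambda>p. 0 + sgn p * (\<bar>p\<bar> * f0 \<bar>p\<bar>)) has_real_derivative sgn p * 0 + ?E p) (at p)" for p
      by (rule even_odd_extension_has_derivative[where E="\<lambda>r. 0" and H="\<lambda>r. r * f0 r"
            and E'="\<lambda>r. 0" and H'="\<lambda>r. f0 r + r * f0_r r"])
         (auto intro!: derivative_eq_intros data_derivatives)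
    then have "((\<lambda>p. sgn p * (\<bar>p\<bar> * f0 \<bar>p\<bar>)) has_real_derivative ?E p) (at p)" for p by simp
    from radius_times_mean[of _ ?E, OF this, of r] show ?thesis
      using False r by (simp add: sgn_minus sgn_if)
  qed simp
  finally show ?thesis .
qed

lemma mean_alpha1:
  assumes r: "0 \<le> r"
  shows "mean \<alpha>\<^sub>1 r = f1 r"
proof (cases "r = 0")
  case True
  then show ?thesis by (simp add: \<alpha>\<^sub>1_def)
next
  case False
  have "r * mean \<alpha>\<^sub>1 r = (a\<^sub>1 r - a\<^sub>1 (- r)) / 2"
    by (rule radius_times_mean[OF a1_has_derivative])
  also have "\<dots> = r * f1 r" using False r by (simp add: a\<^sub>1_def sgn_if)
  finally show ?thesis using False by simp
qed

lemma data_vanish_line: "R < \<bar>p\<bar> \<Longrightarrow> a\<^sub>1 p = 0 \<and> \<alpha>\<^sub>1 p = 0"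
  using data_vanish[of "\<bar>p\<bar>"] by (simp add: a\<^sub>1_def \<alpha>\<^sub>1_def)

lemma data_norm_nonneg: "0 \<le> data_norm f0 f1"
  using data_norm_bounds(1)[of 0] by linarith

lemma data_bound_line: "\<bar>a\<^sub>1 p\<bar> \<le> (3 + 2 * R) * data_norm f0 f1" "\<bar>\<alpha>\<^sub>1 p\<bar> \<le> (3 + 2 * R) * data_norm f0 f1"
proof -
  let ?D = "data_norm f0 f1"
  note D0 = data_norm_nonneg
  have "\<bar>a\<^sub>1 p\<bar> \<le> (3 + 2 * R) * ?D \<and> \<bar>\<alpha>\<^sub>1 p\<bar> \<le> (3 + 2 * R) * ?D"
  proof (cases "R < \<bar>p\<bar>")
    case True
    then show ?thesis using data_vanish_line[OF True] D0 R by simp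
  next
    case False
    define q where "q = \<bar>p\<bar>"
    have q: "0 \<le> q" "q \<le> R" using False by (auto simp: q_def)
    note b = data_norm_bounds[OF q(1)]
    have qb: "\<bar>q * x\<bar> \<le> R * ?D" if "\<bar>x\<bar> \<le> ?D" for x
      unfolding abs_mult using that q by (intro mult_mono) auto
    have sb: "\<bar>sgn p * x\<bar> \<le> \<bar>x\<bar>" for x by (simp add: abs_mult sgn_if)
    have "\<bar>a\<^sub>1 p\<bar> \<le> \<bar>f0 q\<bar> + \<bar>q * f0_r q\<bar> + \<bar>q * f1 q\<bar>"
      unfolding a\<^sub>1_def q_def[symmetric]
      using sb[of "q * f1 q"] abs_triangle_ineq[of "f0 q + q * f0_r q" "sgn p * (q * f1 q)"]
        abs_triangle_ineq[of "f0 q" "q * f0_r q"] by linarith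
    also have "\<dots> \<le> ?D + R * ?D + R * ?D" by (intro add_mono b qb)
    also have "\<dots> \<le> (3 + 2 * R) * ?D" using D0 by (simp add: algebra_simps)
    finally have 1: "\<bar>a\<^sub>1 p\<bar> \<le> (3 + 2 * R) * ?D" .
    have "\<bar>\<alpha>\<^sub>1 p\<bar> \<le> 2 * \<bar>f0_r q\<bar> + \<bar>q * f0_rr q\<bar> + (\<bar>f1 q\<bar> + \<bar>q * f1_r q\<bar>)"
      unfolding \<alpha>\<^sub>1_def q_def[symmetric]
      using sb[of "2 * f0_r q + q * f0_rr q"] abs_triangle_ineq[of "2 * f0_r q" "q * f0_rr q"]
        abs_triangle_ineq[of "f1 q" "q * f1_r q"]
        abs_triangle_ineq[of "sgn p * (2 * f0_r q + q * f0_rr q)" "f1 q + q * f1_r q"] by linarith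
    also have "\<dots> \<le> 2 * ?D + R * ?D + (?D + R * ?D)" by (intro add_mono mult_left_mono b qb) simp
    also have "\<dots> = (3 + 2 * R) * ?D" by (simp add: algebra_simps)
    finally show ?thesis using 1 by simp
  qed
  then show "\<bar>a\<^sub>1 p\<bar> \<le> (3 + 2 * R) * ?D" "\<bar>\<alpha>\<^sub>1 p\<bar> \<le> (3 + 2 * R) * ?D" by auto
qed

text \<open>
  The solution has size \<open>Q = amplitude * \<epsilon>\<close>; the factor \<open>6 R\<close> compensates the division by \<open>6 R\<close> in the bound
  required of the data on the line. It is proportional to the norm of the data, so vanishing data give \<open>Q = 0\<close>.
\<close>

definition amplitude :: real where
  "amplitude = 6 * R * ((3 + 2 * R) * data_norm f0 f1)"

lemma amplitude_nonneg: "0 \<le> amplitude"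
  using R data_norm_nonneg by (simp add: amplitude_def)

lemma solution_up_to_T:
  assumes \<mu>: "modulus_of_continuity \<mu>" "symbol_like \<mu>" and T: "0 < T" and \<epsilon>: "0 < \<epsilon>"
    and \<kappa>: "2 * amplitude * \<epsilon> / R \<le> \<kappa>"
    and small: "28 * (amplitude * \<epsilon>) * (integral {-(2*T+R)..2*T+R} (\<lambda>y. \<mu> (\<kappa> / (1 + \<bar>y\<bar>)) / (1 + \<bar>y\<bar>)) + 8 * \<mu> \<kappa>) \<le> R"
  shows "\<exists>u. classical_solution \<mu> (\<lambda>r. \<epsilon> * f0 r) (\<lambda>r. \<epsilon> * f1 r) T u \<and>
    closure (support_on ({0..T} \<times> {0..}) (\<lambda>(t, r). u t r)) \<subseteq> {(t, r). t \<in> {0..T} \<and> r \<ge> 0 \<and> r \<le> t + R} \<and>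
    (\<forall>t\<in>{0..T}. \<forall>r\<in>{0..t + R}.
      (\<forall>a b. a + b \<le> 1 \<longrightarrow> \<bar>pd T a b u t r\<bar> \<le> 2 * (amplitude * \<epsilon>) * inverse (t - r + 2 * R)) \<and>
      (\<forall>a b. 1 \<le> a + b \<and> a + b \<le> 2 \<longrightarrow>
        \<bar>pd T a b (\<lambda>t r. r * u t r) t r\<bar> \<le> 2 * (amplitude * \<epsilon>) * inverse (t - r + 2 * R)))"
proof -
  interpret small_data_wave T R "amplitude * \<epsilon>" \<kappa> \<mu> "\<lambda>p. \<epsilon> * a\<^sub>1 p" "\<lambda>p. \<epsilon> * \<alpha>\<^sub>1 p"
  proof
    show "((\<lambda>p. \<epsilon> * a\<^sub>1 p) has_real_derivative \<epsilon> * \<alpha>\<^sub>1 p) (at p)" for p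
      by (rule DERIV_cmult[OF a1_has_derivative])
    show "continuous_on UNIV (\<lambda>p. \<epsilon> * \<alpha>\<^sub>1 p)" by (intro continuous_intros continuous_alpha1)
    show "\<epsilon> * a\<^sub>1 p = 0 \<and> \<epsilon> * \<alpha>\<^sub>1 p = 0" if "R < \<bar>p\<bar>" for p using data_vanish_line[OF that] by simp
    have "amplitude * \<epsilon> / (6 * R) = \<epsilon> * ((3 + 2 * R) * data_norm f0 f1)" using R by (simp add: amplitude_def)
    then show "\<bar>\<epsilon> * a\<^sub>1 p\<bar> \<le> amplitude * \<epsilon> / (6 * R)" "\<bar>\<epsilon> * \<alpha>\<^sub>1 p\<bar> \<le> amplitude * \<epsilon> / (6 * R)" for p
      using mult_left_mono[OF data_bound_line(1)[of p], of \<epsilon>] mult_left_mono[OF data_bound_line(2)[of p], of \<epsilon>] \<epsilon>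
      by (simp_all add: abs_mult)
  qed (use T R \<epsilon> \<kappa> \<mu> small amplitude_nonneg in \<open>simp_all add: mult.assoc\<close>)
  show ?thesis
    by (rule classical_solution_exists)
       (simp_all add: mean_scaled mean_a1 mean_alpha1 data_vanish)
qed

text \<open>
  The two summands get \<open>R / 2\<close> each: the first because of the size of \<open>k1\<close>, the second because \<open>\<epsilon>\<close> is small
  compared with \<open>1 / \<mu>(k2)\<close>.
\<close>

lemma smallness_from_constants:
  assumes "0 < \<epsilon>" "\<epsilon> \<le> R / (448 * (amplitude + 1) * (m + 1))" "0 \<le> x" "x \<le> m"
    "i \<le> 2 * (R / (112 * (amplitude + 1))) / \<epsilon>"
  shows "28 * (amplitude * \<epsilon>) * (i + 8 * x) \<le> R"
proof -
  note A = amplitude_nonneg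
  have "28 * (amplitude * \<epsilon>) * i \<le> 28 * (amplitude * \<epsilon>) * (2 * (R / (112 * (amplitude + 1))) / \<epsilon>)"
    using assms A by (intro mult_left_mono) auto
  also have "\<dots> = R / 2 * (amplitude / (amplitude + 1))"
  proof -
    have "28 * (a * e) * (2 * (R / (112 * b)) / e) = R / 2 * (a / b)" if "0 < e" for a b e :: real
      using that by simp
    then show ?thesis using \<open>0 < \<epsilon>\<close> .
  qed
  also have "\<dots> \<le> R / 2 * 1" using R A by (intro mult_left_mono) auto
  finally have 1: "28 * (amplitude * \<epsilon>) * i \<le> R / 2" by simp
  have pos: "0 < 448 * (amplitude + 1) * (m + 1)" using A assms(3,4) by (intro mult_pos_pos) auto
  have "28 * (amplitude * \<epsilon>) * (8 * x) = 224 * (amplitude * x) * \<epsilon>" by simp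
  also have "\<dots> \<le> 224 * ((amplitude + 1) * (m + 1)) * \<epsilon>"
    using assms A by (intro mult_right_mono mult_left_mono mult_mono) auto
  also have "\<dots> = 448 * (amplitude + 1) * (m + 1) * \<epsilon> / 2" by simp
  also have "\<dots> \<le> R / 2" using assms(2) pos by (simp add: le_divide_eq mult.commute)
  finally show ?thesis using 1 by (simp add: distrib_left)
qed

end

section \<open>Existence, uniqueness and lifespan\<close>

theorem proposition2p2:
  fixes f0 f1 :: "real \<Rightarrow> real" and R :: real
  assumes "R > 0"
    and "Ck_on 2 {0..} f0" and "Ck_on 1 {0..} f1"
    and "closure (support_on {0..} f0) \<subseteq> {0..R}"
    and "closure (support_on {0..} f1) \<subseteq> {0..R}"
    and "deriv_within {0..} f0 0 = 0"
  shows "\<exists>K>0. \<exists>k1>0. \<exists>k2>0. \<forall>(\<mu> :: real \<Rightarrow> real) (\<tau>\<^sub>0 :: real).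
    modulus_of_continuity \<mu> \<and> \<not> dini \<mu> \<and> symbol_like \<mu> \<and> \<tau>\<^sub>0 > 0 \<longrightarrow>
    (\<exists>\<epsilon>\<^sub>0>0. k2 * \<epsilon>\<^sub>0 \<le> \<tau>\<^sub>0 \<and> (\<exists>C>0. \<forall>\<epsilon>\<in>{0<..\<epsilon>\<^sub>0}.
      (\<forall>T>0. T \<le> K * \<epsilon> * inverse (dini_H_inv \<mu> \<tau>\<^sub>0 (k1 * inverse \<epsilon> + dini_H \<mu> \<tau>\<^sub>0 (k2 * \<epsilon>))) \<longrightarrow>
        (\<exists>u. classical_solution \<mu> (\<lambda>r. \<epsilon> * f0 r) (\<lambda>r. \<epsilon> * f1 r) T u \<and>
          (\<forall>w. classical_solution \<mu> (\<lambda>r. \<epsilon> * f0 r) (\<lambda>r. \<epsilon> * f1 r) T w \<longrightarrow>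
            (\<forall>t\<in>{0..T}. \<forall>r\<ge>0. w t r = u t r)) \<and>
          closure (support_on ({0..T} \<times> {0..}) (\<lambda>(t, r). u t r))
            \<subseteq> {(t, r). t \<in> {0..T} \<and> r \<ge> 0 \<and> r \<le> t + R} \<and>
          (\<forall>t\<in>{0..T}. \<forall>r\<in>{0..t + R}.
            (\<forall>a b. a + b \<le> 1 \<longrightarrow>
              \<bar>pd T a b u t r\<bar> \<le> C * (\<epsilon> * data_norm f0 f1 * inverse (t - r + 2 * R))) \<and>
            (\<forall>a b. 1 \<le> a + b \<and> a + b \<le> 2 \<longrightarrow>
              \<bar>pd T a b (\<lambda>t r. r * u t r) t r\<bar>
                \<le> C * (\<epsilon> * data_norm f0 f1 * inverse (t - r + 2 * R)))))) \<and>
      lifespan \<mu> (\<lambda>r. \<epsilon> * f0 r) (\<lambda>r. \<epsilon> * f1 r)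
        \<ge> ereal (K * \<epsilon> * inverse (dini_H_inv \<mu> \<tau>\<^sub>0 (k1 * inverse \<epsilon> + dini_H \<mu> \<tau>\<^sub>0 (k2 * \<epsilon>))))))"
proof -
  interpret radial_data f0 f1 R using assms by unfold_locales
  \<comment> \<open>The integral of the weight is at most \<open>2 k1 / \<epsilon>\<close>, so \<open>k1\<close> must satisfy \<open>56 * amplitude * k1 \<le> R / 2\<close>; \<open>k2\<close> makes \<open>\<kappa> = k2 \<epsilon> \<ge> 2 Q / R\<close>. The summands \<open>1\<close> keep both positive when the data vanish.\<close>
  define k1 where "k1 = R / (112 * (amplitude + 1))"
  define k2 where "k2 = 2 * amplitude / R + 1"
  define C where "C = 2 * (6 * R * (3 + 2 * R))"
  note A = amplitude_nonneg
  have k: "0 < k1" "0 < k2" "0 < C" using A R by (auto simp: k1_def k2_def C_def add_nonneg_pos)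
  show ?thesis
  proof (rule exI[of _ "k2 / 4"], rule conjI, use k in simp, rule exI[of _ k1], rule conjI, rule k,
      rule exI[of _ k2], rule conjI, rule k, intro allI impI, elim conjE)
    fix \<mu> :: "real \<Rightarrow> real" and \<tau>\<^sub>0 :: real
    assume \<mu>: "modulus_of_continuity \<mu>" and nd: "\<not> dini \<mu>" and sl: "symbol_like \<mu>" and \<tau>\<^sub>0: "\<tau>\<^sub>0 > 0"
    define m where "m = \<mu> k2"
    have m: "0 \<le> m" using modulusD(3)[OF \<mu>, of k2] k by (simp add: m_def)
    \<comment> \<open>In order: \<open>\<epsilon> \<le> 1\<close> gives \<open>\<mu> (k2 \<epsilon>) \<le> m\<close>; \<open>k2 \<epsilon>\<close> lies in the domain of \<open>H\<close>; the hypothesis of \<open>weight_integral_le\<close>; the hypothesis of \<open>smallness_from_constants\<close>.\<close>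
    define \<epsilon>\<^sub>0 where "\<epsilon>\<^sub>0 = Min {1, \<tau>\<^sub>0 / k2, k1 / (2 * (1 + R) * (m + 1)), R / (448 * (amplitude + 1) * (m + 1))}"
    have \<epsilon>\<^sub>0_pos: "0 < \<epsilon>\<^sub>0" using A R k m \<tau>\<^sub>0 by (simp add: \<epsilon>\<^sub>0_def)
    have \<epsilon>\<^sub>0_le: "\<epsilon>\<^sub>0 \<le> 1" "\<epsilon>\<^sub>0 \<le> \<tau>\<^sub>0 / k2" "\<epsilon>\<^sub>0 \<le> k1 / (2 * (1 + R) * (m + 1))"
      "\<epsilon>\<^sub>0 \<le> R / (448 * (amplitude + 1) * (m + 1))"
      by (simp_all add: \<epsilon>\<^sub>0_def)
    define bound where "bound \<epsilon> = k2 / 4 * \<epsilon> * inverse (dini_H_inv \<mu> \<tau>\<^sub>0 (k1 * inverse \<epsilon> + dini_H \<mu> \<tau>\<^sub>0 (k2 * \<epsilon>)))" for \<epsilon>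
    let ?Sol = "\<lambda>C \<epsilon> T. \<exists>u. classical_solution \<mu> (\<lambda>r. \<epsilon> * f0 r) (\<lambda>r. \<epsilon> * f1 r) T u \<and>
          (\<forall>w. classical_solution \<mu> (\<lambda>r. \<epsilon> * f0 r) (\<lambda>r. \<epsilon> * f1 r) T w \<longrightarrow>
            (\<forall>t\<in>{0..T}. \<forall>r\<ge>0. w t r = u t r)) \<and>
          closure (support_on ({0..T} \<times> {0..}) (\<lambda>(t, r). u t r))
            \<subseteq> {(t, r). t \<in> {0..T} \<and> r \<ge> 0 \<and> r \<le> t + R} \<and>
          (\<forall>t\<in>{0..T}. \<forall>r\<in>{0..t + R}.
            (\<forall>a b. a + b \<le> 1 \<longrightarrow>
              \<bar>pd T a b u t r\<bar> \<le> C * (\<epsilon> * data_norm f0 f1 * inverse (t - r + 2 * R))) \<and>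
            (\<forall>a b. 1 \<le> a + b \<and> a + b \<le> 2 \<longrightarrow>
              \<bar>pd T a b (\<lambda>t r. r * u t r) t r\<bar>
                \<le> C * (\<epsilon> * data_norm f0 f1 * inverse (t - r + 2 * R))))"
    have exist: "?Sol C \<epsilon> T"
      if \<epsilon>: "\<epsilon> \<in> {0<..\<epsilon>\<^sub>0}" and T: "0 < T" "T \<le> bound \<epsilon>" for \<epsilon> T
    proof -
      have \<epsilon>': "0 < \<epsilon>" "\<epsilon> \<le> \<epsilon>\<^sub>0" using \<epsilon> by auto
      define \<kappa> where "\<kappa> = k2 * \<epsilon>"
      have "k2 * \<epsilon> \<le> k2 * 1" using \<epsilon>' \<epsilon>\<^sub>0_le(1) k by (intro mult_left_mono) auto
      then have \<kappa>: "0 < \<kappa>" "\<kappa> \<le> k2" using \<epsilon>' k by (auto simp: \<kappa>_def)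
      have \<mu>\<kappa>: "0 \<le> \<mu> \<kappa>" "\<mu> \<kappa> \<le> m" using \<kappa> modulusD(3)[OF \<mu>] modulus_mono[OF \<mu>] by (auto simp: m_def)
      have le: "k2 * \<epsilon> \<le> \<tau>\<^sub>0" using order_trans[OF \<epsilon>'(2) \<epsilon>\<^sub>0_le(2)] k by (simp add: le_divide_eq mult.commute)
      have "2 * (1 + R) * \<mu> (k2 * \<epsilon>) \<le> k1 / \<epsilon>"
      proof -
        have "0 < 2 * (1 + R) * (m + 1)" using R m by simp
        then have "\<epsilon> * (2 * (1 + R) * (m + 1)) \<le> k1" using order_trans[OF \<epsilon>'(2) \<epsilon>\<^sub>0_le(3)] by (simp add: le_divide_eq)
        moreover have "\<epsilon> * (2 * (1 + R) * \<mu> \<kappa>) \<le> \<epsilon> * (2 * (1 + R) * (m + 1))"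
          using \<epsilon>' R \<mu>\<kappa> by (intro mult_left_mono) auto
        ultimately have "\<epsilon> * (2 * (1 + R) * \<mu> \<kappa>) \<le> k1" by (rule order_trans[rotated])
        then have "2 * (1 + R) * \<mu> \<kappa> \<le> k1 / \<epsilon>" using \<epsilon>'(1) by (subst le_divide_eq) (simp add: mult.commute)
        then show ?thesis by (simp only: \<kappa>_def)
      qed
      then have I: "integral {-(2*T+R)..2*T+R} (\<lambda>y. \<mu> (\<kappa> / (1 + \<bar>y\<bar>)) / (1 + \<bar>y\<bar>)) \<le> 2 * k1 / \<epsilon>"
        unfolding \<kappa>_def
        by (rule weight_integral_le[OF \<mu> nd \<tau>\<^sub>0 \<epsilon>'(1) k(1,2) R le _ T[unfolded bound_def]])
      have "2 * amplitude * \<epsilon> / R \<le> \<kappa>" using \<epsilon>' R by (simp add: \<kappa>_def k2_def distrib_right)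
      moreover have "28 * (amplitude * \<epsilon>) * (integral {-(2*T+R)..2*T+R} (\<lambda>y. \<mu> (\<kappa> / (1 + \<bar>y\<bar>)) / (1 + \<bar>y\<bar>)) + 8 * \<mu> \<kappa>) \<le> R"
        by (rule smallness_from_constants[OF \<epsilon>'(1) order_trans[OF \<epsilon>'(2) \<epsilon>\<^sub>0_le(4)] \<mu>\<kappa> I[unfolded k1_def]])
      ultimately obtain u where u: "classical_solution \<mu> (\<lambda>r. \<epsilon> * f0 r) (\<lambda>r. \<epsilon> * f1 r) T u"
        "closure (support_on ({0..T} \<times> {0..}) (\<lambda>(t, r). u t r)) \<subseteq> {(t, r). t \<in> {0..T} \<and> r \<ge> 0 \<and> r \<le> t + R}"
        "\<forall>t\<in>{0..T}. \<forall>r\<in>{0..t + R}.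
          (\<forall>a b. a + b \<le> 1 \<longrightarrow> \<bar>pd T a b u t r\<bar> \<le> 2 * (amplitude * \<epsilon>) * inverse (t - r + 2 * R)) \<and>
          (\<forall>a b. 1 \<le> a + b \<and> a + b \<le> 2 \<longrightarrow>
            \<bar>pd T a b (\<lambda>t r. r * u t r) t r\<bar> \<le> 2 * (amplitude * \<epsilon>) * inverse (t - r + 2 * R))"
        using solution_up_to_T[OF \<mu> sl T(1) \<epsilon>'(1)] by blast
      have eq: "2 * (amplitude * \<epsilon>) * x = C * (\<epsilon> * data_norm f0 f1 * x)" for x
        by (simp add: C_def amplitude_def)
      have "\<forall>w. classical_solution \<mu> (\<lambda>r. \<epsilon> * f0 r) (\<lambda>r. \<epsilon> * f1 r) T w \<longrightarrow> (\<forall>t\<in>{0..T}. \<forall>r\<ge>0. w t r = u t r)"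
        using classical_solution_unique[OF \<mu> sl T(1) u(1)] by blast
      with u(1,2) u(3)[unfolded eq] show ?thesis by blast
    qed
    have life: "ereal (bound \<epsilon>) \<le> lifespan \<mu> (\<lambda>r. \<epsilon> * f0 r) (\<lambda>r. \<epsilon> * f1 r)" if \<epsilon>: "\<epsilon> \<in> {0<..\<epsilon>\<^sub>0}" for \<epsilon>
    proof -
      have \<epsilon>': "0 < \<epsilon>" "k2 * \<epsilon> \<le> \<tau>\<^sub>0"
        using \<epsilon> order_trans[OF _ \<epsilon>\<^sub>0_le(2), of \<epsilon>] k by (auto simp: le_divide_eq mult.commute)
      have "dini_H \<mu> \<tau>\<^sub>0 \<tau>\<^sub>0 \<le> dini_H \<mu> \<tau>\<^sub>0 (k2 * \<epsilon>)" using \<epsilon>' k by (intro dini_H_antimono[OF \<mu>]) auto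
      then have "0 \<le> k1 * inverse \<epsilon> + dini_H \<mu> \<tau>\<^sub>0 (k2 * \<epsilon>)" using \<epsilon>' k by (simp add: dini_H_def)
      then have "0 < dini_H_inv \<mu> \<tau>\<^sub>0 (k1 * inverse \<epsilon> + dini_H \<mu> \<tau>\<^sub>0 (k2 * \<epsilon>))"
        using dini_H_inv(1)[OF \<mu> nd \<tau>\<^sub>0] by simp
      then have "0 < bound \<epsilon>" using \<epsilon>' k by (simp add: bound_def)
      then show ?thesis
        unfolding lifespan_def using exist[OF \<epsilon>, of "bound \<epsilon>"] by (intro Sup_upper) auto
    qed
    have "k2 * \<epsilon>\<^sub>0 \<le> \<tau>\<^sub>0" using \<epsilon>\<^sub>0_le(2) k by (simp add: le_divide_eq mult.commute)
    then show "\<exists>\<epsilon>\<^sub>0>0. k2 * \<epsilon>\<^sub>0 \<le> \<tau>\<^sub>0 \<and> (\<exists>C>0. \<forall>\<epsilon>\<in>{0<..\<epsilon>\<^sub>0}.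
      (\<forall>T>0. T \<le> k2 / 4 * \<epsilon> * inverse (dini_H_inv \<mu> \<tau>\<^sub>0 (k1 * inverse \<epsilon> + dini_H \<mu> \<tau>\<^sub>0 (k2 * \<epsilon>))) \<longrightarrow> ?Sol C \<epsilon> T) \<and>
      lifespan \<mu> (\<lambda>r. \<epsilon> * f0 r) (\<lambda>r. \<epsilon> * f1 r)
        \<ge> ereal (k2 / 4 * \<epsilon> * inverse (dini_H_inv \<mu> \<tau>\<^sub>0 (k1 * inverse \<epsilon> + dini_H \<mu> \<tau>\<^sub>0 (k2 * \<epsilon>)))))"
      unfolding bound_def[symmetric] using \<epsilon>\<^sub>0_pos k(3) exist life
      by (intro exI[of _ \<epsilon>\<^sub>0] exI[of _ C] conjI ballI allI impI)
  qed
qed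

end
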